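(* Let $a,m$ be integers with $1\le a\le m$, and let $\mathcal{L}(m,a):=\mathcal{L}_{3,2m}(m^8,a)$ be the linear system of surfaces of degree $2m$ in $\mathbb{P}^3$ having multiplicity at least $m$ at each of eight points $p_1,\dots,p_8$ and multiplicity at least $a$ at a ninth point $p_9$, where $p_1,\dots,p_9$ are in general position. Then $$\dim(\mathcal{L}(m,a))=m-a+1,\qquad h^1(\mathcal{L}(m,a))=\binom{a+1}{3}+\binom{a}{2}.$$ Hence $\mathcal{L}(m,a)$ is special if and only if $2\le a\le m$. Moreover the only special effect variety for $\mathcal{L}(m,a)$ is the unique quadric surface $Q$ through the nine points $p_1,\dots,p_9$, and $Q$ is contained in the base locus of $\mathcal{L}(m,a)$ with multiplicity exactly $a$.
   Context: We work over the complex numbers. $\mathcal{L}_{n,d}(m_1,\dots,m_s)$ denotes the linear system of hypersurfaces of degree $d$ in $\mathbb{P}^n$ with multiplicity at least $m_i$ at $p_i$, where $p_1,\dots,p_s$ are points in general position; $m^k$ means that the multiplicity $m$ is repeated $k$ times. Dimensions are affine (vector space) dimensions: $\dim(\mathcal{L})=h^0(\mathcal{L})$. The virtual dimension is $$\operatorname{vdim}(\mathcal{L})=\binom{n+d}{n}-\sum_{i=1}^s\binom{n+m_i-1}{n},$$ the expected dimension is $\operatorname{edim}(\mathcal{L})=\max(\operatorname{vdim}(\mathcal{L}),0)$, and $\mathcal{L}$ is special if $\dim(\mathcal{L})>\operatorname{edim}(\mathcal{L})$, non-special otherwise. $h^1(\mathcal{L})$ is the dimension of the first cohomology group of the line bundle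 $\mathcal{O}(dH-\sum_i m_iE_i)$ on the blow-up of $\mathbb{P}^n$ at $p_1,\dots,p_s$ ($H$ the hyperplane class, $E_i$ the exceptional divisors); since the higher cohomology groups vanish, $h^1(\mathcal{L})=\dim(\mathcal{L})-\operatorname{vdim}(\mathcal{L})$. A special effect variety for $\mathcal{L}$ is a variety whose containment, with multiplicity, in the base locus of $\mathcal{L}$ generates the speciality of $\mathcal{L}$. Here, that $Q$ (contained with multiplicity $a$) is the only special effect variety means that $\mathcal{L}(m,a)=aQ+\mathcal{L}_{3,2(m-a)}((m-a)^8)$ and that the residual system $\mathcal{L}_{3,2(m-a)}((m-a)^8)$, based at $p_1,\dots,p_8$, is non-special. *)

theory Defs
  imports
    "HOL-Analysis.Finite_Cartesian_Product"
    "HOL-Library.Poly_Mapping"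
    "HOL-Library.Numeral_Type"
    "HOL-Library.Extended_Nat"
    "HOL-Library.Function_Algebras"
    "HOL-Computational_Algebra.Factorial_Ring"
    "HOL-Computational_Algebra.Fraction_Field"
begin

section \<open>Polynomials and their multiplicity at a point\<close>

type_synonym 'v mpoly = "('v \<Rightarrow>\<^sub>0 nat) \<Rightarrow>\<^sub>0 complex"

definition Const :: "complex \<Rightarrow> 'v mpoly" where
  "Const c = Poly_Mapping.single 0 c"

definition Var :: "'v \<Rightarrow> 'v mpoly" where
  "Var j = Poly_Mapping.single (Poly_Mapping.single j 1) 1"

definition mon_degree :: "('v \<Rightarrow>\<^sub>0 nat) \<Rightarrow> nat" where
  "mon_degree t = (\<Sum>j\<in>Poly_Mapping.keys t. Poly_Mapping.lookup t j)"

definition homogeneous :: "nat \<Rightarrow> 'v mpoly \<Rightarrow> bool" where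
  "homogeneous d F \<longleftrightarrow> (\<forall>t\<in>Poly_Mapping.keys F. mon_degree t = d)"

definition substitute :: "(complex \<Rightarrow> 'r) \<Rightarrow> ('v \<Rightarrow> 'r) \<Rightarrow> 'v mpoly \<Rightarrow> 'r::comm_semiring_1" where
  "substitute \<iota> x F =
     (\<Sum>t\<in>Poly_Mapping.keys F. \<iota> (Poly_Mapping.lookup F t) *
        (\<Prod>j\<in>Poly_Mapping.keys t. x j ^ Poly_Mapping.lookup t j))"

text \<open>
  A point of projective space is represented by any nonzero vector \<open>v\<close> of homogeneous coordinates.
  The multiplicity of \<open>F\<close> at \<open>v\<close> is the lowest degree of a term of the Taylor expansion
  \<open>F(v + Y)\<close>. For a form \<open>F\<close> the affine cone over the hypersurface is, near \<open>v\<close>, the product of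
  the hypersurface with a line, so this is also the multiplicity computed in an affine chart of
  projective space; it does not depend on the representative \<open>v\<close>.
\<close>

definition mult_at_least :: "nat \<Rightarrow> 'n mpoly \<Rightarrow> complex ^ 'n \<Rightarrow> bool" where
  "mult_at_least k F v \<longleftrightarrow>
     (\<forall>t\<in>Poly_Mapping.keys (substitute Const (\<lambda>j. Const (v $ j) + Var j) F). k \<le> mon_degree t)"


section \<open>Linear systems\<close>

text \<open>
  The coordinates are indexed by \<open>'n\<close>, so the ambient space has dimension \<open>CARD('n) - 1\<close>. The
  system is kept as the vector space of its equations (the zero form included), that is, as
  \<open>H\<^sup>0\<close>. It is based at the points \<open>p i\<close>, \<open>i \<in> I\<close>, with multiplicities \<open>m i\<close>.
\<close>

definition linear_system ::
  "'i set \<Rightarrow> ('i \<Rightarrow> complex ^ 'n) \<Rightarrow> nat \<Rightarrow> ('i \<Rightarrow> nat) \<Rightarrow> 'n mpoly set" where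
  "linear_system I p d m = {F. homogeneous d F \<and> (\<forall>i\<in>I. mult_at_least (m i) F (p i))}"

definition dim_ls :: "'i set \<Rightarrow> ('i \<Rightarrow> complex ^ 'n) \<Rightarrow> nat \<Rightarrow> ('i \<Rightarrow> nat) \<Rightarrow> nat" where
  "dim_ls I p d m = vector_space.dim (\<lambda>c F. Const c * F) (linear_system I p d m)"

definition vdim :: "nat \<Rightarrow> 'i set \<Rightarrow> nat \<Rightarrow> ('i \<Rightarrow> nat) \<Rightarrow> int" where
  "vdim n I d m = int ((n + d) choose n) - (\<Sum>i\<in>I. int ((n + m i - 1) choose n))"

definition edim :: "nat \<Rightarrow> 'i set \<Rightarrow> nat \<Rightarrow> ('i \<Rightarrow> nat) \<Rightarrow> int" where
  "edim n I d m = max (vdim n I d m) 0"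

definition special :: "'i set \<Rightarrow> ('i \<Rightarrow> complex ^ 'n) \<Rightarrow> nat \<Rightarrow> ('i \<Rightarrow> nat) \<Rightarrow> bool" where
  "special I p d m \<longleftrightarrow> int (dim_ls I p d m) > edim (CARD('n) - 1) I d m"

text \<open>
  For an irreducible form \<open>q\<close>: the least multiplicity along \<open>q = 0\<close> of a member of \<open>L\<close> is \<open>a\<close>.
\<close>

definition base_multiplicity :: "'n mpoly \<Rightarrow> 'n mpoly set \<Rightarrow> nat \<Rightarrow> bool" where
  "base_multiplicity q L a \<longleftrightarrow> (\<forall>F\<in>L. q ^ a dvd F) \<and> (\<exists>F\<in>L. \<not> q ^ Suc a dvd F)"


section \<open>First cohomology of the line bundles on the blow-up\<close>

text \<open>
  Let \<open>X\<close> be the blow-up of projective space (of dimension at least \<open>2\<close>) at \<open>s\<close> distinct points,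
  \<open>s = card I\<close>. The space of global sections of \<open>O(eH - \<Sum> \<mu>\<^sub>i E\<^sub>i)\<close> on \<open>X\<close>, for \<open>\<mu>\<^sub>i \<ge> 0\<close>, is
  \<open>linear_system I p e \<mu>\<close>. The divisor \<open>A = (s+1)H - \<Sum> E\<^sub>i = H + \<Sum> (H - E\<^sub>i)\<close> is ample and base
  point free: each summand is base point free and no curve has intersection number \<open>0\<close> with all of
  them. Hence the nonvanishing loci \<open>X\<^sub>f\<close> of the nonzero sections \<open>f\<close> of \<open>A\<close> form an affine open cover
  of \<open>X\<close>, with \<open>X\<^sub>f \<inter> X\<^sub>g = X\<^bsub>fg\<^esub>\<close>, and the Cech complex of this cover computes the cohomology of
  every line bundle \<open>B\<close> on \<open>X\<close>.

  If \<open>f\<close> is a nonzero section of \<open>rA\<close>, then the sections of \<open>B\<close> over \<open>X\<^sub>f\<close> are the fractions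
  \<open>G / f\<^sup>k\<close> with \<open>G\<close> a global section of \<open>B + krA\<close>. Here \<open>B = O(dH - \<Sum> m\<^sub>i E\<^sub>i)\<close>, and all section
  spaces are regarded as subspaces of the fraction field of the homogeneous coordinate ring, so
  that restriction maps are inclusions.
\<close>

definition to_frac :: "'v::linorder mpoly \<Rightarrow> 'v mpoly fract" where
  "to_frac F = Fract F 1"

definition ample_cover :: "'i set \<Rightarrow> ('i \<Rightarrow> complex ^ 'n) \<Rightarrow> 'n mpoly set" where
  "ample_cover I p = linear_system I p (card I + 1) (\<lambda>_. 1) - {0}"

definition local_sections ::
  "'i set \<Rightarrow> ('i \<Rightarrow> complex ^ 'n::{finite,linorder}) \<Rightarrow> nat \<Rightarrow> ('i \<Rightarrow> nat) \<Rightarrow> nat \<Rightarrow> 'n mpoly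
     \<Rightarrow> 'n mpoly fract set" where
  "local_sections I p d m r f =
     {\<phi>. \<exists>k. \<exists>G\<in>linear_system I p (d + k * r * (card I + 1)) (\<lambda>i. m i + k * r).
            \<phi> = to_frac G / to_frac f ^ k}"

text \<open>
  Cochains are functions on all (pairs of) polynomials that vanish outside the index set of the cover.
\<close>

definition cochains0 ::
  "'i set \<Rightarrow> ('i \<Rightarrow> complex ^ 'n::{finite,linorder}) \<Rightarrow> nat \<Rightarrow> ('i \<Rightarrow> nat)
     \<Rightarrow> ('n mpoly \<Rightarrow> 'n mpoly fract) set" where
  "cochains0 I p d m =
     {h. (\<forall>f\<in>ample_cover I p. h f \<in> local_sections I p d m 1 f) \<and>
         (\<forall>f. f \<notin> ample_cover I p \<longrightarrow> h f = 0)}"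

definition cochains1 ::
  "'i set \<Rightarrow> ('i \<Rightarrow> complex ^ 'n::{finite,linorder}) \<Rightarrow> nat \<Rightarrow> ('i \<Rightarrow> nat)
     \<Rightarrow> ('n mpoly \<times> 'n mpoly \<Rightarrow> 'n mpoly fract) set" where
  "cochains1 I p d m =
     {g. (\<forall>f1\<in>ample_cover I p. \<forall>f2\<in>ample_cover I p.
            g (f1, f2) \<in> local_sections I p d m 2 (f1 * f2)) \<and>
         (\<forall>e. e \<notin> ample_cover I p \<times> ample_cover I p \<longrightarrow> g e = 0)}"

definition cocycles1 ::
  "'i set \<Rightarrow> ('i \<Rightarrow> complex ^ 'n::{finite,linorder}) \<Rightarrow> nat \<Rightarrow> ('i \<Rightarrow> nat)
     \<Rightarrow> ('n mpoly \<times> 'n mpoly \<Rightarrow> 'n mpoly fract) set" where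
  "cocycles1 I p d m =
     {g \<in> cochains1 I p d m.
        \<forall>f1\<in>ample_cover I p. \<forall>f2\<in>ample_cover I p. \<forall>f3\<in>ample_cover I p.
          g (f2, f3) - g (f1, f3) + g (f1, f2) = 0}"

definition coboundaries1 ::
  "'i set \<Rightarrow> ('i \<Rightarrow> complex ^ 'n::{finite,linorder}) \<Rightarrow> nat \<Rightarrow> ('i \<Rightarrow> nat)
     \<Rightarrow> ('n mpoly \<times> 'n mpoly \<Rightarrow> 'n mpoly fract) set" where
  "coboundaries1 I p d m =
     {g \<in> cochains1 I p d m. \<exists>h\<in>cochains0 I p d m.
        \<forall>f1\<in>ample_cover I p. \<forall>f2\<in>ample_cover I p. g (f1, f2) = h f2 - h f1}"

text \<open>
  The dimension of \<open>Z / B\<close> (possibly \<open>\<infinity>\<close>), for a subspace \<open>B\<close> of \<open>Z\<close>: the supremum of the sizes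
  of finite subsets of \<open>Z\<close> that are linearly independent modulo \<open>B\<close>.
\<close>

definition quotient_dim :: "(complex \<Rightarrow> 'a \<Rightarrow> 'a) \<Rightarrow> 'a::ab_group_add set \<Rightarrow> 'a set \<Rightarrow> enat" where
  "quotient_dim smul Z B =
     (SUP W\<in>{W. finite W \<and> W \<subseteq> Z \<and>
                (\<forall>c. (\<Sum>w\<in>W. smul (c w) w) \<in> B \<longrightarrow> (\<forall>w\<in>W. c w = 0))}. enat (card W))"

definition h1 ::
  "'i set \<Rightarrow> ('i \<Rightarrow> complex ^ 'n::{finite,linorder}) \<Rightarrow> nat \<Rightarrow> ('i \<Rightarrow> nat) \<Rightarrow> enat" where
  "h1 I p d m =
     quotient_dim (\<lambda>c g e. to_frac (Const c) * g e) (cocycles1 I p d m) (coboundaries1 I p d m)"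


section \<open>General position\<close>

text \<open>
  Every nonempty Zariski open subset of a product of projective spaces contains a nonempty one of
  the form \<open>G \<noteq> 0\<close> with \<open>G\<close> multihomogeneous. The variable \<open>(i, j)\<close> of \<open>G\<close> stands for the \<open>j\<close>-th
  coordinate of the \<open>i\<close>-th point, and \<open>\<delta> i\<close> is the degree of \<open>G\<close> in the coordinates of the \<open>i\<close>-th
  point.
\<close>

definition for_general_points ::
  "'i set \<Rightarrow> (('i \<Rightarrow> complex ^ 'n) \<Rightarrow> bool) \<Rightarrow> bool" where
  "for_general_points I P \<longleftrightarrow>
     (\<exists>(G :: ('i \<times> 'n) mpoly) \<delta>.
        G \<noteq> 0 \<and>
        (\<forall>t\<in>Poly_Mapping.keys G.
           Poly_Mapping.keys t \<subseteq> I \<times> UNIV \<and>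
           (\<forall>i\<in>I. (\<Sum>j\<in>UNIV. Poly_Mapping.lookup t (i, j)) = \<delta> i)) \<and>
        (\<forall>p. (\<forall>i\<in>I. p i \<noteq> 0) \<and> substitute (\<lambda>c. c) (\<lambda>(i, j). p i $ j) G \<noteq> 0 \<longrightarrow> P p))"

text \<open>The multiplicities \<open>(m\<^sup>8, a)\<close> at the points indexed by \<open>1, \<dots>, 9\<close>.\<close>

definition mults :: "nat \<Rightarrow> nat \<Rightarrow> nat \<Rightarrow> nat" where
  "mults m a = (\<lambda>i. if i = 9 then a else m)"

end

theory Submission
  imports Defs "HOL-Analysis.Cartesian_Space" "HOL-Computational_Algebra.Polynomial"
begin

text \<open>
  Call \<open>L(b)\<close> the system of forms of degree \<open>2 b\<close> with multiplicity \<open>b\<close> at the first eight points.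
  The theorem rests on two facts.

  The first is that \<open>L(b)\<close> is spanned by the products \<open>q\<^sup>i r\<^bsup>b - i\<^esup>\<close> of two quadrics generating the
  pencil through the eight points, and so has dimension \<open>b + 1\<close>. The products always lie in the system,
  so only an upper bound for the dimension is needed, and this may be proved for a single choice
  of the points (\<open>generically_linear_system\<close>). Eight points on the cuspidal quartic
  \<open>(1, t\<^sup>2, t\<^sup>3, t\<^sup>4)\<close> will do: on this curve a form of \<open>L(b)\<close> is a polynomial in \<open>t\<close> of degree at most
  \<open>8 b\<close> with eight prescribed roots of order \<open>b\<close> and, on account of the cusp, without linear term;
  for \<open>b > 0\<close> and positive roots it vanishes. (On a smooth elliptic quartic one would have to choose
  the points such that a certain line bundle is not torsion; the smooth part of the cuspidal curve is
  the additive group, which has no torsion.) The curve splits off from the restriction to a quadric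
  cone, hence a power of the other quadric does, and induction on \<open>b\<close> finishes the argument
  (\<open>special_system\<close>). If now \<open>q\<close> passes through the ninth point, where it is smooth, and \<open>r\<close> does not,
  then the multiplicity of \<open>\<Sum> c\<^sub>i q\<^sup>i r\<^bsup>m - i\<^esup>\<close> there is the least \<open>i\<close> with \<open>c\<^sub>i \<noteq> 0\<close>. So multiplicity \<open>a\<close>
  means divisibility by \<open>q\<^sup>a\<close>, and the quotient ranges over \<open>L(m - a)\<close> (\<open>nine_point_system\<close>).

  The second fact is that \<open>h\<^sup>1\<close> is the difference of dimension and virtual dimension
  (\<open>h1_eq_dim_minus_vdim\<close>), for fat points in a projective space of dimension at least three. A cocycle
  splits outside the points, because Koszul complexes on three general products of linear forms are
  exact (\<open>cocycle_splits\<close>). The splitting has no poles along the exceptional divisors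
  modulo the prescribed order of vanishing, where it is therefore given by jets of forms at the points
  (\<open>local_extension\<close>). In this way \<open>H\<^sup>1\<close> becomes the space of all tuples of jets modulo those that
  come from a global form, and its dimension is found by counting.
\<close>

abbreviation lookup where "lookup \<equiv> Poly_Mapping.lookup"
abbreviation keys where "keys \<equiv> Poly_Mapping.keys"

section \<open>Substitution as a ring homomorphism\<close>

definition eval_mon :: "('v \<Rightarrow> 'r::comm_semiring_1) \<Rightarrow> ('v \<Rightarrow>\<^sub>0 nat) \<Rightarrow> 'r" where
  "eval_mon x t = (\<Prod>j\<in>keys t. x j ^ lookup t j)"

lemma eval_mon_superset:
  assumes "finite A" "keys t \<subseteq> A"
  shows "eval_mon x t = (\<Prod>j\<in>A. x j ^ lookup t j)"
  unfolding eval_mon_def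
  by (rule prod.mono_neutral_left) (use assms in \<open>auto simp: in_keys_iff\<close>)

lemma eval_mon_0 [simp]: "eval_mon x 0 = 1"
  by (simp add: eval_mon_def)

lemma eval_mon_add: "eval_mon x (s + t) = eval_mon x s * eval_mon x t"
proof -
  let ?A = "keys s \<union> keys t"
  have "keys (s + t) \<subseteq> ?A" by (rule Poly_Mapping.keys_add)
  then show ?thesis
    by (simp add: eval_mon_superset[of ?A] lookup_add power_add prod.distrib)
qed

lemma eval_mon_single [simp]: "eval_mon x (Poly_Mapping.single j n) = x j ^ n"
  by (cases "n = 0") (auto simp: eval_mon_def)

lemma substitute_alt: "substitute \<iota> x F = (\<Sum>t\<in>keys F. \<iota> (lookup F t) * eval_mon x t)"
  by (simp add: substitute_def eval_mon_def)

lemma mon_degree_superset: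
  assumes "finite A" "keys t \<subseteq> A"
  shows "mon_degree t = (\<Sum>j\<in>A. lookup t j)"
  unfolding mon_degree_def
  by (rule sum.mono_neutral_left) (use assms in \<open>auto simp: in_keys_iff\<close>)

lemma mon_degree_add: "mon_degree (s + t) = mon_degree s + mon_degree t"
proof -
  let ?A = "keys s \<union> keys t"
  have "keys (s + t) \<subseteq> ?A" by (rule Poly_Mapping.keys_add)
  then show ?thesis
    by (simp add: mon_degree_superset[of ?A] lookup_add sum.distrib)
qed

lemma mon_degree_0 [simp]: "mon_degree 0 = 0"
  by (simp add: mon_degree_def)

lemma mon_degree_single [simp]: "mon_degree (Poly_Mapping.single j n) = n"
  by (cases "n = 0") (auto simp: mon_degree_def)

lemma mon_degree_eq_0_iff: "mon_degree t = 0 \<longleftrightarrow> t = 0"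
  by (auto simp: mon_degree_def in_keys_iff poly_mapping_eq_iff fun_eq_iff)

text \<open>
  The targets will be the polynomials themselves, the complex numbers, polynomials in one variable, and
  the function field.
\<close>

locale scalar_hom =
  fixes \<iota> :: "complex \<Rightarrow> 'r::comm_ring_1"
  assumes hom_0: "\<iota> 0 = 0" and hom_1: "\<iota> 1 = 1"
    and hom_add: "\<iota> (a + b) = \<iota> a + \<iota> b" and hom_mult: "\<iota> (a * b) = \<iota> a * \<iota> b"
begin

lemma substitute_superset:
  assumes "finite A" "keys F \<subseteq> A"
  shows "substitute \<iota> x F = (\<Sum>t\<in>A. \<iota> (lookup F t) * eval_mon x t)"
  unfolding substitute_alt
  by (rule sum.mono_neutral_left) (use assms in \<open>auto simp: in_keys_iff hom_0\<close>)

lemma substitute_0 [simp]: "substitute \<iota> x 0 = 0"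
  by (simp add: substitute_alt)

lemma substitute_single [simp]: "substitute \<iota> x (Poly_Mapping.single t c) = \<iota> c * eval_mon x t"
  by (cases "c = 0") (auto simp: substitute_alt hom_0)

lemma substitute_add [simp]: "substitute \<iota> x (F + G) = substitute \<iota> x F + substitute \<iota> x G"
proof -
  let ?A = "keys F \<union> keys G"
  have "keys (F + G) \<subseteq> ?A" by (rule Poly_Mapping.keys_add)
  then show ?thesis
    by (simp add: substitute_superset[of ?A] lookup_add hom_add sum.distrib distrib_right)
qed

lemma substitute_sum [simp]: "substitute \<iota> x (sum F A) = (\<Sum>a\<in>A. substitute \<iota> x (F a))"
  by (induction A rule: infinite_finite_induct) auto

end

lemma mpoly_expand: "F = (\<Sum>t\<in>keys F. Poly_Mapping.single t (lookup F t))"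
  by (rule poly_mapping_eqI) (auto simp: lookup_sum lookup_single when_def in_keys_iff)

context scalar_hom
begin

lemma substitute_mult [simp]: "substitute \<iota> x (F * G) = substitute \<iota> x F * substitute \<iota> x G"
proof -
  have 1: "substitute \<iota> x (Poly_Mapping.single t c * G) = \<iota> c * eval_mon x t * substitute \<iota> x G" for t c
  proof -
    have "substitute \<iota> x (Poly_Mapping.single t c * G)
        = substitute \<iota> x (Poly_Mapping.single t c * (\<Sum>s\<in>keys G. Poly_Mapping.single s (lookup G s)))"
      by (subst mpoly_expand[of G]) (rule refl)
    also have "\<dots> = (\<Sum>s\<in>keys G. \<iota> (c * lookup G s) * eval_mon x (t + s))"
      by (simp only: sum_distrib_left mult_single substitute_sum substitute_single)
    also have "\<dots> = \<iota> c * eval_mon x t * substitute \<iota> x G"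
      by (simp add: sum_distrib_left hom_mult eval_mon_add substitute_alt mult_ac)
    finally show ?thesis .
  qed
  have "substitute \<iota> x (F * G)
      = substitute \<iota> x ((\<Sum>t\<in>keys F. Poly_Mapping.single t (lookup F t)) * G)"
    by (subst mpoly_expand[of F]) (rule refl)
  also have "\<dots> = (\<Sum>t\<in>keys F. \<iota> (lookup F t) * eval_mon x t * substitute \<iota> x G)"
    by (simp only: sum_distrib_right 1 substitute_sum)
  also have "\<dots> = substitute \<iota> x F * substitute \<iota> x G"
    by (simp add: sum_distrib_right substitute_alt[of _ _ F])
  finally show ?thesis .
qed

lemma substitute_Const [simp]: "substitute \<iota> x (Const c) = \<iota> c"
  by (simp add: Const_def)

lemma substitute_Var [simp]: "substitute \<iota> x (Var j) = x j"
  by (simp add: Var_def hom_1)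

lemma substitute_1 [simp]: "substitute \<iota> x 1 = 1"
  using substitute_single[of x 0 1] by (simp add: hom_1)

lemma substitute_uminus [simp]: "substitute \<iota> x (- F) = - substitute \<iota> x F"
proof -
  have "substitute \<iota> x (- F) + substitute \<iota> x F = 0"
    unfolding substitute_add[symmetric] by simp
  then show ?thesis by (simp add: eq_neg_iff_add_eq_0)
qed

lemma substitute_diff [simp]: "substitute \<iota> x (F - G) = substitute \<iota> x F - substitute \<iota> x G"
  using substitute_add[of x F "- G"] by simp

lemma substitute_power [simp]: "substitute \<iota> x (F ^ n) = substitute \<iota> x F ^ n"
  by (induction n) auto

lemma substitute_prod [simp]: "substitute \<iota> x (prod F A) = (\<Prod>a\<in>A. substitute \<iota> x (F a))"
  by (induction A rule: infinite_finite_induct) auto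

end

lemma substitute_hom:
  fixes \<phi> :: "'r::comm_ring_1 \<Rightarrow> 's::comm_ring_1"
  assumes "\<phi> 0 = 0" "\<phi> 1 = 1" "\<And>a b. \<phi> (a + b) = \<phi> a + \<phi> b" "\<And>a b. \<phi> (a * b) = \<phi> a * \<phi> b"
  shows "\<phi> (substitute \<iota> x F) = substitute (\<lambda>c. \<phi> (\<iota> c)) (\<lambda>j. \<phi> (x j)) F"
proof -
  have s: "\<phi> (sum f A) = (\<Sum>a\<in>A. \<phi> (f a))" for f :: "('b \<Rightarrow>\<^sub>0 nat) \<Rightarrow> 'r" and A
    by (induction A rule: infinite_finite_induct) (auto simp: assms)
  have p: "\<phi> (prod f A) = (\<Prod>a\<in>A. \<phi> (f a))" for f :: "'b \<Rightarrow> 'r" and A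
    by (induction A rule: infinite_finite_induct) (auto simp: assms)
  have e: "\<phi> (a ^ n) = \<phi> a ^ n" for a n
    by (induction n) (auto simp: assms)
  show ?thesis by (simp add: substitute_def s p e assms)
qed

lemma Const_0 [simp]: "Const 0 = 0" and Const_1 [simp]: "Const 1 = 1"
  and Const_add: "Const (a + b) = Const a + Const b"
  and Const_mult: "Const (a * b) = Const a * Const b"
  by (simp_all add: Const_def single_add mult_single)

interpretation Csub: scalar_hom Const
  by unfold_locales (simp_all add: Const_add Const_mult)

interpretation eval: scalar_hom "\<lambda>c. c"
  by unfold_locales simp_all

lemma lookup_Const: "lookup (Const c) t = (if t = 0 then c else 0)"
  by (simp add: Const_def lookup_single when_def)

lemma Const_eq_0_iff [simp]: "Const c = 0 \<longleftrightarrow> c = 0"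
  by (metis Const_0 lookup_Const lookup_zero)

lemma Const_uminus: "Const (- a) = - Const a"
  by (simp add: Const_def single_uminus)

lemma Const_diff: "Const (a - b) = Const a - Const b"
  by (simp add: Const_def single_diff)

lemma Const_sum: "Const (sum f A) = (\<Sum>a\<in>A. Const (f a))"
  by (induction A rule: infinite_finite_induct) (auto simp: Const_add)

lemma lookup_Const_mult [simp]: "lookup (Const c * F) t = c * lookup F t"
proof -
  have "Const c * F = (\<Sum>s\<in>keys F. Poly_Mapping.single s (c * lookup F s))"
    by (subst mpoly_expand[of F]) (simp add: Const_def sum_distrib_left mult_single)
  then show ?thesis
    by (auto simp: lookup_sum lookup_single when_def in_keys_iff)
qed

lemma eval_mon_Var: "eval_mon Var t = Poly_Mapping.single t 1"
proof -
  have "finite (keys t)" by simp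
  have "(\<Prod>j\<in>A. Var j ^ lookup t j) = Poly_Mapping.single (\<Sum>j\<in>A. Poly_Mapping.single j (lookup t j)) 1"
    for A
  proof (induction A rule: infinite_finite_induct)
    case (insert j A)
    have "Var j ^ n = Poly_Mapping.single (Poly_Mapping.single j n) 1" for n
      by (induction n) (simp_all add: Var_def mult_single flip: single_add)
    with insert show ?case by (simp add: mult_single)
  qed auto
  moreover have "(\<Sum>j\<in>keys t. Poly_Mapping.single j (lookup t j)) = t"
    by (rule poly_mapping_eqI) (auto simp: lookup_sum lookup_single when_def in_keys_iff)
  ultimately show ?thesis by (simp add: eval_mon_def)
qed

lemma single_eq: "Poly_Mapping.single t c = Const c * eval_mon Var t"
  by (simp add: eval_mon_Var Const_def mult_single)

lemma substitute_Var_id [simp]: "substitute Const Var F = F"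
  by (subst (2) mpoly_expand) (simp add: substitute_alt single_eq)

lemma (in scalar_hom) substitute_substitute:
  "substitute \<iota> y (substitute Const x F) = substitute \<iota> (\<lambda>j. substitute \<iota> y (x j)) F"
  by (subst substitute_hom) auto


section \<open>Homogeneous components\<close>

lemma mpoly_lookup_single_mult:
  "lookup (Poly_Mapping.single s (a::complex) * G) t
     = (\<Sum>r\<in>keys G. if s + r = t then a * lookup G r else 0)"
proof -
  have "Poly_Mapping.single s a * G = (\<Sum>r\<in>keys G. Poly_Mapping.single (s + r) (a * lookup G r))"
    by (subst mpoly_expand[of G]) (simp add: sum_distrib_left mult_single)
  then show ?thesis by (simp add: lookup_sum lookup_single when_def)
qed

definition hom_part :: "nat \<Rightarrow> 'v mpoly \<Rightarrow> 'v mpoly" where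
  "hom_part n F = (\<Sum>t\<in>{t \<in> keys F. mon_degree t = n}. Poly_Mapping.single t (lookup F t))"

lemma lookup_hom_part: "lookup (hom_part n F) t = (if mon_degree t = n then lookup F t else 0)"
  by (auto simp: hom_part_def lookup_sum lookup_single when_def in_keys_iff)

lemma homogeneousI: "(\<And>t. lookup F t \<noteq> 0 \<Longrightarrow> mon_degree t = d) \<Longrightarrow> homogeneous d F"
  by (simp add: homogeneous_def in_keys_iff)

lemma homogeneousD: "homogeneous d F \<Longrightarrow> lookup F t \<noteq> 0 \<Longrightarrow> mon_degree t = d"
  by (simp add: homogeneous_def in_keys_iff)

lemma hom_part_homogeneous [simp]: "homogeneous n (hom_part n F)"
  by (rule homogeneousI) (auto simp: lookup_hom_part split: if_splits)

lemma hom_part_self: "homogeneous n F \<Longrightarrow> hom_part n F = F"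
  by (rule poly_mapping_eqI) (auto simp: lookup_hom_part dest: homogeneousD)

lemma hom_part_other: "homogeneous n F \<Longrightarrow> k \<noteq> n \<Longrightarrow> hom_part k F = 0"
  by (rule poly_mapping_eqI) (auto simp: lookup_hom_part dest: homogeneousD)

lemma hom_part_add [simp]: "hom_part n (F + G) = hom_part n F + hom_part n G"
  by (rule poly_mapping_eqI) (auto simp: lookup_hom_part lookup_add)

lemma hom_part_diff [simp]: "hom_part n (F - G) = hom_part n F - hom_part n G"
  by (rule poly_mapping_eqI) (auto simp: lookup_hom_part lookup_minus)

lemma hom_part_0 [simp]: "hom_part n 0 = 0"
  by (rule poly_mapping_eqI) (auto simp: lookup_hom_part)

lemma hom_part_sum: "hom_part n (sum F A) = (\<Sum>a\<in>A. hom_part n (F a))"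
  by (induction A rule: infinite_finite_induct) auto

lemma homogeneous_0 [simp]: "homogeneous d 0"
  by (simp add: homogeneous_def)

lemma homogeneous_add: "homogeneous d F \<Longrightarrow> homogeneous d G \<Longrightarrow> homogeneous d (F + G)"
  unfolding homogeneous_def using Poly_Mapping.keys_add[of F G] by blast

lemma homogeneous_uminus: "homogeneous d F \<Longrightarrow> homogeneous d (- F)"
  by (auto simp: homogeneous_def)

lemma homogeneous_diff: "homogeneous d F \<Longrightarrow> homogeneous d G \<Longrightarrow> homogeneous d (F - G)"
  using homogeneous_add[of d F "- G"] homogeneous_uminus[of d G] by simp

lemma homogeneous_sum: "(\<And>a. a \<in> A \<Longrightarrow> homogeneous d (F a)) \<Longrightarrow> homogeneous d (sum F A)"
  by (induction A rule: infinite_finite_induct) (auto intro: homogeneous_add)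

lemma homogeneous_mult: "homogeneous d F \<Longrightarrow> homogeneous e G \<Longrightarrow> homogeneous (d + e) (F * G)"
  unfolding homogeneous_def using Poly_Mapping.keys_mult[of F G]
  by (auto simp: mon_degree_add dest!: subsetD)

lemma homogeneous_Const [simp]: "homogeneous 0 (Const c)"
  by (rule homogeneousI) (auto simp: lookup_Const split: if_splits)

lemma homogeneous_1 [simp]: "homogeneous 0 1"
  using homogeneous_Const[of 1] by simp

lemma homogeneous_Var [simp]: "homogeneous 1 (Var j)" "homogeneous (Suc 0) (Var j)"
  by (auto simp: homogeneous_def Var_def)

lemma homogeneous_power: "homogeneous d F \<Longrightarrow> homogeneous (k * d) (F ^ k)"
  by (induction k) (auto intro: homogeneous_mult)

lemma homogeneous_Const_mult: "homogeneous d F \<Longrightarrow> homogeneous d (Const c * F)"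
  using homogeneous_mult[OF homogeneous_Const] by force

lemma homogeneous_prod:
  "(\<And>a. a \<in> A \<Longrightarrow> homogeneous (d a) (F a)) \<Longrightarrow> homogeneous (sum d A) (prod F A)"
  by (induction A rule: infinite_finite_induct) (auto intro: homogeneous_mult)

lemma hom_part_expand:
  assumes "finite A" "mon_degree ` keys F \<subseteq> A"
  shows "F = (\<Sum>n\<in>A. hom_part n F)"
proof (rule poly_mapping_eqI)
  fix t
  show "lookup F t = lookup (\<Sum>n\<in>A. hom_part n F) t"
  proof (cases "t \<in> keys F")
    case True
    with assms have "mon_degree t \<in> A" by blast
    with assms(1) show ?thesis by (simp add: lookup_sum lookup_hom_part)
  next
    case False
    then have "lookup F t = 0" by (simp add: in_keys_iff)
    then have "lookup (hom_part n F) t = 0" for n by (simp add: lookup_hom_part)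
    with \<open>lookup F t = 0\<close> show ?thesis by (simp only: lookup_sum sum.neutral_const)
  qed
qed

lemma hom_part_mult_homogeneous:
  assumes "homogeneous e A"
  shows "hom_part (n + e) (A * B) = A * hom_part n B"
proof -
  let ?D = "insert n (mon_degree ` keys B)"
  have B: "B = (\<Sum>k\<in>?D. hom_part k B)" by (rule hom_part_expand) auto
  have "hom_part (n + e) (A * B) = (\<Sum>k\<in>?D. hom_part (n + e) (A * hom_part k B))"
    by (subst B) (simp only: sum_distrib_left hom_part_sum)
  also have "\<dots> = (\<Sum>k\<in>?D. if k = n then A * hom_part n B else 0)"
  proof (rule sum.cong[OF refl])
    fix k
    have h: "homogeneous (k + e) (A * hom_part k B)"
      using homogeneous_mult[OF assms hom_part_homogeneous, of k B] by (simp add: add.commute)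
    show "hom_part (n + e) (A * hom_part k B) = (if k = n then A * hom_part n B else 0)"
      using hom_part_self[OF h] hom_part_other[OF h, of "n + e"] by auto
  qed
  also have "\<dots> = A * hom_part n B" by simp
  finally show ?thesis .
qed

lemma hom_part_mult_small:
  assumes "homogeneous e A" "n < e"
  shows "hom_part n (A * B) = 0"
proof (rule poly_mapping_eqI)
  fix t
  have "mon_degree t \<ge> e" if "t \<in> keys (A * B)"
    using that Poly_Mapping.keys_mult[of A B] assms(1)
    by (auto simp: homogeneous_def mon_degree_add dest!: subsetD)
  with assms(2) show "lookup (hom_part n (A * B)) t = lookup 0 t"
    by (force simp: lookup_hom_part in_keys_iff)
qed

section \<open>Order of vanishing at the origin\<close>


definition low :: "nat \<Rightarrow> 'v mpoly \<Rightarrow> bool" where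
  "low k F \<longleftrightarrow> (\<forall>t\<in>keys F. k \<le> mon_degree t)"

lemma low_0 [simp]: "low k 0" and low_zero [simp]: "low 0 F"
  by (auto simp: low_def)

lemma low_mono: "low k F \<Longrightarrow> l \<le> k \<Longrightarrow> low l F"
  by (auto simp: low_def)

lemma low_add: "low k F \<Longrightarrow> low k G \<Longrightarrow> low k (F + G)"
  unfolding low_def using Poly_Mapping.keys_add[of F G] by blast

lemma low_uminus: "low k F \<Longrightarrow> low k (- F)"
  by (auto simp: low_def)

lemma low_diff: "low k F \<Longrightarrow> low k G \<Longrightarrow> low k (F - G)"
  using low_add[of k F "- G"] low_uminus[of k G] by simp

lemma low_sum: "(\<And>a. a \<in> A \<Longrightarrow> low k (F a)) \<Longrightarrow> low k (sum F A)"
  by (induction A rule: infinite_finite_induct) (auto intro: low_add)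

lemma low_mult: "low k F \<Longrightarrow> low l G \<Longrightarrow> low (k + l) (F * G)"
  unfolding low_def using Poly_Mapping.keys_mult[of F G]
  by (fastforce simp: mon_degree_add dest!: subsetD intro: add_mono)

lemma low_homogeneous: "homogeneous k F \<Longrightarrow> low k F"
  by (auto simp: low_def homogeneous_def)

lemma low_power: "low k F \<Longrightarrow> low (n * k) (F ^ n)"
  by (induction n) (auto intro: low_mult)

lemma low_iff_hom_part: "low k F \<longleftrightarrow> (\<forall>n<k. hom_part n F = 0)"
proof
  assume *: "low k F"
  show "\<forall>n<k. hom_part n F = 0"
  proof (intro allI impI poly_mapping_eqI)
    fix n t assume "n < k"
    with * have "mon_degree t = n \<Longrightarrow> lookup F t = 0"
      unfolding low_def by (metis in_keys_iff not_le)
    then show "lookup (hom_part n F) t = lookup 0 t" by (simp add: lookup_hom_part)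
  qed
next
  assume *: "\<forall>n<k. hom_part n F = 0"
  show "low k F"
    unfolding low_def in_keys_iff
  proof (intro ballI leI notI, unfold in_keys_iff)
    fix t assume "lookup F t \<noteq> 0" "mon_degree t < k"
    with * have "lookup (hom_part (mon_degree t) F) t = 0" by simp
    with \<open>lookup F t \<noteq> 0\<close> show False by (simp add: lookup_hom_part)
  qed
qed

lemma low_Suc: "low (Suc k) F \<longleftrightarrow> low k F \<and> hom_part k F = 0"
  by (auto simp: low_iff_hom_part less_Suc_eq)

lemma low_diff_hom_part: "low k F \<Longrightarrow> low (Suc k) (F - hom_part k F)"
  by (auto simp: low_iff_hom_part less_Suc_eq hom_part_self[OF hom_part_homogeneous]
      hom_part_other[OF hom_part_homogeneous])

lemma ex_low_exact:
  assumes "F \<noteq> 0"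
  shows "\<exists>k. low k F \<and> \<not> low (Suc k) F"
proof -
  from assms obtain t where t: "t \<in> keys F" by (metis keys_eq_empty equals0I)
  then have "\<not> low (Suc (mon_degree t)) F" by (force simp: low_def)
  then obtain n where "\<not> low (Suc n) F" by blast
  then show ?thesis
  proof (induction n)
    case 0 then show ?case by (intro exI[of _ 0]) auto
  next
    case (Suc n) then show ?case by (cases "low (Suc n) F") auto
  qed
qed

lemma hom_part_low_mult:
  assumes "low k F" "low l G"
  shows "hom_part (k + l) (F * G) = hom_part k F * hom_part l G"
proof -
  have "F * G = hom_part k F * hom_part l G + (hom_part k F * (G - hom_part l G) + (F - hom_part k F) * G)"
    by (simp add: algebra_simps)
  moreover have "low (Suc (k + l)) (hom_part k F * (G - hom_part l G) + (F - hom_part k F) * G)"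
    using low_mult[OF low_homogeneous[OF hom_part_homogeneous[of k F]] low_diff_hom_part[OF assms(2)]]
      low_mult[OF low_diff_hom_part[OF assms(1)] assms(2)]
    by (intro low_add) auto
  moreover have "homogeneous (k + l) (hom_part k F * hom_part l G)"
    by (intro homogeneous_mult) auto
  ultimately show ?thesis
    by (simp only: hom_part_add hom_part_self low_Suc add_0_right)
qed

text \<open>
  Lowest parts multiply without cancellation because the polynomials form a domain; this makes the
  multiplicity at a point a valuation.
\<close>

lemma low_exact_mult:
  fixes F :: "'v::linorder mpoly"
  assumes "low k F" "\<not> low (Suc k) F" "low l G" "\<not> low (Suc l) G"
  shows "\<not> low (Suc (k + l)) (F * G)"
proof -
  have "hom_part k F \<noteq> 0" "hom_part l G \<noteq> 0" using assms by (auto simp: low_Suc)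
  then have "hom_part k F * hom_part l G \<noteq> 0" by simp
  then show ?thesis using hom_part_low_mult[OF assms(1,3)] by (simp add: low_Suc)
qed

lemma low_cancel:
  fixes F :: "'v::linorder mpoly"
  assumes "low k F" "\<not> low (Suc k) F" "low (k + l) (F * G)"
  shows "low l G"
proof (rule ccontr)
  assume "\<not> low l G"
  then have "G \<noteq> 0" by auto
  then obtain n where n: "low n G" "\<not> low (Suc n) G" using ex_low_exact by blast
  with \<open>\<not> low l G\<close> have "n < l" by (metis low_mono not_le)
  have "\<not> low (Suc (k + n)) (F * G)" using low_exact_mult[OF assms(1,2) n] .
  moreover have "Suc (k + n) \<le> k + l" using \<open>n < l\<close> by simp
  ultimately show False using assms(3) low_mono by blast
qed

lemma low_substitute:
  assumes "low k F" "\<And>j. low 1 (x j)"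
  shows "low k (substitute Const x F)"
proof -
  have "low (mon_degree t) (eval_mon x t)" for t
  proof -
    have "low (\<Sum>j\<in>A. lookup t j) (\<Prod>j\<in>A. x j ^ lookup t j)" for A
    proof (induction A rule: infinite_finite_induct)
      case (insert j A)
      then show ?case using low_mult[OF low_power[OF assms(2)[of j], of "lookup t j"]] by simp
    qed auto
    then show ?thesis by (simp add: mon_degree_def eval_mon_def)
  qed
  moreover have "mon_degree t \<ge> k" if "t \<in> keys F" for t using assms(1) that by (auto simp: low_def)
  ultimately have "low k (eval_mon x t)" if "t \<in> keys F" for t
    using that low_mono by blast
  then have "low (0 + k) (Const (lookup F t) * eval_mon x t)" if "t \<in> keys F" for t
    using that by (intro low_mult) simp_all
  then show ?thesis
    unfolding substitute_alt by (intro low_sum) simp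
qed

lemma homogeneous_substitute:
  assumes "homogeneous d F" "\<And>j. homogeneous e (x j)"
  shows "homogeneous (d * e) (substitute Const x F)"
proof -
  have "homogeneous (mon_degree t * e) (eval_mon x t)" for t
  proof -
    have "homogeneous ((\<Sum>j\<in>A. lookup t j) * e) (\<Prod>j\<in>A. x j ^ lookup t j)" for A
    proof (induction A rule: infinite_finite_induct)
      case (insert j A)
      then show ?case
        using homogeneous_mult[OF homogeneous_power[OF assms(2)[of j], of "lookup t j"] insert(3)]
        by (simp add: distrib_right)
    qed auto
    then show ?thesis by (simp add: mon_degree_def eval_mon_def)
  qed
  moreover have "mon_degree t = d" if "t \<in> keys F" for t using assms(1) that by (auto simp: homogeneous_def)
  ultimately have "homogeneous (d * e) (eval_mon x t)" if "t \<in> keys F" for t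
    using that by metis
  then show ?thesis
    unfolding substitute_alt by (intro homogeneous_sum homogeneous_Const_mult)
qed

section \<open>Multiplicity at a point\<close>

definition shift :: "complex ^ 'n \<Rightarrow> 'n mpoly \<Rightarrow> 'n mpoly" where
  "shift v = substitute Const (\<lambda>j. Const (v $ j) + Var j)"

lemma mult_at_least_shift: "mult_at_least k F v \<longleftrightarrow> low k (shift v F)"
  by (simp add: mult_at_least_def low_def shift_def)

lemma shift_simps [simp]:
  "shift v 0 = 0" "shift v 1 = 1" "shift v (F + G) = shift v F + shift v G"
  "shift v (F - G) = shift v F - shift v G" "shift v (F * G) = shift v F * shift v G"
  "shift v (F ^ n) = shift v F ^ n" "shift v (Const c) = Const c"
  "shift v (sum H A) = (\<Sum>a\<in>A. shift v (H a))"
  "shift v (prod H A) = (\<Prod>a\<in>A. shift v (H a))"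
  "shift v (Var j) = Const (v $ j) + Var j"
  by (simp_all add: shift_def)

lemma shift_inverse: "shift (- v) (shift v F) = F"
  unfolding shift_def by (simp add: Csub.substitute_substitute Const_uminus)

lemma shift_eq_0_iff [simp]: "shift v F = 0 \<longleftrightarrow> F = 0"
  by (metis shift_inverse shift_simps(1))

abbreviation eval_at :: "'n mpoly \<Rightarrow> complex ^ 'n \<Rightarrow> complex" where
  "eval_at F v \<equiv> substitute (\<lambda>c. c) (\<lambda>j. v $ j) F"

lemma eval_zero: "substitute (\<lambda>c. c) (\<lambda>_. 0) F = lookup F 0"
proof -
  have "eval_mon (\<lambda>_. 0::complex) t = (if t = 0 then 1 else 0)" for t :: "'a \<Rightarrow>\<^sub>0 nat"
    by (auto simp: eval_mon_def in_keys_iff poly_mapping_eq_iff fun_eq_iff)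
  then have "substitute (\<lambda>c. c) (\<lambda>_. 0) F = (\<Sum>t\<in>keys F. if t = 0 then lookup F t else 0)"
    unfolding substitute_alt by (intro sum.cong) auto
  also have "\<dots> = lookup F 0" by (simp add: in_keys_iff)
  finally show ?thesis .
qed

lemma mult_at_least_1_iff: "mult_at_least 1 F v \<longleftrightarrow> eval_at F v = 0"
proof -
  have "eval_at F v = substitute (\<lambda>c. c) (\<lambda>_. 0) (shift v F)"
    by (simp add: shift_def eval.substitute_substitute)
  also have "\<dots> = lookup (shift v F) 0" by (rule eval_zero)
  finally have *: "eval_at F v = lookup (shift v F) 0" .
  have "low 1 G \<longleftrightarrow> lookup G 0 = 0" for G :: "'a mpoly"
  proof
    show "lookup G 0 = 0" if "low 1 G"
      using that unfolding low_def by (metis in_keys_iff mon_degree_0 not_one_le_zero)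
    show "low 1 G" if "lookup G 0 = 0"
      unfolding low_def in_keys_iff
    proof (intro ballI)
      fix t assume "t \<in> keys G"
      with that have "t \<noteq> 0" by (auto simp: in_keys_iff)
      then have "mon_degree t \<noteq> 0" by (simp add: mon_degree_eq_0_iff)
      then show "1 \<le> mon_degree t" by simp
    qed
  qed
  then show ?thesis by (simp add: * mult_at_least_shift)
qed

lemma mult_at_least_0 [simp]: "mult_at_least k 0 v" and mult_at_least_zero [simp]: "mult_at_least 0 F v"
  by (auto simp: mult_at_least_shift)

lemma mult_at_least_mono: "mult_at_least k F v \<Longrightarrow> l \<le> k \<Longrightarrow> mult_at_least l F v"
  by (auto simp: mult_at_least_shift intro: low_mono)

lemma mult_at_least_add: "mult_at_least k F v \<Longrightarrow> mult_at_least k G v \<Longrightarrow> mult_at_least k (F + G) v"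
  by (auto simp: mult_at_least_shift intro: low_add)

lemma mult_at_least_diff: "mult_at_least k F v \<Longrightarrow> mult_at_least k G v \<Longrightarrow> mult_at_least k (F - G) v"
  by (auto simp: mult_at_least_shift intro: low_diff)

lemma mult_at_least_sum: "(\<And>a. a \<in> A \<Longrightarrow> mult_at_least k (F a) v) \<Longrightarrow> mult_at_least k (sum F A) v"
  by (auto simp: mult_at_least_shift intro: low_sum)

lemma mult_at_least_mult:
  "mult_at_least k F v \<Longrightarrow> mult_at_least l G v \<Longrightarrow> mult_at_least (k + l) (F * G) v"
  by (auto simp: mult_at_least_shift intro: low_mult)

lemma mult_at_least_mult_left: "mult_at_least k G v \<Longrightarrow> mult_at_least k (F * G) v"
  using mult_at_least_mult[of 0 F v k G] by simp

lemma mult_at_least_mult_right: "mult_at_least k F v \<Longrightarrow> mult_at_least k (F * G) v"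
  using mult_at_least_mult[of k F v 0 G] by simp

lemma mult_at_least_power: "mult_at_least k F v \<Longrightarrow> mult_at_least (n * k) (F ^ n) v"
  by (auto simp: mult_at_least_shift intro: low_power)

text \<open>
  A relation instead of a function, so that the zero polynomial needs no convention: it has no exact
  multiplicity.
\<close>

definition mult_exact :: "nat \<Rightarrow> 'n mpoly \<Rightarrow> complex ^ 'n \<Rightarrow> bool" where
  "mult_exact k F v \<longleftrightarrow> mult_at_least k F v \<and> \<not> mult_at_least (Suc k) F v"

lemma mult_exact_nonzero: "mult_exact k F v \<Longrightarrow> F \<noteq> 0"
  by (auto simp: mult_exact_def)

lemma ex_mult_exact: "F \<noteq> 0 \<Longrightarrow> \<exists>k. mult_exact k F v"
  unfolding mult_exact_def mult_at_least_shift by (rule ex_low_exact) auto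

lemma mult_exact_iff: "mult_exact k F v \<Longrightarrow> mult_at_least l F v \<longleftrightarrow> l \<le> k"
  unfolding mult_exact_def by (metis mult_at_least_mono not_less_eq_eq)

lemma mult_exact_unique: "mult_exact k F v \<Longrightarrow> mult_exact l F v \<Longrightarrow> k = l"
  by (metis mult_exact_def mult_exact_iff le_antisym)

lemma mult_exact_0_iff: "mult_exact 0 F v \<longleftrightarrow> eval_at F v \<noteq> 0"
  using mult_at_least_1_iff[of F v] by (simp add: mult_exact_def)

lemma mult_exact_mult:
  fixes F :: "'n::{finite,linorder} mpoly"
  shows "mult_exact k F v \<Longrightarrow> mult_exact l G v \<Longrightarrow> mult_exact (k + l) (F * G) v"
  unfolding mult_exact_def mult_at_least_shift shift_simps
  by (auto intro: low_mult dest: low_exact_mult)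

lemma mult_exact_power:
  fixes F :: "'n::{finite,linorder} mpoly"
  shows "mult_exact k F v \<Longrightarrow> mult_exact (n * k) (F ^ n) v"
proof (induction n)
  case 0
  then show ?case by (simp add: mult_exact_0_iff)
next
  case (Suc n)
  then show ?case using mult_exact_mult[of k F v "n * k" "F ^ n"] by simp
qed

text \<open>
  The way in which additivity of the multiplicity is used: a factor of known multiplicity can be divided
  out.
\<close>

lemma mult_cancel:
  fixes F :: "'n::{finite,linorder} mpoly"
  assumes "mult_exact k F v"
  shows "mult_at_least (k + l) (F * G) v \<longleftrightarrow> mult_at_least l G v"
proof
  show "mult_at_least l G v" if "mult_at_least (k + l) (F * G) v"
    using assms that low_cancel[of k "shift v F" l "shift v G"]
    unfolding mult_exact_def mult_at_least_shift shift_simps by blast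
  show "mult_at_least (k + l) (F * G) v" if "mult_at_least l G v"
    using assms that by (auto simp: mult_exact_def intro: mult_at_least_mult)
qed

section \<open>Linear algebra\<close>

interpretation mp: vector_space "\<lambda>c F. Const c * F :: 'v mpoly"
  by unfold_locales (simp_all add: Const_add Const_mult algebra_simps)

text \<open>
  Gaussian elimination: a row with a nonzero entry removes one unknown and one equation.
\<close>

lemma underdetermined_system:
  fixes M :: "'r \<Rightarrow> 'c \<Rightarrow> 'k::field"
  assumes "finite R" "finite C" "card R < card C"
  shows "\<exists>x. (\<exists>c\<in>C. x c \<noteq> 0) \<and> (\<forall>r\<in>R. (\<Sum>c\<in>C. M r c * x c) = 0)"
  using assms
proof (induction R arbitrary: C M rule: finite_induct)
  case empty
  then have "C \<noteq> {}" by auto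
  then show ?case by (intro exI[of _ "\<lambda>_. 1"]) auto
next
  case (insert r R)
  show ?case
  proof (cases "\<forall>c\<in>C. M r c = 0")
    case True
    from insert have "card R < card C" by simp
    from insert.IH[OF insert.prems(1) this, of M] obtain x
      where x: "\<exists>c\<in>C. x c \<noteq> 0" "\<forall>r\<in>R. (\<Sum>c\<in>C. M r c * x c) = 0" by blast
    with True show ?thesis by (intro exI[of _ x]) auto
  next
    case False
    then obtain c0 where c0: "c0 \<in> C" "M r c0 \<noteq> 0" by blast
    define C' where "C' = C - {c0}"
    define M' where "M' s c = M s c * M r c0 - M s c0 * M r c" for s c
    have fin: "finite C'" using insert.prems by (simp add: C'_def)
    have C: "C = insert c0 C'" "c0 \<notin> C'" using c0 by (auto simp: C'_def)
    have "card R < card C'" using insert.prems insert.hyps fin C by simp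
    from insert.IH[OF fin this, of M'] obtain x
      where x: "\<exists>c\<in>C'. x c \<noteq> 0" "\<forall>r\<in>R. (\<Sum>c\<in>C'. M' r c * x c) = 0" by blast
    \<comment> \<open>back substitution into the pivot row\<close>
    define y where "y c = (if c = c0 then - (\<Sum>c\<in>C'. M r c * x c) / M r c0 else x c)" for c
    have y: "(\<Sum>c\<in>C. M s c * y c) = M s c0 * y c0 + (\<Sum>c\<in>C'. M s c * x c)" for s
    proof -
      have "(\<Sum>c\<in>C'. M s c * y c) = (\<Sum>c\<in>C'. M s c * x c)"
        using C by (intro sum.cong) (auto simp: y_def)
      then show ?thesis using C fin by simp
    qed
    have "(\<Sum>c\<in>C. M s c * y c) = 0" if "s \<in> insert r R" for s
    proof (cases "s = r")
      case True
      then show ?thesis using c0 unfolding y by (simp add: y_def)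
    next
      case False
      with that have "(\<Sum>c\<in>C'. M' s c * x c) = 0" using x(2) by auto
      then have "(\<Sum>c\<in>C'. M s c * x c) * M r c0 = M s c0 * (\<Sum>c\<in>C'. M r c * x c)"
        by (simp add: M'_def algebra_simps sum_subtractf sum_distrib_left sum_distrib_right)
      then show ?thesis using c0 unfolding y by (simp add: y_def field_simps)
    qed
    moreover have "\<exists>c\<in>C. y c \<noteq> 0" using x(1) C by (auto simp: y_def)
    ultimately show ?thesis by blast
  qed
qed


section \<open>The Taylor expansion of a form\<close>

definition degree_le :: "nat \<Rightarrow> 'v mpoly \<Rightarrow> bool" where
  "degree_le k F \<longleftrightarrow> (\<forall>t\<in>keys F. mon_degree t \<le> k)"

lemma degree_le_0 [simp]: "degree_le k 0"
  by (simp add: degree_le_def)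

lemma degree_le_add: "degree_le k F \<Longrightarrow> degree_le k G \<Longrightarrow> degree_le k (F + G)"
  unfolding degree_le_def using Poly_Mapping.keys_add[of F G] by blast

lemma degree_le_sum: "(\<And>a. a \<in> A \<Longrightarrow> degree_le k (F a)) \<Longrightarrow> degree_le k (sum F A)"
  by (induction A rule: infinite_finite_induct) (auto intro: degree_le_add)

lemma degree_le_mult: "degree_le k F \<Longrightarrow> degree_le l G \<Longrightarrow> degree_le (k + l) (F * G)"
  unfolding degree_le_def using Poly_Mapping.keys_mult[of F G]
  by (fastforce simp: mon_degree_add dest!: subsetD intro: add_mono)

lemma degree_le_homogeneous: "homogeneous k F \<Longrightarrow> degree_le k F"
  by (auto simp: degree_le_def homogeneous_def)

lemma degree_le_mono: "degree_le k F \<Longrightarrow> k \<le> l \<Longrightarrow> degree_le l F"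
  by (auto simp: degree_le_def)

lemma degree_le_power: "degree_le k F \<Longrightarrow> degree_le (n * k) (F ^ n)"
  by (induction n) (auto intro: degree_le_mult degree_le_homogeneous)

lemma degree_le_substitute:
  assumes "homogeneous d F" "\<And>j. degree_le 1 (x j)"
  shows "degree_le d (substitute Const x F)"
proof -
  have "degree_le (mon_degree t) (eval_mon x t)" for t
  proof -
    have "degree_le (\<Sum>j\<in>A. lookup t j) (\<Prod>j\<in>A. x j ^ lookup t j)" for A
    proof (induction A rule: infinite_finite_induct)
      case (insert j A)
      then show ?case using degree_le_mult[OF degree_le_power[OF assms(2)[of j], of "lookup t j"]] by simp
    qed (auto intro: degree_le_homogeneous)
    then show ?thesis by (simp add: mon_degree_def eval_mon_def)
  qed
  then have "degree_le d (eval_mon x t)" if "t \<in> keys F" for t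
    using assms(1) that by (metis homogeneous_def)
  then have "degree_le (0 + d) (Const (lookup F t) * eval_mon x t)" if "t \<in> keys F" for t
    using that by (intro degree_le_mult degree_le_homogeneous[OF homogeneous_Const])
  then show ?thesis
    unfolding substitute_alt by (intro degree_le_sum) simp
qed

lemma degree_le_shift: "homogeneous d F \<Longrightarrow> degree_le d (shift v F)"
  unfolding shift_def
  by (intro degree_le_substitute degree_le_add)
    (auto intro: degree_le_mono[OF degree_le_homogeneous[OF homogeneous_Const]]
      degree_le_homogeneous)

text \<open>
  The Taylor expansion has no terms beyond the degree of the form.
\<close>

lemma mult_exceeds_degree:
  assumes "homogeneous d F" "mult_at_least k F v" "d < k"
  shows "F = 0"
proof -
  have "degree_le d (shift v F)" "low k (shift v F)"
    using assms degree_le_shift by (auto simp: mult_at_least_shift)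
  with \<open>d < k\<close> have "keys (shift v F) = {}"
    unfolding degree_le_def low_def by fastforce
  then show ?thesis by simp
qed

definition lin :: "complex ^ 'n \<Rightarrow> 'n mpoly" where
  "lin c = (\<Sum>j\<in>UNIV. Const (c $ j) * Var j)"

definition pairing :: "complex ^ 'n \<Rightarrow> complex ^ 'n \<Rightarrow> complex" where
  "pairing c v = (\<Sum>j\<in>UNIV. c $ j * v $ j)"

lemma homogeneous_lin [simp]: "homogeneous 1 (lin c)" "homogeneous (Suc 0) (lin c)"
  by (auto simp: lin_def intro!: homogeneous_sum homogeneous_Const_mult)

lemma (in scalar_hom) substitute_lin: "substitute \<iota> x (lin c) = (\<Sum>j\<in>UNIV. \<iota> (c $ j) * x j)"
  by (simp add: lin_def)

lemma eval_lin [simp]: "eval_at (lin c) v = pairing c v"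
  by (simp add: eval.substitute_lin pairing_def)

lemma shift_lin: "shift v (lin c) = Const (pairing c v) + lin c"
  by (simp add: lin_def pairing_def Const_sum Const_mult sum.distrib algebra_simps)

lemma lookup_lin: "lookup (lin c) (Poly_Mapping.single j 1) = c $ j"
proof -
  have "lookup (Const (c $ i) * Var i) (Poly_Mapping.single j 1) = (if i = j then c $ j else 0)" for i
    by (auto simp: Var_def lookup_single when_def dest!: arg_cong[of _ _ keys])
  then show ?thesis by (simp add: lin_def lookup_sum)
qed

lemma lin_eq_0_iff [simp]: "lin c = 0 \<longleftrightarrow> c = 0"
proof
  assume "lin c = 0"
  then show "c = 0" using lookup_lin[of c] by (simp add: vec_eq_iff)
qed (simp add: lin_def)

lemma lin_diff: "lin (c - d) = lin c - lin d"
  and lin_scale: "lin (a *s c) = Const a * lin c"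
  by (simp_all add: lin_def Const_diff Const_mult sum_subtractf sum_distrib_left algebra_simps)

lemma pairing_add: "pairing (c + d) v = pairing c v + pairing d v"
  and pairing_scale: "pairing (a *s c) v = a * pairing c v"
  by (simp_all add: pairing_def sum.distrib sum_distrib_left algebra_simps)

lemma pairing_axis: "pairing (axis j a) v = a * v $ j"
proof -
  have "pairing (axis j a) v = (\<Sum>i\<in>UNIV. if i = j then a * v $ j else 0)"
    unfolding pairing_def by (intro sum.cong) (auto simp: axis_def)
  then show ?thesis by simp
qed

lemma ex_pairing_1:
  assumes "v \<noteq> 0" shows "\<exists>c. pairing c v = 1"
proof -
  from assms obtain j where "v $ j \<noteq> 0" by (auto simp: vec_eq_iff)
  then have "pairing (axis j (1 / v $ j)) v = 1" by (simp add: pairing_axis)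
  then show ?thesis by blast
qed

lemma to_frac_simps [simp]:
  fixes F :: "'v::linorder mpoly"
  shows "to_frac 0 = (0 :: 'v mpoly fract)" "to_frac 1 = (1 :: 'v mpoly fract)"
  "to_frac (F + G) = to_frac F + to_frac G" "to_frac (F * G) = to_frac F * to_frac G"
  by (simp_all add: to_frac_def Zero_fract_def One_fract_def)

lemma to_frac_uminus [simp]: "to_frac (- F) = - to_frac (F :: 'v::linorder mpoly)"
  and to_frac_diff [simp]: "to_frac (F - G) = to_frac F - to_frac (G :: 'v::linorder mpoly)"
  by (simp_all add: to_frac_def)

lemma to_frac_power [simp]: "to_frac (F ^ n) = to_frac (F :: 'v::linorder mpoly) ^ n"
  by (induction n) auto

lemma to_frac_sum: "to_frac (sum F A) = (\<Sum>a\<in>A. to_frac (F a :: 'v::linorder mpoly))"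
  by (induction A rule: infinite_finite_induct) auto

lemma to_frac_inject [simp]: "to_frac F = to_frac G \<longleftrightarrow> F = (G :: 'v::linorder mpoly)"
  by (simp add: to_frac_def eq_fract)

lemma to_frac_eq_0_iff [simp]: "to_frac F = 0 \<longleftrightarrow> F = (0 :: 'v::linorder mpoly)"
  by (metis to_frac_inject to_frac_simps(1))

interpretation frac: scalar_hom "\<lambda>c. to_frac (Const c :: 'v::linorder mpoly)"
  by unfold_locales (simp_all add: Const_add Const_mult)

lemma to_frac_substitute:
  fixes x :: "'w \<Rightarrow> 'v::linorder mpoly"
  shows "to_frac (substitute Const x F) = substitute (\<lambda>c. to_frac (Const c)) (\<lambda>j. to_frac (x j)) F"
  by (rule substitute_hom) auto

lemma (in scalar_hom) substitute_scale:
  assumes "homogeneous d F"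
  shows "substitute \<iota> (\<lambda>j. s * x j) F = s ^ d * substitute \<iota> x F"
proof -
  have "eval_mon (\<lambda>j. s * x j) t = s ^ mon_degree t * eval_mon x t" for t
    by (simp add: eval_mon_def mon_degree_def power_mult_distrib prod.distrib power_sum)
  with assms show ?thesis
    by (auto simp: substitute_alt homogeneous_def sum_distrib_left mult_ac intro!: sum.cong)
qed

text \<open>
  If the linear form \<open>c\<close> takes the value \<open>1\<close> at \<open>v\<close>, this is composition with the projection along \<open>v\<close>
  onto the hyperplane \<open>c = 0\<close>; algebraically it is reduction modulo \<open>c\<close>.
\<close>

definition proj_along :: "complex ^ 'n \<Rightarrow> complex ^ 'n \<Rightarrow> 'n mpoly \<Rightarrow> 'n mpoly" where
  "proj_along v c = substitute Const (\<lambda>j. Var j - Const (v $ j) * lin c)"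

lemma homogeneous_proj_along: "homogeneous d F \<Longrightarrow> homogeneous d (proj_along v c F)"
  unfolding proj_along_def
  using homogeneous_substitute[of d F 1 "\<lambda>j. Var j - Const (v $ j) * lin c"]
  by (simp add: homogeneous_diff homogeneous_Const_mult)

lemma proj_along_lin: "proj_along v c (lin d) = lin d - Const (pairing d v) * lin c"
proof -
  have "proj_along v c (lin d) = (\<Sum>j\<in>UNIV. Const (d $ j) * Var j - Const (d $ j * v $ j) * lin c)"
    unfolding proj_along_def by (simp add: Csub.substitute_lin Const_mult algebra_simps)
  also have "\<dots> = lin d - Const (pairing d v) * lin c"
    by (simp add: sum_subtractf lin_def[of d] pairing_def Const_sum sum_distrib_right)
  finally show ?thesis .
qed

lemma mult_proj_along:
  assumes "homogeneous k H" "pairing c v = 1"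
  shows "mult_at_least k (proj_along v c H) v"
proof -
  have "shift v (proj_along v c H) = proj_along v c H"
    unfolding proj_along_def shift_def Csub.substitute_substitute
    unfolding shift_def[symmetric]
    by (simp add: shift_lin assms algebra_simps)
  then show ?thesis
    by (simp add: mult_at_least_shift low_homogeneous homogeneous_proj_along assms)
qed

text \<open>
  Every vector is \<open>c(X) v + Z\<close> with \<open>Z\<close> in the hyperplane \<open>c = 0\<close>. Homogeneity allows to divide by
  \<open>c(X)\<close>, in the function field, and to expand at \<open>v\<close>. In contrast to the Taylor expansion itself this
  expresses a form through forms of the same degree, which makes the tangential part of the expansion
  visible.
\<close>

lemma taylor_form:
  fixes F :: "'n::{finite,linorder} mpoly"
  assumes "homogeneous d F" "pairing c v = 1"
  shows "F = (\<Sum>j\<le>d. lin c ^ (d - j) * proj_along v c (hom_part j (shift v F)))"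
proof -
  define s where "s = to_frac (lin c)"
  define z where "z j = to_frac (Var j - Const (v $ j) * lin c)" for j
  let ?\<iota> = "\<lambda>c. to_frac (Const c :: 'n mpoly)"
  have "c \<noteq> 0" using assms(2) by (auto simp: pairing_def)
  then have "s \<noteq> 0" by (simp add: s_def)
  have parts: "shift v F = (\<Sum>j\<le>d. hom_part j (shift v F))"
    by (rule hom_part_expand) (use degree_le_shift[OF assms(1)] in \<open>auto simp: degree_le_def\<close>)
  have "to_frac F = substitute ?\<iota> (\<lambda>j. to_frac (Var j)) F"
    using to_frac_substitute[of Var F] by simp
  also have "(\<lambda>j. to_frac (Var j)) = (\<lambda>j. s * (?\<iota> (v $ j) + z j / s))"
    using \<open>s \<noteq> 0\<close> by (simp add: fun_eq_iff z_def s_def[symmetric] field_simps)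
  also have "substitute ?\<iota> \<dots> F = s ^ d * substitute ?\<iota> (\<lambda>j. ?\<iota> (v $ j) + z j / s) F"
    by (rule frac.substitute_scale) fact
  also have "substitute ?\<iota> (\<lambda>j. ?\<iota> (v $ j) + z j / s) F
      = substitute ?\<iota> (\<lambda>j. z j / s) (shift v F)"
    by (simp add: shift_def frac.substitute_substitute)
  also have "\<dots> = (\<Sum>j\<le>d. substitute ?\<iota> (\<lambda>j. z j / s) (hom_part j (shift v F)))"
    by (subst parts) (rule frac.substitute_sum)
  also have "\<dots> = (\<Sum>j\<le>d. (1 / s) ^ j * to_frac (proj_along v c (hom_part j (shift v F))))"
  proof (rule sum.cong[OF refl])
    fix j
    have "to_frac (proj_along v c (hom_part j (shift v F)))
        = substitute ?\<iota> z (hom_part j (shift v F))"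
      unfolding proj_along_def to_frac_substitute z_def ..
    then show "substitute ?\<iota> (\<lambda>j. z j / s) (hom_part j (shift v F))
        = (1 / s) ^ j * to_frac (proj_along v c (hom_part j (shift v F)))"
      using frac.substitute_scale[OF hom_part_homogeneous, of "1 / s" z j "shift v F"]
      by (simp only: times_divide_eq_left mult_1_left)
  qed
  also have "s ^ d * \<dots> = (\<Sum>j\<le>d. s ^ (d - j) * to_frac (proj_along v c (hom_part j (shift v F))))"
    unfolding sum_distrib_left
    by (rule sum.cong[OF refl]) (use \<open>s \<noteq> 0\<close> in \<open>simp add: power_diff power_one_over field_simps\<close>)
  also have "\<dots> = to_frac (\<Sum>j\<le>d. lin c ^ (d - j) * proj_along v c (hom_part j (shift v F)))"
    by (simp add: to_frac_sum s_def)
  finally show ?thesis by (simp only: to_frac_inject)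
qed

text \<open>
  The lowest term of the expansion: a form that vanishes to order \<open>k\<close> is, up to order \<open>k + 1\<close>, a
  power of \<open>c\<close> times a form of degree \<open>k\<close>.
\<close>

lemma leading_form:
  fixes F :: "'n::{finite,linorder} mpoly"
  assumes F: "homogeneous d F" "mult_at_least k F v" and c: "pairing c v = 1" and "k \<le> d"
  obtains K where "homogeneous k K" "mult_at_least k K v"
    "mult_at_least (Suc k) (F - lin c ^ (d - k) * K) v"
proof
  let ?K = "\<lambda>j. proj_along v c (hom_part j (shift v F))"
  show "homogeneous k (?K k)" by (simp add: homogeneous_proj_along)
  show "mult_at_least k (?K k) v" by (simp add: mult_proj_along c)
  have zero: "?K j = 0" if "j < k" for j
    using F(2) that by (simp add: mult_at_least_shift low_iff_hom_part proj_along_def)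
  have "F = (\<Sum>j\<le>d. lin c ^ (d - j) * ?K j)" by (rule taylor_form) fact+
  also have "\<dots> = lin c ^ (d - k) * ?K k + (\<Sum>j\<in>{..d} - {k}. lin c ^ (d - j) * ?K j)"
    using \<open>k \<le> d\<close> by (subst sum.remove[of _ k]) auto
  finally have "F - lin c ^ (d - k) * ?K k = (\<Sum>j\<in>{..d} - {k}. lin c ^ (d - j) * ?K j)"
    by (simp add: algebra_simps)
  moreover have "mult_at_least (Suc k) (lin c ^ (d - j) * ?K j) v" if "j \<in> {..d} - {k}" for j
  proof (cases "j < k")
    case False
    have "mult_at_least j (lin c ^ (d - j) * ?K j) v"
      by (intro mult_at_least_mult_left mult_proj_along c) simp
    then show ?thesis by (rule mult_at_least_mono) (use that False in auto)
  qed (simp add: zero)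
  ultimately show "mult_at_least (Suc k) (F - lin c ^ (d - k) * ?K k) v"
    by (simp only: mult_at_least_sum)
qed

text \<open>
  Near \<open>v\<close> the form \<open>W\<close> is a unit, and the jet of \<open>F / W\<close> is corrected one order at a time. The
  degree of \<open>H\<close> is the least in which all jets of this order exist.
\<close>

lemma local_division:
  fixes F :: "'n::{finite,linorder} mpoly"
  assumes F: "homogeneous d F" and W: "homogeneous e W" "eval_at W v \<noteq> 0"
    and d: "d = e + k" and "v \<noteq> 0"
  obtains H where "homogeneous k H" "mult_at_least (Suc k) (F - W * H) v"
proof -
  obtain c where c: "pairing c v = 1" using ex_pairing_1 \<open>v \<noteq> 0\<close> by blast
  have "\<exists>H. homogeneous k H \<and> mult_at_least n (F - W * H) v" if "n \<le> Suc k" for n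
    using that
  proof (induction n)
    case 0
    show ?case by (intro exI[of _ 0]) simp
  next
    case (Suc n)
    then obtain H where H: "homogeneous k H" "mult_at_least n (F - W * H) v" by auto
    let ?R = "F - W * H"
    have R: "homogeneous d ?R"
      using F homogeneous_mult[OF W(1) H(1)] d by (simp add: homogeneous_diff)
    have "n \<le> d" "n \<le> k" using Suc.prems d by auto
    obtain K where K: "homogeneous n K" "mult_at_least n K v"
      "mult_at_least (Suc n) (?R - lin c ^ (d - n) * K) v"
      using leading_form[OF R H(2) c \<open>n \<le> d\<close>] by blast
    let ?a = "1 / eval_at W v"
    let ?H = "H + Const ?a * (lin c ^ (k - n) * K)"
    have "homogeneous k ?H"
    proof (intro homogeneous_add H homogeneous_Const_mult)
      show "homogeneous k (lin c ^ (k - n) * K)"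
        using homogeneous_mult[OF homogeneous_power[OF homogeneous_lin(1), of "k - n"] K(1)] \<open>n \<le> k\<close>
        by simp
    qed
    moreover have "mult_at_least (Suc n) (F - W * ?H) v"
    proof -
      have "d - n = e + (k - n)" using d \<open>n \<le> k\<close> by simp
      then have "lin c ^ (d - n) = lin c ^ e * lin c ^ (k - n)" by (simp add: power_add)
      then have "F - W * ?H = (?R - lin c ^ (d - n) * K)
          + (lin c ^ e - Const ?a * W) * (lin c ^ (k - n) * K)"
        by (simp add: algebra_simps)
      moreover have "mult_at_least 1 (lin c ^ e - Const ?a * W) v"
        unfolding mult_at_least_1_iff using W(2) c by simp
      then have "mult_at_least (1 + n) ((lin c ^ e - Const ?a * W) * (lin c ^ (k - n) * K)) v"
        by (intro mult_at_least_mult mult_at_least_mult_left K)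
      ultimately show ?thesis using mult_at_least_add[OF K(3)] by (simp only: plus_1_eq_Suc)
    qed
    ultimately show ?case by blast
  qed
  from this[of "Suc k"] that show ?thesis by blast
qed

text \<open>Two nonzero vectors are separated by a linear form iff they are different projective points.\<close>

definition separated :: "'i set \<Rightarrow> ('i \<Rightarrow> complex ^ 'n) \<Rightarrow> bool" where
  "separated I p \<longleftrightarrow> (\<forall>i\<in>I. p i \<noteq> 0) \<and>
     (\<forall>i\<in>I. \<forall>j\<in>I. i \<noteq> j \<longrightarrow> (\<exists>c. pairing c (p j) = 0 \<and> pairing c (p i) \<noteq> 0))"

text \<open>
  The summand responsible for one point is divided by a product of powers of linear forms that vanish
  to the required orders at the other points. The bound on \<open>d\<close> leaves enough degree for this product.
\<close>

lemma interpolation: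
  fixes F :: "'i \<Rightarrow> 'n::{finite,linorder} mpoly"
  assumes "finite I" and sep: "separated I p" and F: "\<And>i. i \<in> I \<Longrightarrow> homogeneous d (F i)"
    and d: "(\<Sum>i\<in>I. \<mu> i) \<le> d"
  obtains G where "homogeneous d G" "\<And>i. i \<in> I \<Longrightarrow> mult_at_least (\<mu> i) (G - F i) (p i)"
proof -
  have "\<exists>K. homogeneous d K \<and> (\<forall>j\<in>I. mult_at_least (\<mu> j) (K - (if j = i then F i else 0)) (p j))"
    if i: "i \<in> I" for i
  proof (cases "\<mu> i = 0")
    case True
    then show ?thesis by (intro exI[of _ 0]) auto
  next
    case False
    have p: "p i \<noteq> 0" using sep i by (auto simp: separated_def)
    obtain c where c: "pairing c (p i) = 1" using ex_pairing_1[OF p] by blast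
    obtain l where l: "\<And>j. j \<in> I - {i} \<Longrightarrow> pairing (l j) (p j) = 0 \<and> pairing (l j) (p i) \<noteq> 0"
    proof -
      have "\<forall>j\<in>I - {i}. \<exists>c. pairing c (p j) = 0 \<and> pairing c (p i) \<noteq> 0"
        using sep i by (auto simp: separated_def)
      then show ?thesis using that by (auto dest!: bchoice)
    qed
    define P where "P = (\<Prod>j\<in>I - {i}. lin (l j) ^ \<mu> j)"
    define s where "s = (\<Sum>j\<in>I - {i}. \<mu> j)"
    have s: "s + \<mu> i \<le> d" using d \<open>finite I\<close> i by (simp add: s_def sum.remove[of I i])
    \<comment> \<open>The power of \<open>c\<close>, a unit at \<open>p i\<close>, brings the quotient to degree \<open>\<mu> i - 1\<close>.\<close>
    define W where "W = lin c ^ (d + 1 - s - \<mu> i) * P"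
    have "homogeneous s P"
      unfolding P_def s_def
      by (intro homogeneous_prod) (use homogeneous_power[OF homogeneous_lin(1)] in simp)
    then have "homogeneous ((d + 1 - s - \<mu> i) * 1 + s) W"
      unfolding W_def by (intro homogeneous_mult homogeneous_power homogeneous_lin)
    moreover have "(d + 1 - s - \<mu> i) * 1 + s = d + 1 - \<mu> i" using s by simp
    ultimately have W: "homogeneous (d + 1 - \<mu> i) W" by simp
    have "eval_at W (p i) \<noteq> 0"
      using \<open>finite I\<close> l c by (simp add: W_def P_def)
    moreover have "d = (d + 1 - \<mu> i) + (\<mu> i - 1)" using False s by simp
    ultimately obtain H where H: "homogeneous (\<mu> i - 1) H"
      "mult_at_least (Suc (\<mu> i - 1)) (F i - W * H) (p i)"
      using local_division[OF F[OF i] W] p by blast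
    have "homogeneous d (W * H)" using homogeneous_mult[OF W H(1)] False s by simp
    moreover have "mult_at_least (\<mu> i) (W * H - F i) (p i)"
      using H(2) False mult_at_least_diff[OF mult_at_least_0 H(2)] by simp
    moreover have "mult_at_least (\<mu> j) (W * H) (p j)" if j: "j \<in> I - {i}" for j
    proof -
      have "mult_at_least 1 (lin (l j)) (p j)" using l[OF j] by (simp only: mult_at_least_1_iff eval_lin)
      then have "mult_at_least (\<mu> j * 1) (lin (l j) ^ \<mu> j) (p j)"
        by (rule mult_at_least_power)
      then have "mult_at_least (\<mu> j) P (p j)"
        using \<open>finite I\<close> j unfolding P_def by (simp add: prod.remove[of _ j] mult_at_least_mult_right)
      then show ?thesis by (simp add: W_def mult_at_least_mult_left mult_at_least_mult_right)
    qed
    ultimately show ?thesis by (intro exI[of _ "W * H"]) auto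
  qed
  then obtain K where K: "\<And>i. i \<in> I \<Longrightarrow> homogeneous d (K i)"
    "\<And>i j. i \<in> I \<Longrightarrow> j \<in> I \<Longrightarrow> mult_at_least (\<mu> j) (K i - (if j = i then F i else 0)) (p j)"
    by (subgoal_tac "\<forall>i\<in>I. \<exists>K. homogeneous d K \<and>
        (\<forall>j\<in>I. mult_at_least (\<mu> j) (K - (if j = i then F i else 0)) (p j))") (drule bchoice, blast+)
  show ?thesis
  proof
    show "homogeneous d (sum K I)" by (intro homogeneous_sum K)
    fix j assume j: "j \<in> I"
    have "sum K I - F j = (\<Sum>i\<in>I. K i - (if j = i then F i else 0))"
      using \<open>finite I\<close> j by (simp add: sum_subtractf)
    then show "mult_at_least (\<mu> j) (sum K I - F j) (p j)"
      using K(2) j by (simp add: mult_at_least_sum)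
  qed
qed

section \<open>Monomials of a given degree\<close>

lemma mon_degree_UNIV: "mon_degree (t :: 'n::finite \<Rightarrow>\<^sub>0 nat) = (\<Sum>j\<in>UNIV. lookup t j)"
  by (rule mon_degree_superset) auto

lemma monomials_of_degree:
  shows finite_monomials: "finite {t :: 'n::finite \<Rightarrow>\<^sub>0 nat. mon_degree t = d}"
    and card_monomials: "card {t :: 'n::finite \<Rightarrow>\<^sub>0 nat. mon_degree t = d} = (d + CARD('n) - 1) choose d"
proof -
  obtain xs where xs: "set xs = (UNIV :: 'n set)" "distinct xs"
    using finite_distinct_list[of "UNIV :: 'n set"] by auto
  have len: "length xs = CARD('n)" using xs by (metis distinct_card)
  let ?L = "{l. length l = CARD('n) \<and> sum_list l = d}"
  let ?f = "\<lambda>t :: 'n \<Rightarrow>\<^sub>0 nat. map (lookup t) xs"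
  have bij: "bij_betw ?f {t. mon_degree t = d} ?L"
  proof (rule bij_betwI')
    fix s t :: "'n \<Rightarrow>\<^sub>0 nat"
    show "?f s = ?f t \<longleftrightarrow> s = t"
      using xs by (auto intro!: poly_mapping_eqI)
  next
    fix t :: "'n \<Rightarrow>\<^sub>0 nat" assume "t \<in> {t. mon_degree t = d}"
    then show "?f t \<in> ?L"
      using xs len by (simp add: sum_list_distinct_conv_sum_set mon_degree_UNIV)
  next
    fix l assume l: "l \<in> ?L"
    define g where "g j = l ! (THE i. i < length xs \<and> xs ! i = j)" for j
    have g: "g (xs ! i) = l ! i" if "i < length xs" for i
    proof -
      have "(THE k. k < length xs \<and> xs ! k = xs ! i) = i"
        using that xs(2) by (auto simp: nth_eq_iff_index_eq intro!: the_equality)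
      then show ?thesis by (simp add: g_def)
    qed
    let ?t = "Poly_Mapping.Abs_poly_mapping g"
    have t: "lookup ?t = g" by (rule lookup_Abs_poly_mapping) simp
    have "?f ?t = l" using l len g by (auto simp: t intro!: nth_equalityI)
    moreover from this have "mon_degree ?t = d"
      using l xs by (auto simp: mon_degree_UNIV t sum_list_distinct_conv_sum_set)
    ultimately show "\<exists>t\<in>{t. mon_degree t = d}. l = ?f t" by force
  qed
  have fin: "finite ?L"
    by (rule finite_subset[OF _ finite_lists_length_eq[of "{..d}" "CARD('n)"]])
      (auto dest: member_le_sum_list)
  show "finite {t :: 'n \<Rightarrow>\<^sub>0 nat. mon_degree t = d}"
    using bij_betw_finite[OF bij] fin by simp
  show "card {t :: 'n \<Rightarrow>\<^sub>0 nat. mon_degree t = d} = (d + CARD('n) - 1) choose d"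
    unfolding bij_betw_same_card[OF bij] by (rule card_length_sum_list)
qed

lemma lookup_sum_monomials:
  assumes "finite A"
  shows "lookup (\<Sum>t\<in>A. Const (x t) * Poly_Mapping.single t 1) s = (if s \<in> A then x s else 0)"
proof -
  have "lookup (\<Sum>t\<in>A. Const (x t) * Poly_Mapping.single t 1) s = (\<Sum>t\<in>A. if t = s then x t else 0)"
    by (auto simp: lookup_sum lookup_single when_def intro!: sum.cong)
  then show ?thesis using assms by simp
qed

lemma form_expand:
  fixes F :: "'n::finite mpoly"
  assumes "finite A" "keys F \<subseteq> A"
  shows "F = (\<Sum>t\<in>A. Const (lookup F t) * Poly_Mapping.single t 1)"
  by (rule poly_mapping_eqI) (use assms in \<open>auto simp: lookup_sum_monomials in_keys_iff\<close>)


section \<open>Linear systems as vector spaces\<close>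

lemma linear_systemI:
  "homogeneous d F \<Longrightarrow> (\<And>i. i \<in> I \<Longrightarrow> mult_at_least (m i) F (p i)) \<Longrightarrow> F \<in> linear_system I p d m"
  by (simp add: linear_system_def)

lemma linear_systemD:
  assumes "F \<in> linear_system I p d m"
  shows "homogeneous d F" "i \<in> I \<Longrightarrow> mult_at_least (m i) F (p i)"
  using assms by (auto simp: linear_system_def)

lemma subspace_linear_system: "mp.subspace (linear_system I p d m)"
  by (auto simp: mp.subspace_def linear_system_def
      intro: homogeneous_add homogeneous_Const_mult mult_at_least_add mult_at_least_mult_left)

lemma linear_system_antimono:
  "I \<subseteq> J \<Longrightarrow> linear_system J p d m \<subseteq> linear_system I p d m"
  by (auto simp: linear_system_def)

lemma linear_system_mult:
  assumes "F \<in> linear_system I p d m" "G \<in> linear_system I p e k"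
  shows "F * G \<in> linear_system I p (d + e) (\<lambda>i. m i + k i)"
  using assms by (auto simp: linear_system_def intro: homogeneous_mult mult_at_least_mult)

lemma linear_system_power:
  assumes "F \<in> linear_system I p d m"
  shows "F ^ n \<in> linear_system I p (n * d) (\<lambda>i. n * m i)"
  using assms by (auto simp: linear_system_def intro: homogeneous_power mult_at_least_power)

text \<open>
  Dimensions are bounded by choosing a set of monomials whose coefficients determine the element.
\<close>

lemma independent_card_le_coeffs:
  assumes L: "mp.subspace L" and T: "finite T"
    and inj: "\<And>F. F \<in> L \<Longrightarrow> (\<And>t. t \<in> T \<Longrightarrow> lookup F t = 0) \<Longrightarrow> F = 0"
    and B: "B \<subseteq> L" "mp.independent B"
  shows "finite B \<and> card B \<le> card T"
proof -
  have small: "card S \<le> card T" if S: "finite S" "S \<subseteq> B" for S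
  proof (rule ccontr)
    assume "\<not> card S \<le> card T"
    then have "card T < card S" by simp
    from underdetermined_system[OF T S(1) this, of "\<lambda>t F. lookup F t"] obtain x
      where x: "\<exists>F\<in>S. x F \<noteq> 0" "\<forall>t\<in>T. (\<Sum>F\<in>S. lookup F t * x F) = 0" by blast
    let ?F = "\<Sum>F\<in>S. Const (x F) * F"
    have "?F \<in> L" using S B(1) by (intro mp.subspace_sum[OF L] mp.subspace_scale[OF L]) auto
    moreover have "lookup ?F t = 0" if "t \<in> T" for t
      using x(2) that by (simp add: lookup_sum mult.commute[of "x _"])
    ultimately have "?F = 0" by (rule inj)
    then have "\<forall>F\<in>S. x F = 0"
      using B(2) S unfolding mp.independent_explicit_finite_subsets by blast
    with x(1) show False by blast
  qed
  have "finite B"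
  proof (rule ccontr)
    assume "infinite B"
    then obtain S where "S \<subseteq> B" "finite S" "card S = Suc (card T)"
      using infinite_arbitrarily_large by blast
    with small[of S] show False by simp
  qed
  with small[of B] show ?thesis by simp
qed

lemma basis_of_coeffs:
  assumes L: "mp.subspace L" and T: "finite T"
    and inj: "\<And>F. F \<in> L \<Longrightarrow> (\<And>t. t \<in> T \<Longrightarrow> lookup F t = 0) \<Longrightarrow> F = 0"
    and B: "B \<subseteq> L" "mp.independent B" "card B = card T"
  shows "L = mp.span B" "mp.dim L = card T"
proof -
  have fin: "finite B" using independent_card_le_coeffs[OF L T inj B(1,2)] by blast
  have "L \<subseteq> mp.span B"
  proof (rule subsetI, rule ccontr)
    fix F assume F: "F \<in> L" "F \<notin> mp.span B"
    then have "F \<notin> B" using mp.span_base by blast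
    have "mp.independent (insert F B)" using F(2) B(2) by (rule mp.independent_insertI)
    then have "card (insert F B) \<le> card T"
      using independent_card_le_coeffs[OF L T inj, of "insert F B"] F B(1) by blast
    with fin \<open>F \<notin> B\<close> B(3) show False by simp
  qed
  then show "L = mp.span B" using B(1) L by (simp add: mp.span_minimal subset_antisym)
  show "mp.dim L = card T"
    using mp.basis_card_eq_dim[OF B(1) \<open>L \<subseteq> mp.span B\<close> B(2)] B(3) by simp
qed


section \<open>General position\<close>

definition multihomogeneous :: "'i set \<Rightarrow> ('i \<Rightarrow> nat) \<Rightarrow> ('i \<times> 'n::finite) mpoly \<Rightarrow> bool" where
  "multihomogeneous I \<delta> G \<longleftrightarrow>
     (\<forall>t\<in>keys G. keys t \<subseteq> I \<times> UNIV \<and> (\<forall>i\<in>I. (\<Sum>j\<in>UNIV. lookup t (i, j)) = \<delta> i))"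

abbreviation at_points :: "('i \<Rightarrow> complex ^ 'n) \<Rightarrow> ('i \<times> 'n) mpoly \<Rightarrow> complex" where
  "at_points p G \<equiv> substitute (\<lambda>c. c) (\<lambda>(i, j). p i $ j) G"

lemma multihomogeneous_0 [simp]: "multihomogeneous I \<delta> 0"
  by (simp add: multihomogeneous_def)

lemma multihomogeneous_add:
  "multihomogeneous I \<delta> F \<Longrightarrow> multihomogeneous I \<delta> G \<Longrightarrow> multihomogeneous I \<delta> (F + G)"
  unfolding multihomogeneous_def using Poly_Mapping.keys_add[of F G] by blast

lemma multihomogeneous_diff:
  assumes "multihomogeneous I \<delta> F" "multihomogeneous I \<delta> G"
  shows "multihomogeneous I \<delta> (F - G)"
proof -
  have "multihomogeneous I \<delta> (- G)" using assms(2) by (simp add: multihomogeneous_def)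
  from multihomogeneous_add[OF assms(1) this] show ?thesis by simp
qed

lemma multihomogeneous_mult:
  assumes "multihomogeneous I \<delta> F" "multihomogeneous I \<epsilon> G"
  shows "multihomogeneous I (\<lambda>i. \<delta> i + \<epsilon> i) (F * G)"
  unfolding multihomogeneous_def
proof (intro ballI)
  fix t assume "t \<in> keys (F * G)"
  then obtain r s where rs: "r \<in> keys F" "s \<in> keys G" "t = r + s"
    using Poly_Mapping.keys_mult[of F G] by blast
  then have "keys t \<subseteq> I \<times> UNIV"
    using assms Poly_Mapping.keys_add[of r s] unfolding multihomogeneous_def by blast
  moreover have "(\<Sum>j\<in>UNIV. lookup t (i, j)) = \<delta> i + \<epsilon> i" if "i \<in> I" for i
    using rs assms that by (simp add: multihomogeneous_def lookup_add sum.distrib)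
  ultimately show "keys t \<subseteq> I \<times> UNIV \<and> (\<forall>i\<in>I. (\<Sum>j\<in>UNIV. lookup t (i, j)) = \<delta> i + \<epsilon> i)"
    by blast
qed

lemma multihomogeneous_Const [simp]: "multihomogeneous I (\<lambda>_. 0) (Const c)"
  by (auto simp: multihomogeneous_def lookup_Const in_keys_iff split: if_splits)

lemma multihomogeneous_Var:
  assumes "i \<in> I"
  shows "multihomogeneous I (\<lambda>k. if k = i then 1 else 0) (Var (i, j))"
proof -
  have "lookup (Poly_Mapping.single (i, j) (1::nat)) (k, l) = (if l = j then (if k = i then 1 else 0) else 0)"
    for k l by (auto simp: lookup_single when_def)
  then show ?thesis using assms by (simp add: multihomogeneous_def Var_def)
qed

text \<open>
  A property holds generically, as witnessed at \<open>p0\<close>, if it holds on a standard open set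
  containing \<open>p0\<close>. Since the witness is common to all properties considered, finitely many of
  them hold simultaneously on a nonempty open set.
\<close>

definition generically ::
  "'i set \<Rightarrow> ('i \<Rightarrow> complex ^ 'n) \<Rightarrow> (('i \<Rightarrow> complex ^ 'n) \<Rightarrow> bool) \<Rightarrow> bool" where
  "generically I p0 P \<longleftrightarrow>
     (\<exists>G \<delta>. multihomogeneous I \<delta> G \<and> at_points p0 G \<noteq> 0 \<and> (\<forall>p. at_points p G \<noteq> 0 \<longrightarrow> P p))"

lemma generically_conj:
  assumes "generically I p0 P" "generically I p0 Q"
  shows "generically I p0 (\<lambda>p. P p \<and> Q p)"
proof -
  from assms(1) obtain F \<delta> where F: "multihomogeneous I \<delta> F" "at_points p0 F \<noteq> 0"
    "\<forall>p. at_points p F \<noteq> 0 \<longrightarrow> P p" by (auto simp: generically_def)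
  from assms(2) obtain G \<epsilon> where G: "multihomogeneous I \<epsilon> G" "at_points p0 G \<noteq> 0"
    "\<forall>p. at_points p G \<noteq> 0 \<longrightarrow> Q p" by (auto simp: generically_def)
  show ?thesis
    unfolding generically_def
    by (intro exI[of _ "F * G"] exI[of _ "\<lambda>i. \<delta> i + \<epsilon> i"])
      (use F G multihomogeneous_mult[OF F(1) G(1)] in simp)
qed

lemma generically_True: "generically I p0 (\<lambda>_. True)"
  unfolding generically_def
  using multihomogeneous_Const[of I 1]
  by (intro exI[of _ "1"] exI[of _ "\<lambda>_. 0"]) simp

lemma generically_ball:
  assumes "finite A" "\<And>a. a \<in> A \<Longrightarrow> generically I p0 (P a)"
  shows "generically I p0 (\<lambda>p. \<forall>a\<in>A. P a p)"
  using assms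
proof (induction A rule: finite_induct)
  case empty
  then show ?case by (simp add: generically_True)
next
  case (insert a A)
  then have "generically I p0 (P a)" "generically I p0 (\<lambda>p. \<forall>a\<in>A. P a p)" by simp_all
  then show ?case using generically_conj by fastforce
qed

lemma generically_mono:
  "generically I p0 P \<Longrightarrow> (\<And>p. P p \<Longrightarrow> Q p) \<Longrightarrow> generically I p0 Q"
  unfolding generically_def by blast

lemma for_general_points_if_generically:
  assumes "generically I p0 P" "\<And>p. P p \<Longrightarrow> (\<And>i. i \<in> I \<Longrightarrow> p i \<noteq> 0) \<Longrightarrow> Q p"
  shows "for_general_points I Q"
proof -
  from assms(1) obtain G \<delta> where G: "multihomogeneous I \<delta> G" "at_points p0 G \<noteq> 0"
    "\<forall>p. at_points p G \<noteq> 0 \<longrightarrow> P p" by (auto simp: generically_def)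
  then have "G \<noteq> 0" by auto
  then show ?thesis
    unfolding for_general_points_def
    by (intro exI[of _ G] exI[of _ \<delta>]) (use G assms(2) in \<open>auto simp: multihomogeneous_def\<close>)
qed

text \<open>
  Gaussian elimination without divisions keeps the entries multihomogeneous, and a pivot that is
  nonzero at \<open>p0\<close> stays so on an open set.
\<close>

lemma generically_trivial_kernel:
  fixes M :: "'r \<Rightarrow> 'c \<Rightarrow> ('i \<times> 'n::finite) mpoly"
  assumes "finite C" "\<And>r c. r \<in> R \<Longrightarrow> c \<in> C \<Longrightarrow> multihomogeneous I (\<delta> r) (M r c)"
    and "\<And>x. (\<And>r. r \<in> R \<Longrightarrow> (\<Sum>c\<in>C. at_points p0 (M r c) * x c) = 0) \<Longrightarrow> \<forall>c\<in>C. x c = 0"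
  shows "generically I p0
    (\<lambda>p. \<forall>x. (\<forall>r\<in>R. (\<Sum>c\<in>C. at_points p (M r c) * x c) = 0) \<longrightarrow> (\<forall>c\<in>C. x c = 0))"
  using assms
proof (induction C arbitrary: M \<delta> rule: finite_induct)
  case empty
  then show ?case by (simp add: generically_True)
next
  case (insert c0 C)
  have "\<exists>r\<in>R. at_points p0 (M r c0) \<noteq> 0"
  proof (rule ccontr)
    assume *: "\<not> ?thesis"
    have "(\<Sum>c\<in>insert c0 C. at_points p0 (M r c) * (if c = c0 then 1 else 0)) = 0" if "r \<in> R" for r
      using insert.hyps * that by (auto intro!: sum.neutral)
    then have "\<forall>c\<in>insert c0 C. (if c = c0 then 1 else 0 :: complex) = 0"
      by (rule insert.prems(2))
    then show False by simp
  qed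
  then obtain r0 where r0: "r0 \<in> R" "at_points p0 (M r0 c0) \<noteq> 0" by blast
  define M' where "M' r c = M r0 c0 * M r c - M r c0 * M r0 c" for r c
  have M'_eval: "at_points p (M' r c)
      = at_points p (M r0 c0) * at_points p (M r c) - at_points p (M r c0) * at_points p (M r0 c)"
    for p r c by (simp add: M'_def)
  have elim: "(\<Sum>c\<in>C. at_points p (M' r c) * x c)
      = at_points p (M r0 c0) * (\<Sum>c\<in>C. at_points p (M r c) * x c)
        - at_points p (M r c0) * (\<Sum>c\<in>C. at_points p (M r0 c) * x c)" for p r x
    unfolding M'_eval by (simp add: sum_distrib_left sum_subtractf algebra_simps)
  have "generically I p0
    (\<lambda>p. \<forall>x. (\<forall>r\<in>R. (\<Sum>c\<in>C. at_points p (M' r c) * x c) = 0) \<longrightarrow> (\<forall>c\<in>C. x c = 0))"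
  proof (rule insert.IH)
    fix r c assume rc: "r \<in> R" "c \<in> C"
    have "multihomogeneous I (\<lambda>i. \<delta> r0 i + \<delta> r i) (M r0 c0 * M r c)"
      using rc r0 insert.prems(1) by (intro multihomogeneous_mult) auto
    moreover have "multihomogeneous I (\<lambda>i. \<delta> r i + \<delta> r0 i) (M r c0 * M r0 c)"
      using rc r0 insert.prems(1) by (intro multihomogeneous_mult) auto
    ultimately show "multihomogeneous I ((\<lambda>r i. \<delta> r0 i + \<delta> r i) r) (M' r c)"
      unfolding M'_def by (intro multihomogeneous_diff) (simp_all add: add.commute)
  next
    fix x assume x: "\<And>r. r \<in> R \<Longrightarrow> (\<Sum>c\<in>C. at_points p0 (M' r c) * x c) = 0"
    let ?y = "\<lambda>c. if c = c0 then - (\<Sum>c\<in>C. at_points p0 (M r0 c) * x c) / at_points p0 (M r0 c0) else x c"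
    have "\<forall>c\<in>insert c0 C. ?y c = 0"
    proof (rule insert.prems(2))
      fix r assume r: "r \<in> R"
      have "(\<Sum>c\<in>C. at_points p0 (M r c) * ?y c) = (\<Sum>c\<in>C. at_points p0 (M r c) * x c)"
        using insert.hyps by (intro sum.cong) auto
      then show "(\<Sum>c\<in>insert c0 C. at_points p0 (M r c) * ?y c) = 0"
        using insert.hyps x[OF r] r0 unfolding elim by (simp add: field_simps)
    qed
    then show "\<forall>c\<in>C. x c = 0" using insert.hyps by (metis insertCI)
  qed
  moreover have "generically I p0 (\<lambda>p. at_points p (M r0 c0) \<noteq> 0)"
    unfolding generically_def using r0 insert.prems(1)[of r0 c0] by blast
  ultimately have "generically I p0 (\<lambda>p.
    (\<forall>x. (\<forall>r\<in>R. (\<Sum>c\<in>C. at_points p (M' r c) * x c) = 0) \<longrightarrow> (\<forall>c\<in>C. x c = 0)) \<and>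
    at_points p (M r0 c0) \<noteq> 0)" by (rule generically_conj)
  then show ?case
  proof (rule generically_mono, elim conjE, intro allI impI)
    fix p x
    assume kernel: "\<forall>x. (\<forall>r\<in>R. (\<Sum>c\<in>C. at_points p (M' r c) * x c) = 0) \<longrightarrow> (\<forall>c\<in>C. x c = 0)"
      and pivot: "at_points p (M r0 c0) \<noteq> 0"
      and x: "\<forall>r\<in>R. (\<Sum>c\<in>insert c0 C. at_points p (M r c) * x c) = 0"
    have row: "(\<Sum>c\<in>C. at_points p (M r c) * x c) = - at_points p (M r c0) * x c0" if "r \<in> R" for r
      using x that insert.hyps by (simp add: add_eq_0_iff)
    have "\<forall>r\<in>R. (\<Sum>c\<in>C. at_points p (M' r c) * x c) = 0"
      using row r0(1) by (simp add: elim)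
    then have "\<forall>c\<in>C. x c = 0" using kernel by blast
    moreover from this have "x c0 = 0" using row[OF r0(1)] pivot by simp
    ultimately show "\<forall>c\<in>insert c0 C. x c = 0" by simp
  qed
qed

lemma lookup_Var_mult:
  "lookup (Var j * F) t = (if lookup t j = 0 then 0 else lookup F (t - Poly_Mapping.single j 1))"
proof -
  have *: "Poly_Mapping.single j 1 + r = t \<longleftrightarrow> lookup t j \<noteq> 0 \<and> r = t - Poly_Mapping.single j 1" for r
    by (auto simp: poly_mapping_eq_iff lookup_add lookup_minus lookup_single when_def fun_eq_iff)
  have "lookup (Var j * F) t = (\<Sum>r\<in>keys F. if Poly_Mapping.single j 1 + r = t then lookup F r else 0)"
    unfolding Var_def mpoly_lookup_single_mult by (auto intro!: sum.cong)
  also have "\<dots> = (if lookup t j = 0 then 0 else lookup F (t - Poly_Mapping.single j 1))"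
    unfolding * by (auto simp: in_keys_iff)
  finally show ?thesis .
qed

text \<open>The Taylor coefficients of a fixed monomial at a point are forms in the coordinates of the point.\<close>

lemma taylor_coefficient_multihomogeneous:
  fixes c :: "'n::finite \<Rightarrow>\<^sub>0 nat"
  assumes "i \<in> I"
  shows "\<exists>M. (mon_degree c < mon_degree t \<longrightarrow> M = 0) \<and>
    multihomogeneous I (\<lambda>k. if k = i then mon_degree c - mon_degree t else 0) M \<and>
    (\<forall>p. at_points p M = lookup (shift (p i) (Poly_Mapping.single c 1)) t)"
proof (induction "mon_degree c" arbitrary: c t)
  case 0
  then have "c = 0" by (simp add: mon_degree_eq_0_iff)
  show ?case
  proof (cases "t = 0")
    case True
    have "(\<lambda>k. if k = i then mon_degree c - mon_degree t else 0) = (\<lambda>_. 0)"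
      using \<open>c = 0\<close> by auto
    then show ?thesis
      using \<open>c = 0\<close> True multihomogeneous_Const[of I 1] by (intro exI[of _ 1]) simp
  next
    case False
    then show ?thesis using \<open>c = 0\<close> by (intro exI[of _ 0]) (simp add: lookup_one when_def)
  qed
next
  case (Suc d)
  then have "c \<noteq> 0" by auto
  then obtain j where j: "lookup c j \<noteq> 0" by (auto simp: poly_mapping_eq_iff fun_eq_iff)
  define c' where "c' = c - Poly_Mapping.single j 1"
  have c: "c = Poly_Mapping.single j 1 + c'"
    using j by (auto simp: c'_def poly_mapping_eq_iff lookup_add lookup_minus lookup_single when_def fun_eq_iff)
  then have deg: "mon_degree c = Suc (mon_degree c')" by (simp add: mon_degree_add)
  then have IH: "\<exists>M. (mon_degree c' < mon_degree t \<longrightarrow> M = 0) \<and>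
    multihomogeneous I (\<lambda>k. if k = i then mon_degree c' - mon_degree t else 0) M \<and>
    (\<forall>p. at_points p M = lookup (shift (p i) (Poly_Mapping.single c' 1)) t)" for t
    using Suc.hyps(1)[of c' t] Suc.hyps(2) by auto
  obtain M where M: "mon_degree c' < mon_degree t \<longrightarrow> M = 0"
    "multihomogeneous I (\<lambda>k. if k = i then mon_degree c' - mon_degree t else 0) M"
    "\<And>p. at_points p M = lookup (shift (p i) (Poly_Mapping.single c' 1)) t"
    using IH[of t] by blast
  have split: "Poly_Mapping.single c 1 = Var j * Poly_Mapping.single c' (1::complex)"
    by (simp add: Var_def c mult_single)
  have step: "lookup (shift (p i) (Poly_Mapping.single c 1)) t
      = p i $ j * lookup (shift (p i) (Poly_Mapping.single c' 1)) t
        + (if lookup t j = 0 then 0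
           else lookup (shift (p i) (Poly_Mapping.single c' 1)) (t - Poly_Mapping.single j 1))"
    for p :: "'a \<Rightarrow> complex ^ 'n"
    unfolding split by (simp add: distrib_right lookup_add lookup_Var_mult)
  have VM: "multihomogeneous I (\<lambda>k. if k = i then mon_degree c - mon_degree t else 0) (Var (i, j) * M)"
  proof (cases "mon_degree c' < mon_degree t")
    case False
    then have *: "(\<lambda>k. if k = i then mon_degree c - mon_degree t else 0)
        = (\<lambda>k. (if k = i then 1 else 0) + (if k = i then mon_degree c' - mon_degree t else 0))"
      using deg by (auto simp: fun_eq_iff)
    show ?thesis
      unfolding * by (intro multihomogeneous_mult multihomogeneous_Var M \<open>i \<in> I\<close>)
  qed (use M in simp)
  show ?case
  proof (cases "lookup t j = 0")
    case True
    then show ?thesis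
      using VM M step deg by (intro exI[of _ "Var (i, j) * M"]) auto
  next
    case False
    define t' where "t' = t - Poly_Mapping.single j 1"
    have "t = Poly_Mapping.single j 1 + t'"
      using False by (auto simp: t'_def poly_mapping_eq_iff lookup_add lookup_minus lookup_single when_def fun_eq_iff)
    then have deg': "mon_degree t = Suc (mon_degree t')" by (simp add: mon_degree_add)
    obtain N where N: "mon_degree c' < mon_degree t' \<longrightarrow> N = 0"
      "multihomogeneous I (\<lambda>k. if k = i then mon_degree c' - mon_degree t' else 0) N"
      "\<And>p. at_points p N = lookup (shift (p i) (Poly_Mapping.single c' 1)) t'"
      using IH[of t'] by blast
    have "multihomogeneous I (\<lambda>k. if k = i then mon_degree c - mon_degree t else 0) (Var (i, j) * M + N)"
    proof (rule multihomogeneous_add[OF VM])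
      have "(\<lambda>k. if k = i then mon_degree c - mon_degree t else 0)
          = (\<lambda>k. if k = i then mon_degree c' - mon_degree t' else 0)"
        by (simp only: deg deg' diff_Suc_Suc)
      then show "multihomogeneous I (\<lambda>k. if k = i then mon_degree c - mon_degree t else 0) N"
        using N(2) by (simp only:)
    qed
    then show ?thesis
      using M N step False deg deg' by (intro exI[of _ "Var (i, j) * M + N"]) (auto simp: t'_def)
  qed
qed

lemma low_iff_lookup: "low k F \<longleftrightarrow> (\<forall>t. mon_degree t < k \<longrightarrow> lookup F t = 0)"
  unfolding low_def by (meson in_keys_iff not_le)

text \<open>
  Upper semicontinuity of the dimension: the conditions imposed by the points have a trivial common
  kernel on the span of the monomials outside \<open>T\<close>, and this persists near \<open>p0\<close>. It bounds the
  dimension of the system by \<open>card T\<close>.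
\<close>

lemma generically_linear_system:
  fixes T :: "('n::finite \<Rightarrow>\<^sub>0 nat) set" and p0 :: "'i \<Rightarrow> complex ^ 'n"
  assumes "J \<subseteq> I"
    and p0: "\<And>F. F \<in> linear_system J p0 d m \<Longrightarrow> (\<And>t. t \<in> T \<Longrightarrow> lookup F t = 0) \<Longrightarrow> F = 0"
  shows "generically I p0
    (\<lambda>p. \<forall>F\<in>linear_system J p d m. (\<forall>t\<in>T. lookup F t = 0) \<longrightarrow> F = 0)"
proof -
  let ?C = "{c :: 'n \<Rightarrow>\<^sub>0 nat. mon_degree c = d} - T"
  let ?R = "{(i, t :: 'n \<Rightarrow>\<^sub>0 nat). i \<in> J \<and> mon_degree t < m i}"
  have fin: "finite ?C" by (intro finite_Diff finite_monomials)
  define M :: "'i \<Rightarrow> ('n \<Rightarrow>\<^sub>0 nat) \<Rightarrow> ('n \<Rightarrow>\<^sub>0 nat) \<Rightarrow> ('i \<times> 'n) mpoly" where "M i t c = (SOME M.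
      multihomogeneous I (\<lambda>k. if k = i then mon_degree c - mon_degree t else 0) M \<and>
      (\<forall>p. at_points p M = lookup (shift (p i) (Poly_Mapping.single c 1 :: 'n mpoly)) t))" for i t c
  have M: "multihomogeneous I (\<lambda>k. if k = i then mon_degree c - mon_degree t else 0) (M i t c)"
    "at_points p (M i t c) = lookup (shift (p i) (Poly_Mapping.single c 1 :: 'n mpoly)) t"
    if "i \<in> I" for i t c p
  proof -
    have "\<exists>M. multihomogeneous I (\<lambda>k. if k = i then mon_degree c - mon_degree t else 0) M \<and>
      (\<forall>p. at_points p M = lookup (shift (p i) (Poly_Mapping.single c 1 :: 'n mpoly)) t)"
      using taylor_coefficient_multihomogeneous[OF that, of c t] by blast
    from someI_ex[OF this, folded M_def]
    show "multihomogeneous I (\<lambda>k. if k = i then mon_degree c - mon_degree t else 0) (M i t c)"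
      "at_points p (M i t c) = lookup (shift (p i) (Poly_Mapping.single c 1 :: 'n mpoly)) t"
      by blast+
  qed
  let ?F = "\<lambda>x. \<Sum>c\<in>?C. Const (x c) * Poly_Mapping.single c 1 :: 'n mpoly"
  have conditions: "(\<Sum>c\<in>?C. at_points p (M i t c) * x c) = lookup (shift (p i) (?F x)) t"
    if "i \<in> I" for p i t x
    using that by (simp add: M(2) lookup_sum mult.commute)
  have F: "homogeneous d (?F x)" "\<And>t. t \<in> T \<Longrightarrow> lookup (?F x) t = 0" for x
    using fin by (auto simp: homogeneous_def in_keys_iff lookup_sum_monomials split: if_splits)
  have system: "?F x \<in> linear_system J p d m \<longleftrightarrow>
      (\<forall>r\<in>?R. (\<Sum>c\<in>?C. at_points p (case r of (i, t) \<Rightarrow> M i t c) * x c) = 0)" for p x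
  proof -
    have "mult_at_least (m i) (?F x) (p i) \<longleftrightarrow>
        (\<forall>t. mon_degree t < m i \<longrightarrow> (\<Sum>c\<in>?C. at_points p (M i t c) * x c) = 0)" if "i \<in> J" for i
    proof -
      have "i \<in> I" using that \<open>J \<subseteq> I\<close> by blast
      then show ?thesis
        by (simp only: mult_at_least_shift low_iff_lookup conditions[OF \<open>i \<in> I\<close>])
    qed
    then show ?thesis using F(1) by (auto simp: linear_system_def)
  qed
  have zero: "\<forall>c\<in>?C. x c = 0" if "?F x = 0" for x
    using that lookup_sum_monomials[OF fin, of x] by (metis lookup_zero)
  have "generically I p0 (\<lambda>p. \<forall>x. (\<forall>r\<in>?R. (\<Sum>c\<in>?C. at_points p (case r of (i, t) \<Rightarrow> M i t c) * x c) = 0)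
      \<longrightarrow> (\<forall>c\<in>?C. x c = 0))"
  proof (rule generically_trivial_kernel[OF fin])
    fix r c assume "r \<in> ?R" "c \<in> ?C"
    then show "multihomogeneous I ((\<lambda>(i, t) k. if k = i then d - mon_degree t else 0) r)
        (case r of (i, t) \<Rightarrow> M i t c)"
      using M(1) \<open>J \<subseteq> I\<close> by force
  next
    fix x
    assume "\<And>r. r \<in> ?R \<Longrightarrow> (\<Sum>c\<in>?C. at_points p0 (case r of (i, t) \<Rightarrow> M i t c) * x c) = 0"
    then have "?F x \<in> linear_system J p0 d m" unfolding system by blast
    then have "?F x = 0" by (rule p0) (rule F(2))
    then show "\<forall>c\<in>?C. x c = 0" by (rule zero)
  qed
  then show ?thesis
  proof (rule generically_mono, intro ballI impI)
    fix p F
    assume kernel: "\<forall>x. (\<forall>r\<in>?R. (\<Sum>c\<in>?C. at_points p (case r of (i, t) \<Rightarrow> M i t c) * x c) = 0)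
      \<longrightarrow> (\<forall>c\<in>?C. x c = 0)"
      and F: "F \<in> linear_system J p d m" "\<forall>t\<in>T. lookup F t = 0"
    have "keys F \<subseteq> ?C"
      using linear_systemD(1)[OF F(1)] F(2) by (auto simp: homogeneous_def in_keys_iff)
    then have expand: "F = ?F (lookup F)" by (rule form_expand[OF fin])
    then have "?F (lookup F) \<in> linear_system J p d m" using F(1) by (rule subst)
    then have "\<forall>c\<in>?C. lookup F c = 0" using kernel unfolding system by blast
    then have "?F (lookup F) = 0" by (intro sum.neutral) simp
    with expand show "F = 0" by (rule trans)
  qed
qed

section \<open>Linear forms in general position with respect to points\<close>

definition linearly_closed :: "(complex ^ 'n) set \<Rightarrow> bool" where
  "linearly_closed U \<longleftrightarrow> (\<forall>x\<in>U. \<forall>y\<in>U. \<forall>a b. a *s x + b *s y \<in> U)"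

text \<open>
  On a line through a point outside all but one of the subspaces, in a direction outside the last
  one, each subspace excludes at most one point.
\<close>

lemma avoid_finitely_many_subspaces:
  assumes "finite K" and V: "linearly_closed V" "V \<noteq> {}"
    and U: "\<And>k. k \<in> K \<Longrightarrow> linearly_closed (U k)" "\<And>k. k \<in> K \<Longrightarrow> \<not> V \<subseteq> U k"
  shows "\<exists>v\<in>V. \<forall>k\<in>K. v \<notin> U k"
  using assms(1) U
proof (induction K rule: finite_induct)
  case empty
  with V(2) show ?case by auto
next
  case (insert k K)
  then obtain v where v: "v \<in> V" "\<forall>l\<in>K. v \<notin> U l" by auto
  obtain w where w: "w \<in> V" "w \<notin> U k" using insert.prems(2)[of k] by auto
  show ?case
  proof (cases "v \<in> U k")
    case False
    with v show ?thesis by auto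
  next
    case True
    define bad where "bad l = {c. c \<noteq> 0 \<and> v + c *s w \<in> U l}" for l
    have "finite (bad l)" if "l \<in> K" for l
    proof -
      have "c = c'" if "c \<in> bad l" "c' \<in> bad l" for c c'
      proof (rule ccontr)
        assume "c \<noteq> c'"
        have "v = (c' / (c' - c)) *s (v + c *s w) + (- c / (c' - c)) *s (v + c' *s w)"
        proof -
          define e where "e = c' - c"
          have "e \<noteq> 0" "c' = c + e" using \<open>c \<noteq> c'\<close> by (simp_all add: e_def)
          then have "x = (c' / e) * (x + c * y) + (- c / e) * (x + c' * y)" for x y
            by (simp add: field_simps)
          then show ?thesis by (simp add: vec_eq_iff e_def)
        qed
        also have "\<dots> \<in> U l"
          using that insert.prems(1)[of l] \<open>l \<in> K\<close> unfolding linearly_closed_def bad_def by blast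
        finally show False using v(2) \<open>l \<in> K\<close> by blast
      qed
      then have "bad l \<subseteq> {SOME c. c \<in> bad l}" by (metis singleton_iff someI subsetI)
      then show ?thesis by (rule finite_subset) simp
    qed
    then have "finite (insert 0 (\<Union>l\<in>K. bad l))" using insert.hyps by auto
    then obtain c where c: "c \<notin> insert 0 (\<Union>l\<in>K. bad l)"
      using infinite_UNIV_char_0[where 'a = complex] by (metis ex_new_if_finite)
    have "v + c *s w \<notin> U k"
    proof
      assume "v + c *s w \<in> U k"
      then have "(1 / c) *s (v + c *s w) + (- 1 / c) *s v \<in> U k"
        using True insert.prems(1)[of k] unfolding linearly_closed_def by blast
      moreover have "(1 / c) *s (v + c *s w) + (- 1 / c) *s v = w"
        using c by (simp add: vec_eq_iff field_simps)
      ultimately show False using w(2) by simp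
    qed
    moreover have "v + c *s w \<in> V"
      using V(1) v(1) w(1) unfolding linearly_closed_def by (metis scalar_mult_eq_scaleR scaleR_one vector_smult_lid)
    ultimately show ?thesis using c by (intro bexI[of _ "v + c *s w"]) (auto simp: bad_def)
  qed
qed

lemma pairing_combination: "pairing (a *s x + b *s y) v = a * pairing x v + b * pairing y v"
  by (simp add: pairing_add pairing_scale)

text \<open>
  The witness comes from a vector on which \<open>x\<close> and \<open>y\<close> vanish and which is not proportional to
  \<open>v\<close>; it exists because three linear conditions in at least four unknowns have a solution.
\<close>

lemma orthogonal_not_in_plane:
  fixes x y v :: "complex ^ 'n::finite"
  assumes "CARD('n) \<ge> 4" "v \<noteq> 0"
  shows "\<exists>c. pairing c v = 0 \<and> (\<forall>a b. c \<noteq> a *s x + b *s y)"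
proof -
  obtain j0 where j0: "v $ j0 \<noteq> 0" using \<open>v \<noteq> 0\<close> by (auto simp: vec_eq_iff)
  have "card {0, 1, 2 :: nat} < card (UNIV :: 'n set)" using assms(1) by simp
  from underdetermined_system[OF _ _ this,
      of "\<lambda>r j. if r = 0 then x $ j else if r = 1 then y $ j else if j = j0 then 1 else 0"]
  obtain z where z: "\<exists>j. z j \<noteq> 0" "\<forall>r\<in>{0, 1, 2 :: nat}. (\<Sum>j\<in>UNIV.
    (if r = 0 then x $ j else if r = 1 then y $ j else if j = j0 then 1 else 0) * z j) = 0"
    by auto
  let ?z = "\<chi> j. z j"
  have x: "pairing x ?z = 0" and y: "pairing y ?z = 0"
    using z(2) by (simp_all add: pairing_def)
  have "(\<Sum>j\<in>UNIV. (if j = j0 then 1 else 0) * z j) = 0"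
    using z(2)[rule_format, of 2] by simp
  then have zj0: "z j0 = 0" by (simp add: if_distrib[of "\<lambda>x. x * _"] cong: if_cong)
  obtain j1 where j1: "z j1 \<noteq> 0" using z(1) by blast
  let ?c = "1 *s axis j1 1 + (- v $ j1 / v $ j0) *s axis j0 1"
  have "pairing ?c v = 0" unfolding pairing_combination pairing_axis using j0 by simp
  moreover have "pairing ?c ?z \<noteq> 0" unfolding pairing_combination pairing_axis using j1 zj0 by simp
  then have "?c \<noteq> a *s x + b *s y" for a b
    using x y pairing_combination[of a x b y ?z] by (metis add_0 mult_zero_right)
  ultimately show ?thesis by blast
qed

text \<open>
  The linear forms allowed at \<open>Some i\<close> are those through the \<open>i\<close>-th point, and \<open>None\<close> stands for
  an unconstrained one: the product over all of them is a section of the ample divisor.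
\<close>

definition through :: "('i \<Rightarrow> complex ^ 'n) \<Rightarrow> 'i option \<Rightarrow> (complex ^ 'n) set" where
  "through p k = {c. \<forall>i. k = Some i \<longrightarrow> pairing c (p i) = 0}"

text \<open>
  The conditions exclude finitely many proper subspaces: the planes in \<open>X\<close> are proper since the forms
  through a point span a space of dimension at least three.
\<close>

lemma ex_general_linear_form:
  fixes p :: "'i \<Rightarrow> complex ^ 'n::finite"
  assumes n: "CARD('n) \<ge> 4" and I: "finite I" "separated I p"
    and k: "k \<in> insert None (Some ` I)" and X: "finite X"
  shows "\<exists>c\<in>through p k. (\<forall>i\<in>I. k \<noteq> Some i \<longrightarrow> pairing c (p i) \<noteq> 0) \<and>
    (\<forall>(x, y)\<in>X. \<forall>a b. c \<noteq> a *s x + b *s y)"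
proof -
  let ?J = "{i \<in> I. k \<noteq> Some i}"
  let ?U = "\<lambda>s. case s of Inl i \<Rightarrow> {c. pairing c (p i) = 0}
    | Inr (x, y) \<Rightarrow> {c. \<exists>a b. c = a *s x + b *s y}"
  have "\<exists>c\<in>through p k. \<forall>s\<in>Inl ` ?J \<union> Inr ` X. c \<notin> ?U s"
  proof (rule avoid_finitely_many_subspaces)
    show "finite (Inl ` ?J \<union> Inr ` X)" using I X by simp
    show "linearly_closed (through p k)"
      by (auto simp: linearly_closed_def through_def pairing_combination)
    have "0 \<in> through p k" by (simp add: through_def pairing_def)
    then show "through p k \<noteq> {}" by blast
    fix s assume s: "s \<in> Inl ` ?J \<union> Inr ` X"
    show "linearly_closed (?U s)"
    proof (cases s)
      case (Inl i)
      then show ?thesis by (auto simp: linearly_closed_def pairing_combination)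
    next
      case (Inr xy)
      obtain x y where xy: "xy = (x, y)" by (cases xy)
      have "\<exists>a'' b''. a *s (a1 *s x + b1 *s y) + b *s (a2 *s x + b2 *s y) = a'' *s x + b'' *s y"
        for a b a1 a2 b1 b2
        by (intro exI[of _ "a * a1 + b * a2"] exI[of _ "a * b1 + b * b2"])
          (simp add: vec_eq_iff algebra_simps)
      then show ?thesis unfolding Inr xy by (auto simp: linearly_closed_def)
    qed
    show "\<not> through p k \<subseteq> ?U s"
    proof (cases s)
      case (Inl i)
      then have i: "i \<in> I" "k \<noteq> Some i" using s by auto
      show ?thesis
      proof (cases k)
        case None
        obtain c where "pairing c (p i) = 1"
          using ex_pairing_1 I(2) i(1) unfolding separated_def by blast
        then have "c \<in> through p k" "c \<notin> ?U s" using None Inl by (auto simp: through_def)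
        then show ?thesis by blast
      next
        case (Some j)
        then have "j \<in> I" "i \<noteq> j" using k i by auto
        then obtain c where "pairing c (p j) = 0" "pairing c (p i) \<noteq> 0"
          using I(2) i unfolding separated_def by blast
        then have "c \<in> through p k" "c \<notin> ?U s" using Some Inl by (auto simp: through_def)
        then show ?thesis by blast
      qed
    next
      case (Inr xy)
      obtain x y where xy: "xy = (x, y)" by (cases xy)
      obtain v where v: "v \<noteq> 0" "\<And>i. k = Some i \<Longrightarrow> v = p i"
      proof (cases k)
        case None
        have "(axis undefined 1 :: complex ^ 'n) \<noteq> 0" by (simp add: axis_eq_0_iff)
        with None that show ?thesis by blast
      next
        case (Some j)
        then have "p j \<noteq> 0" using k I(2) by (auto simp: separated_def)
        with Some that show ?thesis by blast
      qed
      obtain c where "pairing c v = 0" "\<forall>a b. c \<noteq> a *s x + b *s y"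
        using orthogonal_not_in_plane[OF n v(1)] by blast
      then have "c \<in> through p k" "c \<notin> ?U s" using v(2) Inr xy by (auto simp: through_def)
      then show ?thesis by blast
    qed
  qed
  then obtain c where c: "c \<in> through p k" "\<forall>s\<in>Inl ` ?J \<union> Inr ` X. c \<notin> ?U s" by blast
  have "pairing c (p i) \<noteq> 0" if "i \<in> I" "k \<noteq> Some i" for i
    using c(2)[rule_format, of "Inl i"] that by auto
  moreover have "c \<noteq> a *s x + b *s y" if "(x, y) \<in> X" for a b x y
    using c(2)[rule_format, of "Inr (x, y)"] that by auto
  ultimately show ?thesis using c(1) by blast
qed


section \<open>Regular sequences of products of linear forms\<close>

text \<open>
  The second element is a nonzerodivisor modulo the first one, and, below, the third one modulo the first
  two.
\<close>

definition regular2 :: "'a::idom \<Rightarrow> 'a \<Rightarrow> bool" where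
  "regular2 x y \<longleftrightarrow> (\<forall>r. x dvd y * r \<longrightarrow> x dvd r)"

definition regular3 :: "'a::idom \<Rightarrow> 'a \<Rightarrow> 'a \<Rightarrow> bool" where
  "regular3 x y z \<longleftrightarrow> (\<forall>r a b. z * r = a * x + b * y \<longrightarrow> (\<exists>c d. r = c * x + d * y))"

lemma regular2_mult_right: "regular2 x y \<Longrightarrow> regular2 x z \<Longrightarrow> regular2 x (y * z)"
  unfolding regular2_def by (metis mult.assoc)

lemma regular2_mult_left:
  assumes "regular2 x y" "regular2 w y" "x \<noteq> 0"
  shows "regular2 (x * w) y"
  unfolding regular2_def
proof (intro allI impI)
  fix r assume r: "x * w dvd y * r"
  then have "x dvd y * r" by (rule dvd_mult_left)
  then have "x dvd r" using assms(1) unfolding regular2_def by blast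
  then obtain s where s: "r = x * s" by (rule dvdE)
  have "y * r = x * (y * s)" by (simp add: s mult.left_commute)
  with r have "x * w dvd x * (y * s)" by simp
  then have "w dvd y * s" using assms(3) by simp
  then have "w dvd s" using assms(2) unfolding regular2_def by blast
  then show "x * w dvd r" unfolding s by (rule mult_dvd_mono[OF dvd_refl])
qed

lemma regular2_1_left [simp]: "regular2 1 y" and regular2_1_right [simp]: "regular2 x 1"
  by (auto simp: regular2_def)

lemma regular2_prod:
  assumes "\<And>i j. i \<in> A \<Longrightarrow> j \<in> B \<Longrightarrow> regular2 (x i) (y j)" "\<And>i. i \<in> A \<Longrightarrow> x i \<noteq> 0"
  shows "regular2 (prod x A) (prod y B)"
proof -
  have "regular2 (x i) (prod y B)" if "i \<in> A" for i
    using assms(1)[OF that] by (induction B rule: infinite_finite_induct) (auto intro: regular2_mult_right)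
  with assms(2) show ?thesis
    by (induction A rule: infinite_finite_induct) (auto intro: regular2_mult_left)
qed

lemma regular2_power:
  assumes "regular2 x y" "x \<noteq> 0" shows "regular2 (x ^ k) (y ^ l)"
  using regular2_prod[of "{..<k}" "{..<l}" "\<lambda>_. x" "\<lambda>_. y"] assms by simp

lemma regular3_sym: "regular3 x y z \<Longrightarrow> regular3 y x z"
  unfolding regular3_def by (metis add.commute)

lemma regular3_mult_right:
  assumes "regular3 x y z" "regular3 x y w" shows "regular3 x y (z * w)"
  unfolding regular3_def
proof (intro allI impI)
  fix r a b assume "z * w * r = a * x + b * y"
  then have "z * (w * r) = a * x + b * y" by (simp add: mult.assoc)
  then obtain c d where "w * r = c * x + d * y" using assms(1) unfolding regular3_def by blast
  then show "\<exists>c d. r = c * x + d * y" using assms(2) unfolding regular3_def by blast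
qed

text \<open>
  Modulo \<open>y\<close> this is the fact that \<open>z\<close> is a nonzerodivisor modulo \<open>x w\<close> if it is one modulo \<open>x\<close> and
  modulo \<open>w\<close>.
\<close>

lemma regular3_mult_left:
  assumes "regular3 x y z" "regular3 w y z" "regular2 y x"
  shows "regular3 (x * w) y z"
  unfolding regular3_def
proof (intro allI impI)
  fix r a b assume r: "z * r = a * (x * w) + b * y"
  then have "z * r = (a * w) * x + b * y" by (simp add: mult_ac)
  then obtain c d where cd: "r = c * x + d * y" using assms(1) unfolding regular3_def by blast
  have "x * (z * c - a * w) = y * (b - z * d)" using r by (simp add: cd algebra_simps)
  then have "y dvd x * (z * c - a * w)" by simp
  then obtain e where e: "z * c - a * w = y * e" using assms(3) unfolding regular2_def by blast
  then have "z * c = a * w + e * y" by (simp add: algebra_simps)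
  then obtain f g where "c = f * w + g * y" using assms(2) unfolding regular3_def by blast
  then have "r = f * (x * w) + (g * x + d) * y" by (simp add: cd algebra_simps)
  then show "\<exists>c d. r = c * (x * w) + d * y" by blast
qed

lemma regular3_1_left [simp]: "regular3 1 y z"
  unfolding regular3_def by (metis add.right_neutral mult.right_neutral mult_zero_left)

lemma regular3_1_right [simp]: "regular3 x y 1"
  by (auto simp: regular3_def)

lemma regular3_prod:
  assumes "\<And>i j k. i \<in> A \<Longrightarrow> j \<in> B \<Longrightarrow> k \<in> C \<Longrightarrow> regular3 (x i) (y j) (z k)"
    and "\<And>i j. i \<in> A \<Longrightarrow> j \<in> B \<Longrightarrow> regular2 (x i) (y j)"
    and "\<And>i j. i \<in> A \<Longrightarrow> j \<in> B \<Longrightarrow> regular2 (y j) (x i)"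
    and "\<And>j. j \<in> B \<Longrightarrow> y j \<noteq> 0"
  shows "regular3 (prod x A) (prod y B) (prod z C)"
proof -
  have 1: "regular3 (x i) (y j) (prod z C)" if "i \<in> A" "j \<in> B" for i j
    using assms(1)[OF that]
    by (induction C rule: infinite_finite_induct) (auto intro: regular3_mult_right)
  have 2: "regular3 (prod y B) (x i) (prod z C)" if "i \<in> A" for i
    using 1[OF that] assms(2)[OF that]
    by (induction B rule: infinite_finite_induct) (auto intro: regular3_mult_left regular3_sym)
  have 3: "regular2 (prod y B) (x i)" if "i \<in> A" for i
    using regular2_prod[of B "{i}" y x] assms(3,4) that by simp
  have "regular3 (x i) (prod y B) (prod z C)" if "i \<in> A" for i
    using 2[OF that] by (rule regular3_sym)
  then show ?thesis
    using 3 by (induction A rule: infinite_finite_induct) (auto intro: regular3_mult_left)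
qed

lemma regular3_power:
  assumes "regular3 x y z" "regular2 x y" "regular2 y x" "y \<noteq> 0"
  shows "regular3 (x ^ k) (y ^ k) (z ^ k)"
  using regular3_prod[of "{..<k}" "{..<k}" "{..<k}" "\<lambda>_. x" "\<lambda>_. y" "\<lambda>_. z"] assms by simp

lemma dvd_substitute_diff:
  fixes D :: "'v mpoly"
  assumes "\<And>j. D dvd x j - y j"
  shows "D dvd substitute Const x F - substitute Const y F"
proof -
  have mult: "D dvd a * b - a' * b'" if "D dvd a - a'" "D dvd b - b'" for a b a' b' :: "'v mpoly"
  proof -
    have "a * b - a' * b' = a * (b - b') + (a - a') * b'" by (simp add: algebra_simps)
    then show ?thesis using that by simp
  qed
  have pow: "D dvd x j ^ n - y j ^ n" for j n
    by (induction n) (auto intro: mult assms)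
  have "D dvd eval_mon x t - eval_mon y t" for t
  proof -
    have "D dvd (\<Prod>j\<in>A. x j ^ lookup t j) - (\<Prod>j\<in>A. y j ^ lookup t j)" for A
      by (induction A rule: infinite_finite_induct) (auto intro: mult pow)
    then show ?thesis by (simp add: eval_mon_def)
  qed
  then show ?thesis
    unfolding substitute_alt sum_subtractf[symmetric] right_diff_distrib[symmetric]
    by (intro dvd_sum dvd_mult) auto
qed

lemma dvd_diff_proj_along: "lin c dvd F - proj_along v c F"
  unfolding proj_along_def
  using dvd_substitute_diff[of "lin c" Var "\<lambda>j. Var j - Const (v $ j) * lin c" F] by simp

lemma proj_along_mult: "proj_along v c (F * G) = proj_along v c F * proj_along v c G"
  and proj_along_add: "proj_along v c (F + G) = proj_along v c F + proj_along v c G"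
  and proj_along_power: "proj_along v c (F ^ n) = proj_along v c F ^ n"
  by (simp_all add: proj_along_def)

lemma proj_along_self:
  assumes "pairing c v = 1" shows "proj_along v c (lin c) = 0"
  using assms by (simp add: proj_along_lin)

text \<open>
  Projection along a vector with \<open>a = 1\<close> identifies the quotient by \<open>a\<close> with a subring of a domain.
\<close>

lemma regular2_lin:
  fixes a b :: "complex ^ 'n::{finite,linorder}"
  assumes "a \<noteq> 0" "\<And>s. b \<noteq> s *s a"
  shows "regular2 (lin a) (lin b)"
  unfolding regular2_def
proof (intro allI impI)
  fix r assume r: "lin a dvd lin b * r"
  obtain v where v: "pairing a v = 1"
    using ex_pairing_1[OF assms(1)] by (auto simp: pairing_def mult.commute)
  have b: "proj_along v a (lin b) = lin (b - pairing b v *s a)"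
    by (simp add: proj_along_lin lin_diff lin_scale)
  obtain u where "lin b * r = lin a * u" using r by blast
  then have "proj_along v a (lin b) * proj_along v a r = proj_along v a (lin a) * proj_along v a u"
    by (metis proj_along_mult)
  then have "lin (b - pairing b v *s a) * proj_along v a r = 0"
    by (simp add: b proj_along_self v)
  then have "proj_along v a r = 0" using assms(2) by simp
  then show "lin a dvd r" using dvd_diff_proj_along[of a r v] by simp
qed

text \<open>
  Reduction modulo \<open>a\<close> leads back to two independent linear forms.
\<close>

lemma regular3_lin:
  fixes a b c :: "complex ^ 'n::{finite,linorder}"
  assumes "a \<noteq> 0" "\<And>s. b \<noteq> s *s a" "\<And>s t. c \<noteq> s *s a + t *s b"
  shows "regular3 (lin a) (lin b) (lin c)"
  unfolding regular3_def
proof (intro allI impI)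
  fix r A B assume r: "lin c * r = A * lin a + B * lin b"
  obtain v where v: "pairing a v = 1"
    using ex_pairing_1[OF assms(1)] by (auto simp: pairing_def mult.commute)
  define b' where "b' = b - pairing b v *s a"
  define c' where "c' = c - pairing c v *s a"
  have proj: "proj_along v a (lin b) = lin b'" "proj_along v a (lin c) = lin c'"
    by (simp_all add: proj_along_lin lin_diff lin_scale b'_def c'_def)
  have "b' \<noteq> 0" using assms(2) by (simp add: b'_def)
  moreover have "c' \<noteq> s *s b'" for s
  proof
    assume "c' = s *s b'"
    then have "c = (pairing c v - s * pairing b v) *s a + s *s b"
      by (simp add: b'_def c'_def vec_eq_iff algebra_simps)
    with assms(3) show False by blast
  qed
  ultimately have reg: "regular2 (lin b') (lin c')" by (rule regular2_lin)
  have "lin c' * proj_along v a r = proj_along v a B * lin b'"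
    using arg_cong[OF r, of "proj_along v a"]
    by (simp add: proj_along_mult proj_along_add proj proj_along_self v)
  then have "lin b' dvd lin c' * proj_along v a r" by simp
  then obtain D where D: "proj_along v a r = lin b' * D" using reg unfolding regular2_def by blast
  obtain E where "r - proj_along v a r = lin a * E" using dvd_diff_proj_along[of a r v] by blast
  then have "r = lin a * E + (lin b - Const (pairing b v) * lin a) * D"
    by (simp add: D b'_def lin_diff lin_scale algebra_simps)
  then have "r = (E - Const (pairing b v) * D) * lin a + D * lin b"
    by (simp add: algebra_simps)
  then show "\<exists>c d. r = c * lin a + d * lin b" by blast
qed

text \<open>
  Exactness of the Koszul complex in the middle, which is the vanishing of the first cohomology on
  the union of the three charts.
\<close>

lemma koszul_exact:
  fixes x y z :: "'a::idom"
  assumes reg: "regular3 x y z"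
    and cocycle: "a23 * x - a13 * y + a12 * z = 0"
  shows "\<exists>h1 h2. a12 = x * h2 - y * h1"
proof -
  have "z * a12 = (- a23) * x + a13 * y" using cocycle by (simp add: algebra_simps)
  then obtain c d where "a12 = c * x + d * y" using reg unfolding regular3_def by blast
  then have "a12 = x * c - y * (- d)" by (simp add: algebra_simps)
  then show ?thesis by blast
qed

section \<open>Local sections of the exceptional divisor\<close>

text \<open>
  The complement of two charts \<open>a \<noteq> 0\<close> and \<open>b \<noteq> 0\<close> of the exceptional divisor has codimension two, so
  that a function on their union has no poles: the terms of order less than \<open>n\<close> of \<open>A / a\<^sup>k\<close> and
  \<open>B / b\<^sup>k\<close> agree, and they are polynomials as \<open>a\<close> and \<open>b\<close> are coprime.
\<close>

lemma local_extension:
  fixes A B :: "'n::{finite,linorder} mpoly"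
  assumes A: "homogeneous d A" and v: "v \<noteq> 0"
    and ab: "pairing a v = 0" "pairing b v = 0" "a \<noteq> 0" "regular2 (lin a) (lin b)"
    and eq: "mult_at_least (n + k) (A * lin b ^ k - B * lin a ^ k) v"
  shows "\<exists>C. homogeneous (d - k) C \<and> mult_at_least n (A - lin a ^ k * C) v"
proof -
  obtain c where c: "pairing c v = 1" using ex_pairing_1[OF v] by blast
  define X where "X j = hom_part j (shift v A)" for j
  have "\<exists>C. X j = (if k \<le> j then lin a ^ k * C else 0) \<and> homogeneous (j - k) C" if "j < n" for j
  proof -
    have hb: "homogeneous k (lin b ^ k)" and ha: "homogeneous k (lin a ^ k)"
      using homogeneous_power[OF homogeneous_lin(1)] by fastforce+
    have "low (n + k) (shift v A * lin b ^ k - shift v B * lin a ^ k)"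
      using eq ab by (simp add: mult_at_least_shift shift_lin)
    then have "hom_part (j + k) (lin b ^ k * shift v A - lin a ^ k * shift v B) = 0"
      using that by (simp add: low_iff_hom_part mult.commute)
    then have "lin b ^ k * X j = lin a ^ k * hom_part j (shift v B)"
      by (simp add: hom_part_mult_homogeneous[OF hb] hom_part_mult_homogeneous[OF ha] X_def)
    then have "lin a ^ k dvd lin b ^ k * X j" by simp
    moreover have "regular2 (lin a ^ k) (lin b ^ k)" using ab by (intro regular2_power) simp_all
    ultimately obtain C where C: "X j = lin a ^ k * C" unfolding regular2_def by blast
    have X: "X j = hom_part j (lin a ^ k * C)"
      unfolding C[symmetric] X_def by (simp add: hom_part_self)
    show ?thesis
    proof (cases "k \<le> j")
      case True
      then have "X j = lin a ^ k * hom_part (j - k) C"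
        using X hom_part_mult_homogeneous[OF ha, of "j - k" C] by simp
      with True show ?thesis by (intro exI[of _ "hom_part (j - k) C"]) simp
    next
      case False
      then have "X j = 0" using X hom_part_mult_small[OF ha] by simp
      with False show ?thesis by (intro exI[of _ 0]) simp
    qed
  qed
  then obtain C where C: "\<And>j. j < n \<Longrightarrow> X j = (if k \<le> j then lin a ^ k * C j else 0)"
    "\<And>j. j < n \<Longrightarrow> homogeneous (j - k) (C j)" by metis
  let ?C = "\<Sum>j\<in>{j. j \<le> d \<and> j < n \<and> k \<le> j}. lin c ^ (d - j) * proj_along v c (C j)"
  have "homogeneous (d - k) ?C"
  proof (rule homogeneous_sum)
    fix j assume j: "j \<in> {j. j \<le> d \<and> j < n \<and> k \<le> j}"
    have "homogeneous ((d - j) * 1 + (j - k)) (lin c ^ (d - j) * proj_along v c (C j))"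
      using C(2)[of j] j
      by (intro homogeneous_mult homogeneous_power homogeneous_lin homogeneous_proj_along) auto
    moreover have "(d - j) * 1 + (j - k) = d - k" using j by simp
    ultimately show "homogeneous (d - k) (lin c ^ (d - j) * proj_along v c (C j))" by simp
  qed
  moreover have "mult_at_least n (A - lin a ^ k * ?C) v"
  proof -
    let ?T = "\<lambda>j. lin c ^ (d - j) * proj_along v c (X j)"
    have pa: "proj_along v c (lin a) = lin a" using ab by (simp add: proj_along_lin)
    have "A = (\<Sum>j\<le>d. ?T j)" unfolding X_def by (rule taylor_form) fact+
    also have "\<dots> = (\<Sum>j\<in>{..d} \<inter> {..<n}. ?T j) + (\<Sum>j\<in>{..d} - {..<n}. ?T j)"
      by (rule sum.Int_Diff) simp
    also have "(\<Sum>j\<in>{..d} \<inter> {..<n}. ?T j) = (\<Sum>j\<in>{j. j \<le> d \<and> j < n \<and> k \<le> j}. ?T j)"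
      by (rule sum.mono_neutral_right) (auto simp: C(1) proj_along_def)
    also have "\<dots> = lin a ^ k * ?C"
      unfolding sum_distrib_left
      by (rule sum.cong) (auto simp: C(1) proj_along_mult proj_along_power pa mult_ac)
    finally have "A - lin a ^ k * ?C = (\<Sum>j\<in>{..d} - {..<n}. ?T j)" by simp
    moreover have "mult_at_least n (?T j) v" if "j \<in> {..d} - {..<n}" for j
    proof -
      have "mult_at_least j (?T j) v"
        unfolding X_def by (intro mult_at_least_mult_left mult_proj_along c) simp
      then show ?thesis by (rule mult_at_least_mono) (use that in simp)
    qed
    ultimately show ?thesis by (simp only: mult_at_least_sum)
  qed
  ultimately show ?thesis by blast
qed

section \<open>Valuations on the function field\<close>

text \<open>
  The fraction vanishes to order at least \<open>e\<close> along the exceptional divisor over \<open>v\<close>. By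
  \<open>val_ge_iff\<close> the choice of numerator and denominator does not matter.
\<close>

definition val_ge :: "complex ^ 'n::{finite,linorder} \<Rightarrow> nat \<Rightarrow> 'n mpoly fract \<Rightarrow> bool" where
  "val_ge v e \<phi> \<longleftrightarrow> (\<exists>A B b. mult_exact b B v \<and> mult_at_least (e + b) A v \<and> \<phi> = to_frac A / to_frac B)"

lemma fract_eq_iff:
  fixes A B :: "'n::linorder mpoly"
  assumes "B \<noteq> 0" "D \<noteq> 0"
  shows "to_frac A / to_frac B = to_frac C / to_frac D \<longleftrightarrow> A * D = C * B"
proof -
  have "to_frac A / to_frac B = to_frac C / to_frac D \<longleftrightarrow> to_frac A * to_frac D = to_frac C * to_frac B"
    using assms by (simp add: frac_eq_eq)
  also have "\<dots> \<longleftrightarrow> to_frac (A * D) = to_frac (C * B)" by simp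
  also have "\<dots> \<longleftrightarrow> A * D = C * B" by (rule to_frac_inject)
  finally show ?thesis .
qed

lemma val_ge_iff:
  fixes A B :: "'n::{finite,linorder} mpoly"
  assumes "mult_exact b B v"
  shows "val_ge v e (to_frac A / to_frac B) \<longleftrightarrow> mult_at_least (e + b) A v"
proof
  assume "val_ge v e (to_frac A / to_frac B)"
  then obtain C D d where D: "mult_exact d D v" and C: "mult_at_least (e + d) C v"
    and "to_frac A / to_frac B = to_frac C / to_frac D"
    unfolding val_ge_def by blast
  then have eq: "D * A = B * C"
    using assms D by (simp add: fract_eq_iff mult_exact_nonzero mult.commute)
  have "mult_at_least (b + (e + d)) (B * C) v" using C mult_cancel[OF assms] by blast
  moreover have "b + (e + d) = d + (e + b)" by simp
  ultimately have "mult_at_least (d + (e + b)) (D * A) v" by (simp only: eq)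
  then show "mult_at_least (e + b) A v" using mult_cancel[OF D] by blast
qed (use assms in \<open>auto simp: val_ge_def\<close>)

lemma val_ge_poly: "val_ge v e (to_frac A) \<longleftrightarrow> mult_at_least e A v"
proof -
  have "mult_exact 0 1 v" by (simp add: mult_exact_0_iff)
  from val_ge_iff[OF this, of e A] show ?thesis by simp
qed

lemma fract_common_denominator:
  fixes A B C D :: "'n::{finite,linorder} mpoly"
  assumes "B \<noteq> 0" "D \<noteq> 0"
  shows "to_frac A / to_frac B + to_frac C / to_frac D = to_frac (A * D + C * B) / to_frac (B * D)"
    "to_frac A / to_frac B - to_frac C / to_frac D = to_frac (A * D - C * B) / to_frac (B * D)"
  using assms by (simp_all add: add_frac_eq diff_frac_eq)

lemma val_ge_add:
  assumes "val_ge v e \<phi>" "val_ge v e \<psi>" shows "val_ge v e (\<phi> + \<psi>)"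
    and val_ge_diff: "val_ge v e (\<phi> - \<psi>)"
proof -
  obtain A B b where B: "mult_exact b B v" and A: "mult_at_least (e + b) A v"
    and \<phi>: "\<phi> = to_frac A / to_frac B" using assms(1) unfolding val_ge_def by blast
  obtain C D d where D: "mult_exact d D v" and C: "mult_at_least (e + d) C v"
    and \<psi>: "\<psi> = to_frac C / to_frac D" using assms(2) unfolding val_ge_def by blast
  have "mult_at_least ((e + b) + d) (A * D) v"
    using A D unfolding mult_exact_def by (intro mult_at_least_mult) auto
  moreover have "mult_at_least ((e + d) + b) (C * B) v"
    using C B unfolding mult_exact_def by (intro mult_at_least_mult) auto
  ultimately have num: "mult_at_least (e + (b + d)) (A * D + C * B) v"
    "mult_at_least (e + (b + d)) (A * D - C * B) v"
    by (auto simp: ac_simps intro: mult_at_least_add mult_at_least_diff)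
  have "mult_exact (b + d) (B * D) v" using B D by (rule mult_exact_mult)
  from val_ge_iff[OF this, of e] num
  show "val_ge v e (\<phi> + \<psi>)" "val_ge v e (\<phi> - \<psi>)"
    using B D by (simp_all only: \<phi> \<psi> fract_common_denominator mult_exact_nonzero simp_thms)
qed

lemma val_ge_0 [simp]: "val_ge v e 0"
  using val_ge_poly[of v e 0] by simp

lemma val_ge_Const_mult:
  assumes "val_ge v e \<phi>" shows "val_ge v e (to_frac (Const c) * \<phi>)"
proof -
  obtain A B b where B: "mult_exact b B v" and A: "mult_at_least (e + b) A v"
    and \<phi>: "\<phi> = to_frac A / to_frac B" using assms unfolding val_ge_def by blast
  have "to_frac (Const c) * \<phi> = to_frac (Const c * A) / to_frac B" by (simp add: \<phi>)
  with val_ge_iff[OF B, of e "Const c * A"] mult_at_least_mult_left[OF A] show ?thesis by simp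
qed

section \<open>Sections away from the points\<close>

text \<open>
  For a form \<open>f\<close> of degree \<open>e\<close>, these are the fractions of degree \<open>d\<close> without poles where
  \<open>f \<noteq> 0\<close>.
\<close>

definition forms_over :: "nat \<Rightarrow> nat \<Rightarrow> 'n::{finite,linorder} mpoly \<Rightarrow> 'n mpoly fract set" where
  "forms_over d e f = {\<phi>. \<exists>k G. homogeneous (d + k * e) G \<and> \<phi> = to_frac G / to_frac f ^ k}"

lemma forms_over_raise:
  fixes f :: "'n::{finite,linorder} mpoly"
  assumes "homogeneous e f" "f \<noteq> 0" "homogeneous (d + k * e) G" "k \<le> K"
  shows "homogeneous (d + K * e) (G * f ^ (K - k))"
    and "to_frac G / to_frac f ^ k = to_frac (G * f ^ (K - k)) / to_frac f ^ K"
proof -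
  have "homogeneous ((d + k * e) + (K - k) * e) (G * f ^ (K - k))"
    using assms by (intro homogeneous_mult homogeneous_power)
  moreover have "(d + k * e) + (K - k) * e = d + K * e"
    using assms(4) by (simp add: diff_mult_distrib add.commute[of _ "d + _"] flip: add.assoc)
  ultimately show "homogeneous (d + K * e) (G * f ^ (K - k))" by simp
  have "to_frac f ^ K = to_frac f ^ k * to_frac f ^ (K - k)"
    using assms(4) by (simp flip: power_add)
  then show "to_frac G / to_frac f ^ k = to_frac (G * f ^ (K - k)) / to_frac f ^ K"
    using assms(2) by simp
qed

lemma forms_over_large:
  fixes f :: "'n::{finite,linorder} mpoly"
  assumes "homogeneous e f" "f \<noteq> 0" "\<phi> \<in> forms_over d e f"
  shows "\<exists>k. \<forall>K\<ge>k. \<exists>G. homogeneous (d + K * e) G \<and> \<phi> = to_frac G / to_frac f ^ K"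
proof -
  obtain k G where "homogeneous (d + k * e) G" "\<phi> = to_frac G / to_frac f ^ k"
    using assms(3) by (auto simp: forms_over_def)
  with forms_over_raise[OF assms(1,2)] show ?thesis by blast
qed

lemma forms_over_add:
  fixes f :: "'n::{finite,linorder} mpoly"
  assumes f: "homogeneous e f" "f \<noteq> 0" and "\<phi> \<in> forms_over d e f" "\<psi> \<in> forms_over d e f"
  shows "\<phi> + \<psi> \<in> forms_over d e f" and forms_over_diff: "\<phi> - \<psi> \<in> forms_over d e f"
proof -
  obtain k where k: "\<forall>K\<ge>k. \<exists>G. homogeneous (d + K * e) G \<and> \<phi> = to_frac G / to_frac f ^ K"
    using forms_over_large[OF f assms(3)] by blast
  obtain l where l: "\<forall>K\<ge>l. \<exists>G. homogeneous (d + K * e) G \<and> \<psi> = to_frac G / to_frac f ^ K"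
    using forms_over_large[OF f assms(4)] by blast
  let ?K = "max k l"
  obtain G H where GH: "homogeneous (d + ?K * e) G" "\<phi> = to_frac G / to_frac f ^ ?K"
    "homogeneous (d + ?K * e) H" "\<psi> = to_frac H / to_frac f ^ ?K"
    using k[rule_format, of ?K] l[rule_format, of ?K] by auto
  have "\<phi> + \<psi> = to_frac (G + H) / to_frac f ^ ?K" "\<phi> - \<psi> = to_frac (G - H) / to_frac f ^ ?K"
    using GH by (simp_all add: add_divide_distrib diff_divide_distrib)
  moreover have "homogeneous (d + ?K * e) (G + H)" "homogeneous (d + ?K * e) (G - H)"
    using GH by (auto intro: homogeneous_add homogeneous_diff)
  ultimately show "\<phi> + \<psi> \<in> forms_over d e f" "\<phi> - \<psi> \<in> forms_over d e f"
    unfolding forms_over_def by blast+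
qed

lemma forms_over_Const_mult:
  fixes \<phi> :: "'n::{finite,linorder} mpoly fract"
  assumes "\<phi> \<in> forms_over d e f" shows "to_frac (Const c) * \<phi> \<in> forms_over d e f"
proof -
  obtain k G where G: "homogeneous (d + k * e) G" "\<phi> = to_frac G / to_frac f ^ k"
    using assms by (auto simp: forms_over_def)
  then have "to_frac (Const c) * \<phi> = to_frac (Const c * G) / to_frac f ^ k" by simp
  with homogeneous_Const_mult[OF G(1)] show ?thesis unfolding forms_over_def by blast
qed

lemma forms_over_poly:
  assumes "homogeneous d F" shows "to_frac F \<in> forms_over d e f"
  unfolding forms_over_def using assms by (intro CollectI exI[of _ 0] exI[of _ F]) simp

lemma forms_over_restrict:
  fixes f :: "'n::{finite,linorder} mpoly"
  assumes "homogeneous e' g" "g \<noteq> 0" "\<phi> \<in> forms_over d e f"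
  shows "\<phi> \<in> forms_over d (e + e') (f * g)"
proof -
  obtain k G where G: "homogeneous (d + k * e) G" "\<phi> = to_frac G / to_frac f ^ k"
    using assms(3) by (auto simp: forms_over_def)
  have "homogeneous ((d + k * e) + k * e') (G * g ^ k)"
    using assms G by (intro homogeneous_mult homogeneous_power)
  then have "homogeneous (d + k * (e + e')) (G * g ^ k)" by (simp add: algebra_simps)
  moreover have "\<phi> = to_frac (G * g ^ k) / to_frac (f * g) ^ k"
    using assms(2) G(2) by (simp add: power_mult_distrib)
  ultimately show ?thesis unfolding forms_over_def by blast
qed

text \<open>
  Two charts \<open>f \<noteq> 0\<close> and \<open>g \<noteq> 0\<close> given by coprime forms miss a set of codimension two, where
  no pole can be hidden.
\<close>

lemma forms_over_Int:
  fixes f g h :: "'n::{finite,linorder} mpoly"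
  assumes reg: "regular2 f g" and f: "homogeneous s f" "f \<noteq> 0" and g: "homogeneous s g" "g \<noteq> 0"
    and h: "homogeneous e h" "h \<noteq> 0"
    and \<phi>: "\<phi> \<in> forms_over d (e + s) (h * f)" "\<phi> \<in> forms_over d (e + s) (h * g)"
  shows "\<phi> \<in> forms_over d e h"
proof -
  obtain k A where A: "homogeneous (d + k * (e + s)) A" "\<phi> = to_frac A / to_frac (h * f) ^ k"
    using \<phi>(1) by (auto simp: forms_over_def)
  obtain l B where B: "homogeneous (d + l * (e + s)) B" "\<phi> = to_frac B / to_frac (h * g) ^ l"
    using \<phi>(2) by (auto simp: forms_over_def)
  have "to_frac A / to_frac ((h * f) ^ k) = to_frac B / to_frac ((h * g) ^ l)"
    using A(2) B(2) by simp
  then have "A * (h * g) ^ l = B * (h * f) ^ k"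
    using f g h by (subst (asm) fract_eq_iff) simp_all
  then have "g ^ l * (A * h ^ l) = f ^ k * (B * h ^ k)"
    by (simp add: power_mult_distrib ac_simps)
  then have "f ^ k dvd g ^ l * (A * h ^ l)" by simp
  moreover have "regular2 (f ^ k) (g ^ l)" using reg f by (intro regular2_power)
  ultimately obtain D where D: "A * h ^ l = f ^ k * D" unfolding regular2_def by blast
  let ?n = "d + (k + l) * e"
  let ?D = "hom_part ?n D"
  have fk: "homogeneous (k * s) (f ^ k)" using f by (intro homogeneous_power)
  have "homogeneous ((d + k * (e + s)) + l * e) (A * h ^ l)"
    using A h by (intro homogeneous_mult homogeneous_power)
  then have "homogeneous (?n + k * s) (f ^ k * D)" by (simp add: D algebra_simps)
  then have "f ^ k * D = f ^ k * ?D"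
    using hom_part_mult_homogeneous[OF fk, of ?n D] by (simp add: hom_part_self)
  then have D': "A * h ^ l = f ^ k * ?D" by (simp only: D)
  have "\<phi> = to_frac (A * h ^ l) / (to_frac (h * f) ^ k * to_frac h ^ l)"
    using A(2) h(2) by simp
  also have "\<dots> = to_frac ?D / to_frac h ^ (k + l)"
    unfolding D' using f(2) by (simp add: power_mult_distrib power_add)
  finally show ?thesis unfolding forms_over_def using hom_part_homogeneous by blast
qed

section \<open>Sections on the charts of the blow-up\<close>

lemma sum_bound: "i \<in> I \<Longrightarrow> finite I \<Longrightarrow> (m i :: nat) \<le> (\<Sum>i\<in>I. m i)"
  by (rule member_le_sum) auto

text \<open>
  The chart \<open>X\<^sub>f\<close> meets the exceptional divisor over a point precisely if \<open>f\<close> has no higher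
  multiplicity there than its linear system requires; only then there is a condition at that point.
\<close>

lemma local_sections_iff:
  fixes f :: "'n::{finite,linorder} mpoly"
  assumes "finite I" "r \<ge> 1" and f: "f \<in> linear_system I p (r * (card I + 1)) (\<lambda>_. r)" "f \<noteq> 0"
  shows "\<phi> \<in> local_sections I p d m r f \<longleftrightarrow>
    \<phi> \<in> forms_over d (r * (card I + 1)) f \<and> (\<forall>i\<in>I. mult_exact r f (p i) \<longrightarrow> val_ge (p i) (m i) \<phi>)"
    (is "?L \<longleftrightarrow> ?R")
proof
  assume ?L
  then obtain k G where G: "G \<in> linear_system I p (d + k * r * (card I + 1)) (\<lambda>i. m i + k * r)"
    "\<phi> = to_frac G / to_frac f ^ k" by (auto simp: local_sections_def)
  have "homogeneous (d + k * (r * (card I + 1))) G"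
    using linear_systemD(1)[OF G(1)] by (simp only: mult.assoc)
  then have "\<phi> \<in> forms_over d (r * (card I + 1)) f" using G(2) unfolding forms_over_def by blast
  moreover have "val_ge (p i) (m i) \<phi>" if "i \<in> I" "mult_exact r f (p i)" for i
    using val_ge_iff[OF mult_exact_power[OF that(2), of k], of "m i" G]
      linear_systemD(2)[OF G(1) that(1)] G(2) by simp
  ultimately show ?R by blast
next
  assume R: ?R
  then obtain k G where G: "homogeneous (d + k * (r * (card I + 1))) G" "\<phi> = to_frac G / to_frac f ^ k"
    by (auto simp: forms_over_def)
  \<comment> \<open>Where \<open>f\<close> has multiplicity greater than \<open>r\<close>, raising the denominator gains one order each time.\<close>
  define n where "n = (\<Sum>i\<in>I. m i) + k * r"
  let ?G = "G * f ^ n"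
  have "homogeneous (d + (k + n) * (r * (card I + 1))) ?G"
    using forms_over_raise(1)[OF linear_systemD(1)[OF f(1)] f(2) G(1), of "k + n"] by simp
  then have "homogeneous (d + (k + n) * r * (card I + 1)) ?G" by (simp only: mult.assoc)
  moreover have "mult_at_least (m i + (k + n) * r) ?G (p i)" if i: "i \<in> I" for i
  proof (cases "mult_exact r f (p i)")
    case True
    then have "val_ge (p i) (m i) (to_frac G / to_frac (f ^ k))" using R i G(2) by simp
    then have "mult_at_least (m i + k * r) G (p i)"
      using val_ge_iff[OF mult_exact_power[OF True, of k]] by blast
    moreover have "mult_at_least (n * r) (f ^ n) (p i)"
      using True unfolding mult_exact_def by (intro mult_at_least_power) auto
    ultimately have "mult_at_least ((m i + k * r) + n * r) ?G (p i)" by (rule mult_at_least_mult)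
    then show ?thesis by (simp add: algebra_simps)
  next
    case False
    then have "mult_at_least (Suc r) f (p i)"
      using linear_systemD(2)[OF f(1) i] by (simp add: mult_exact_def)
    then have "mult_at_least (n * Suc r) (f ^ n) (p i)" by (rule mult_at_least_power)
    then have "mult_at_least (n * Suc r) ?G (p i)" by (rule mult_at_least_mult_left)
    moreover have "m i + (k + n) * r \<le> n * Suc r"
      using sum_bound[OF i \<open>finite I\<close>, of m] by (simp add: n_def algebra_simps)
    ultimately show ?thesis by (rule mult_at_least_mono)
  qed
  ultimately have "?G \<in> linear_system I p (d + (k + n) * r * (card I + 1)) (\<lambda>i. m i + (k + n) * r)"
    by (rule linear_systemI)
  moreover have "\<phi> = to_frac ?G / to_frac f ^ (k + n)"
    using G(2) f(2) by (simp add: power_add)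
  ultimately show ?L unfolding local_sections_def by blast
qed

section \<open>Cocycles and jets\<close>

lemma mult_exact_1_linear:
  fixes a v :: "complex ^ 'n::{finite,linorder}"
  assumes "pairing a v = 0" "a \<noteq> 0" "eval_at w v \<noteq> 0"
  shows "mult_exact 1 (lin a * w) v"
proof -
  have "mult_at_least 1 (lin a) v" unfolding mult_at_least_1_iff using assms by simp
  moreover have "\<not> mult_at_least (Suc 1) (lin a) v"
    using mult_exceeds_degree[of 1 "lin a" "Suc 1" v] assms by auto
  ultimately have "mult_exact 1 (lin a) v" by (simp add: mult_exact_def)
  from mult_exact_mult[OF this, of 0 w] assms(3) show ?thesis by (simp add: mult_exact_0_iff)
qed

text \<open>
  By the upper bound on the multiplicities, every jet of the prescribed order at a single point comes
  from a form of degree \<open>d\<close>; the obstruction to prescribing all jets at once is the first cohomology.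
\<close>

locale fat_points =
  fixes I :: "'i set" and p :: "'i \<Rightarrow> complex ^ 'n::{finite,linorder}" and d :: nat and m :: "'i \<Rightarrow> nat"
  assumes finite_I: "finite I" and dimension: "CARD('n) \<ge> 4" and separated: "separated I p"
    and mult_bounds: "\<And>i. i \<in> I \<Longrightarrow> 1 \<le> m i \<and> m i \<le> d + 1"
begin

abbreviation "s \<equiv> card I + 1"
abbreviation "cover \<equiv> ample_cover I p"

lemma cover_iff: "f \<in> cover \<longleftrightarrow> homogeneous s f \<and> f \<noteq> 0 \<and> (\<forall>i\<in>I. mult_at_least 1 f (p i))"
  by (auto simp: ample_cover_def linear_system_def)

lemma coverD: "f \<in> cover \<Longrightarrow> homogeneous s f" "f \<in> cover \<Longrightarrow> f \<noteq> 0"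
  "f \<in> cover \<Longrightarrow> i \<in> I \<Longrightarrow> mult_at_least 1 f (p i)"
  by (simp_all add: cover_iff)

lemma local_sections_1:
  assumes "f \<in> cover"
  shows "\<phi> \<in> local_sections I p d m 1 f \<longleftrightarrow>
    \<phi> \<in> forms_over d s f \<and> (\<forall>i\<in>I. mult_exact 1 f (p i) \<longrightarrow> val_ge (p i) (m i) \<phi>)"
  using local_sections_iff[OF finite_I, of 1 f p \<phi> d m] assms by (simp add: ample_cover_def)

lemma mult_exact_2_iff:
  assumes "f \<in> cover" "g \<in> cover" "i \<in> I"
  shows "mult_exact 2 (f * g) (p i) \<longleftrightarrow> mult_exact 1 f (p i) \<and> mult_exact 1 g (p i)"
proof
  show "mult_exact 2 (f * g) (p i)" if "mult_exact 1 f (p i) \<and> mult_exact 1 g (p i)"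
    using mult_exact_mult[of 1 f "p i" 1 g] that by (simp add: numeral_2_eq_2)
next
  assume fg: "mult_exact 2 (f * g) (p i)"
  obtain k where k: "mult_exact k f (p i)" using ex_mult_exact coverD(2)[OF assms(1)] by blast
  obtain l where l: "mult_exact l g (p i)" using ex_mult_exact coverD(2)[OF assms(2)] by blast
  have "k + l = 2" using mult_exact_unique[OF mult_exact_mult[OF k l] fg] .
  moreover have "1 \<le> k" "1 \<le> l"
    using mult_exact_iff[OF k] mult_exact_iff[OF l] coverD(3) assms by blast+
  ultimately have "k = 1" "l = 1" by auto
  with k l show "mult_exact 1 f (p i) \<and> mult_exact 1 g (p i)" by simp
qed

lemma local_sections_2:
  assumes "f \<in> cover" "g \<in> cover"
  shows "\<phi> \<in> local_sections I p d m 2 (f * g) \<longleftrightarrow>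
    \<phi> \<in> forms_over d (s + s) (f * g) \<and>
    (\<forall>i\<in>I. mult_exact 1 f (p i) \<and> mult_exact 1 g (p i) \<longrightarrow> val_ge (p i) (m i) \<phi>)"
proof -
  have "f * g \<in> linear_system I p (s + s) (\<lambda>_. 1 + 1)"
    using assms by (intro linear_system_mult) (auto simp: ample_cover_def)
  then have "f * g \<in> linear_system I p (2 * (card I + 1)) (\<lambda>_. 2)"
    by (simp only: mult_2 one_add_one)
  moreover have "f * g \<noteq> 0" using assms coverD(2) by simp
  ultimately have "\<phi> \<in> local_sections I p d m 2 (f * g) \<longleftrightarrow>
    \<phi> \<in> forms_over d (2 * (card I + 1)) (f * g) \<and>
    (\<forall>i\<in>I. mult_exact 2 (f * g) (p i) \<longrightarrow> val_ge (p i) (m i) \<phi>)"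
    by (intro local_sections_iff[OF finite_I]) simp_all
  then show ?thesis using mult_exact_2_iff[OF assms] by (simp add: mult_2)
qed

text \<open>
  Products of general linear forms, one through each point and one more to attain the degree. They
  vanish simply at the points, with independent tangent hyperplanes, and any three factors taken from
  different products are independent.
\<close>

lemma ex_regular_sections:
  obtains f1 f2 f3 where "f1 \<in> cover" "f2 \<in> cover" "f3 \<in> cover"
    "regular2 f1 f2" "regular2 f2 f1" "regular3 f1 f2 f3"
    "\<And>i. i \<in> I \<Longrightarrow> \<exists>a b w1 w2. f1 = lin a * w1 \<and> f2 = lin b * w2 \<and>
      pairing a (p i) = 0 \<and> pairing b (p i) = 0 \<and> a \<noteq> 0 \<and> b \<noteq> 0 \<and> regular2 (lin a) (lin b) \<and>
      homogeneous (card I) w1 \<and> homogeneous (card I) w2 \<and>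
      eval_at w1 (p i) \<noteq> 0 \<and> eval_at w2 (p i) \<noteq> 0"
proof -
  let ?K = "insert None (Some ` I)"
  have fin: "finite ?K" using finite_I by simp
  have cardK: "card ?K = s"
    using finite_I by (simp add: card_image)
  note general = ex_general_linear_form[OF dimension finite_I separated]
  have "\<exists>l. \<forall>k\<in>?K. l k \<in> through p k \<and> (\<forall>i\<in>I. k \<noteq> Some i \<longrightarrow> pairing (l k) (p i) \<noteq> 0) \<and>
      (\<forall>(x, y)\<in>X. \<forall>a b. l k \<noteq> a *s x + b *s y)" if "finite X" for X
  proof (rule bchoice, rule ballI)
    fix k assume "k \<in> ?K"
    from general[OF this that]
    show "\<exists>c. c \<in> through p k \<and> (\<forall>i\<in>I. k \<noteq> Some i \<longrightarrow> pairing c (p i) \<noteq> 0) \<and>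
      (\<forall>(x, y)\<in>X. \<forall>a b. c \<noteq> a *s x + b *s y)" unfolding Bex_def .
  qed
  note choose = this
  obtain a where a: "\<And>k. k \<in> ?K \<Longrightarrow> a k \<in> through p k"
    "\<And>k i. k \<in> ?K \<Longrightarrow> i \<in> I \<Longrightarrow> k \<noteq> Some i \<Longrightarrow> pairing (a k) (p i) \<noteq> 0"
    "\<And>k. k \<in> ?K \<Longrightarrow> a k \<noteq> 0"
    using choose[of "{(0, 0)}"] by auto
  define Y where "Y = (\<lambda>l. (a l, 0 :: (complex, 'n) vec)) ` ?K"
  have "finite Y" using fin by (simp add: Y_def)
  from choose[OF this] obtain b where b': "\<forall>k\<in>?K. b k \<in> through p k \<and>
    (\<forall>i\<in>I. k \<noteq> Some i \<longrightarrow> pairing (b k) (p i) \<noteq> 0) \<and> (\<forall>(x, y)\<in>Y. \<forall>u v. b k \<noteq> u *s x + v *s y)"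
    by blast
  have b: "b k \<in> through p k" "i \<in> I \<Longrightarrow> k \<noteq> Some i \<Longrightarrow> pairing (b k) (p i) \<noteq> 0"
    "l \<in> ?K \<Longrightarrow> b k \<noteq> x *s a l + y *s 0" if "k \<in> ?K" for k l i x y
  proof -
    show "b k \<in> through p k" "i \<in> I \<Longrightarrow> k \<noteq> Some i \<Longrightarrow> pairing (b k) (p i) \<noteq> 0"
      using b' that by blast+
    assume "l \<in> ?K"
    then have "(a l, 0) \<in> Y" unfolding Y_def by (rule imageI)
    then show "b k \<noteq> x *s a l + y *s 0" using b' that by blast
  qed
  define Z where "Z = (\<lambda>(l, n). (a l, b n)) ` (?K \<times> ?K)"
  have "finite Z" using fin by (simp add: Z_def)
  from choose[OF this] obtain c where c': "\<forall>k\<in>?K. c k \<in> through p k \<and>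
    (\<forall>i\<in>I. k \<noteq> Some i \<longrightarrow> pairing (c k) (p i) \<noteq> 0) \<and> (\<forall>(x, y)\<in>Z. \<forall>u v. c k \<noteq> u *s x + v *s y)"
    by blast
  have c: "c k \<in> through p k" "l \<in> ?K \<Longrightarrow> n \<in> ?K \<Longrightarrow> c k \<noteq> x *s a l + y *s b n"
    if "k \<in> ?K" for k l n x y
  proof -
    show "c k \<in> through p k" using c' that by blast
    assume "l \<in> ?K" "n \<in> ?K"
    then have "(a l, b n) \<in> Z" unfolding Z_def by force
    then show "c k \<noteq> x *s a l + y *s b n" using c' that by blast
  qed
  have ab: "b k \<noteq> x *s a l" if "k \<in> ?K" "l \<in> ?K" for k l x
    using b(3)[OF that, of x 0] by simp
  have b0: "b k \<noteq> 0" if "k \<in> ?K" for k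
    using ab[OF that that, of 0] by simp
  have ba: "a k \<noteq> x *s b l" if "k \<in> ?K" "l \<in> ?K" for k l x
  proof
    assume *: "a k = x *s b l"
    then have "x \<noteq> 0" using a(3)[OF that(1)] by auto
    then have "b l = (1 / x) *s a k" using * by (simp add: vec_eq_iff)
    with ab[OF that(2,1)] show False by blast
  qed
  have c0: "c k \<noteq> 0" if "k \<in> ?K" for k
    using c(2)[OF that that that, of 0 0] by simp
  have reg: "regular2 (lin (a k)) (lin (b l))" "regular2 (lin (b l)) (lin (a k))"
    "n \<in> ?K \<Longrightarrow> regular3 (lin (a k)) (lin (b l)) (lin (c n))" if "k \<in> ?K" "l \<in> ?K" for k l n
  proof -
    show "regular2 (lin (a k)) (lin (b l))"
      using a(3)[OF that(1)] ab[OF that(2,1)] by (rule regular2_lin)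
    show "regular2 (lin (b l)) (lin (a k))"
      using b0[OF that(2)] ba[OF that] by (rule regular2_lin)
    assume "n \<in> ?K"
    show "regular3 (lin (a k)) (lin (b l)) (lin (c n))"
      using a(3)[OF that(1)] ab[OF that(2,1)] c(2)[OF \<open>n \<in> ?K\<close> that] by (rule regular3_lin)
  qed
  let ?f = "\<lambda>l. \<Prod>k\<in>?K. lin (l k)"
  have factor: "?f l = lin (l (Some i)) * (\<Prod>k\<in>?K - {Some i}. lin (l k))" if "i \<in> I" for l i
    using that fin by (subst prod.remove[of _ "Some i"]) auto
  have hom: "homogeneous (card A) (\<Prod>k\<in>A. lin (l k))" for l :: "'i option \<Rightarrow> (complex, 'n) vec" and A
    using homogeneous_prod[of A "\<lambda>_. 1" "\<lambda>k. lin (l k)"] by simp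
  have cover: "?f l \<in> cover" if "\<And>k. k \<in> ?K \<Longrightarrow> l k \<in> through p k" "\<And>k. k \<in> ?K \<Longrightarrow> l k \<noteq> 0" for l
    unfolding cover_iff
  proof (intro conjI ballI)
    show "homogeneous s (?f l)" using hom[of ?K l] cardK by simp
    show "?f l \<noteq> 0" using that(2) fin by (subst prod_zero_iff) auto
    fix i assume i: "i \<in> I"
    then have "pairing (l (Some i)) (p i) = 0" using that(1)[of "Some i"] by (auto simp: through_def)
    then have "mult_at_least 1 (lin (l (Some i))) (p i)"
      unfolding mult_at_least_1_iff by simp
    then show "mult_at_least 1 (?f l) (p i)"
      unfolding factor[OF i] by (rule mult_at_least_mult_right)
  qed
  have "\<exists>x y w1 w2. ?f a = lin x * w1 \<and> ?f b = lin y * w2 \<and>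
      pairing x (p i) = 0 \<and> pairing y (p i) = 0 \<and> x \<noteq> 0 \<and> y \<noteq> 0 \<and> regular2 (lin x) (lin y) \<and>
      homogeneous (card I) w1 \<and> homogeneous (card I) w2 \<and>
      eval_at w1 (p i) \<noteq> 0 \<and> eval_at w2 (p i) \<noteq> 0" if i: "i \<in> I" for i
  proof (intro exI conjI)
    have K: "Some i \<in> ?K" using i by simp
    show "?f a = lin (a (Some i)) * (\<Prod>k\<in>?K - {Some i}. lin (a k))"
      "?f b = lin (b (Some i)) * (\<Prod>k\<in>?K - {Some i}. lin (b k))" using factor[OF i] by blast+
    show "pairing (a (Some i)) (p i) = 0" "pairing (b (Some i)) (p i) = 0"
      using a(1)[OF K] b(1)[OF K] by (auto simp: through_def)
    show "a (Some i) \<noteq> 0" "b (Some i) \<noteq> 0" using a(3) b0 K by blast+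
    show "regular2 (lin (a (Some i))) (lin (b (Some i)))" using reg(1)[OF K K] .
    have "card (?K - {Some i}) = card I" using K fin cardK by simp
    then show "homogeneous (card I) (\<Prod>k\<in>?K - {Some i}. lin (a k))"
      "homogeneous (card I) (\<Prod>k\<in>?K - {Some i}. lin (b k))"
      using hom[of "?K - {Some i}"] by metis+
    show "eval_at (\<Prod>k\<in>?K - {Some i}. lin (a k)) (p i) \<noteq> 0"
      "eval_at (\<Prod>k\<in>?K - {Some i}. lin (b k)) (p i) \<noteq> 0"
      using fin a(2) b(2) i by (auto simp: prod_zero_iff)
  qed
  moreover have "regular2 (?f a) (?f b)" "regular2 (?f b) (?f a)"
  proof -
    show "regular2 (?f a) (?f b)"
      by (rule regular2_prod) (simp_all only: reg(1) lin_eq_0_iff a(3) not_False_eq_True)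
    show "regular2 (?f b) (?f a)"
      by (rule regular2_prod) (simp_all only: reg(2) lin_eq_0_iff b0 not_False_eq_True)
  qed
  moreover have "regular3 (?f a) (?f b) (?f c)"
    by (rule regular3_prod) (simp_all only: reg lin_eq_0_iff b0 not_False_eq_True)
  ultimately show ?thesis
    using that[of "?f a" "?f b" "?f c"] cover[of a] cover[of b] cover[of c] a b(1) b0 c(1) c0 by blast
qed

text \<open>
  At a point the chosen linear form is a unit, so jets of order \<open>m i\<close> of forms of degree \<open>d\<close> correspond
  to forms of degree \<open>m i - 1\<close>.
\<close>

definition jet :: "'i \<Rightarrow> 'n mpoly \<Rightarrow> 'n mpoly" where
  "jet i H = lin (SOME c. pairing c (p i) = 1) ^ (d + 1 - m i) * H"

lemma jet_simps: "jet i (H + G) = jet i H + jet i G" "jet i (H - G) = jet i H - jet i G"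
  "jet i (Const c * H) = Const c * jet i H" "jet i 0 = 0"
  by (simp_all add: jet_def algebra_simps)

lemma homogeneous_jet:
  assumes "i \<in> I" "homogeneous (m i - 1) H" shows "homogeneous d (jet i H)"
proof -
  have "homogeneous ((d + 1 - m i) * 1 + (m i - 1)) (jet i H)"
    unfolding jet_def using assms by (intro homogeneous_mult homogeneous_power homogeneous_lin)
  moreover have "(d + 1 - m i) * 1 + (m i - 1) = d" using mult_bounds[OF assms(1)] by auto
  ultimately show ?thesis by simp
qed

definition jets :: "('i \<Rightarrow> 'n mpoly) set" where
  "jets = {H. \<forall>i. (i \<in> I \<longrightarrow> homogeneous (m i - 1) (H i)) \<and> (i \<notin> I \<longrightarrow> H i = 0)}"

text \<open>
  A splitting \<open>h\<close> of a cocycle over the complement of the points, whose restriction to the \<open>m i\<close>-fold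
  exceptional divisor is the jet \<open>H i\<close>. It is only tested on charts that meet this divisor.
\<close>

definition represents :: "('n mpoly \<Rightarrow> 'n mpoly fract) \<Rightarrow> ('i \<Rightarrow> 'n mpoly) \<Rightarrow> bool" where
  "represents h H \<longleftrightarrow> (\<forall>f\<in>cover. h f \<in> forms_over d s f \<and>
     (\<forall>i\<in>I. mult_exact 1 f (p i) \<longrightarrow> val_ge (p i) (m i) (h f - to_frac (jet i (H i)))))"

definition delta :: "('n mpoly \<Rightarrow> 'n mpoly fract) \<Rightarrow> 'n mpoly \<times> 'n mpoly \<Rightarrow> 'n mpoly fract" where
  "delta h e = (if e \<in> cover \<times> cover then h (snd e) - h (fst e) else 0)"

definition global_jets :: "('i \<Rightarrow> 'n mpoly) set" where
  "global_jets = {H \<in> jets. \<exists>D. homogeneous d D \<and> (\<forall>i\<in>I. mult_at_least (m i) (D - jet i (H i)) (p i))}"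

lemma representsD:
  assumes "represents h H" "f \<in> cover"
  shows "h f \<in> forms_over d s f"
    "i \<in> I \<Longrightarrow> mult_exact 1 f (p i) \<Longrightarrow> val_ge (p i) (m i) (h f - to_frac (jet i (H i)))"
  using assms by (auto simp: represents_def)

lemma represents_add:
  assumes "represents h H" "represents g G"
  shows "represents (\<lambda>f. h f + g f) (\<lambda>i. H i + G i)"
  unfolding represents_def
proof (intro ballI conjI impI)
  fix f assume f: "f \<in> cover"
  show "h f + g f \<in> forms_over d s f"
    using assms f coverD unfolding represents_def by (intro forms_over_add) auto
  fix i assume i: "i \<in> I" "mult_exact 1 f (p i)"
  have "val_ge (p i) (m i) ((h f - to_frac (jet i (H i))) + (g f - to_frac (jet i (G i))))"
    using assms f i by (intro val_ge_add representsD(2))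
  moreover have "(h f - to_frac (jet i (H i))) + (g f - to_frac (jet i (G i)))
      = h f + g f - to_frac (jet i (H i + G i))" by (simp add: jet_simps)
  ultimately show "val_ge (p i) (m i) (h f + g f - to_frac (jet i (H i + G i)))" by (simp only:)
qed

lemma represents_scale:
  assumes "represents h H"
  shows "represents (\<lambda>f. to_frac (Const c) * h f) (\<lambda>i. Const c * H i)"
  unfolding represents_def
proof (intro ballI conjI impI)
  fix f assume f: "f \<in> cover"
  show "to_frac (Const c) * h f \<in> forms_over d s f"
    using assms f unfolding represents_def by (intro forms_over_Const_mult) auto
  fix i assume i: "i \<in> I" "mult_exact 1 f (p i)"
  have "val_ge (p i) (m i) (to_frac (Const c) * (h f - to_frac (jet i (H i))))"
    using assms f i by (intro val_ge_Const_mult representsD(2))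
  moreover have "to_frac (Const c) * (h f - to_frac (jet i (H i)))
      = to_frac (Const c) * h f - to_frac (jet i (Const c * H i))"
    by (simp add: jet_simps right_diff_distrib)
  ultimately show "val_ge (p i) (m i) (to_frac (Const c) * h f - to_frac (jet i (Const c * H i)))"
    by (simp only:)
qed

lemma represents_0: "represents (\<lambda>_. 0) (\<lambda>_. 0)"
proof -
  have "0 \<in> forms_over d s f" for f :: "'n mpoly"
    using forms_over_poly[of d 0 s f] by simp
  then show ?thesis by (simp add: represents_def jet_simps)
qed

text \<open>
  In the degree \<open>d + k s\<close> of a numerator with denominator \<open>f\<^sup>k\<close>, the jets at all points can be
  prescribed once \<open>k\<close> is large: the required orders add up to \<open>k\<close> times the number of points
  plus a constant, and \<open>s\<close> exceeds the number of points.
\<close>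

lemma ex_represents:
  assumes H: "H \<in> jets" shows "\<exists>h. represents h H"
proof -
  have "\<exists>\<phi>. \<phi> \<in> forms_over d s f \<and>
     (\<forall>i\<in>I. mult_exact 1 f (p i) \<longrightarrow> val_ge (p i) (m i) (\<phi> - to_frac (jet i (H i))))"
    if f: "f \<in> cover" for f
  proof -
    define k where "k = (\<Sum>i\<in>I. m i)"
    let ?F = "\<lambda>i. jet i (H i) * f ^ k"
    have "homogeneous (d + k * s) (?F i)" if "i \<in> I" for i
      using H that coverD(1)[OF f]
      by (intro homogeneous_mult homogeneous_jet homogeneous_power) (auto simp: jets_def)
    moreover have "(\<Sum>i\<in>I. m i + k) \<le> d + k * s"
      by (simp add: sum.distrib k_def algebra_simps)
    ultimately obtain G where G: "homogeneous (d + k * s) G"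
      "\<And>i. i \<in> I \<Longrightarrow> mult_at_least (m i + k) (G - ?F i) (p i)"
      using interpolation[OF finite_I separated, of "d + k * s" ?F "\<lambda>i. m i + k"] by blast
    have "val_ge (p i) (m i) (to_frac G / to_frac f ^ k - to_frac (jet i (H i)))"
      if i: "i \<in> I" "mult_exact 1 f (p i)" for i
    proof -
      have "mult_exact k (f ^ k) (p i)" using mult_exact_power[OF i(2), of k] by simp
      then have "val_ge (p i) (m i) (to_frac (G - ?F i) / to_frac (f ^ k))"
        using G(2)[OF i(1)] by (simp only: val_ge_iff)
      moreover have "to_frac (G - ?F i) / to_frac (f ^ k) = to_frac G / to_frac f ^ k - to_frac (jet i (H i))"
        using coverD(2)[OF f] by (simp add: diff_divide_distrib)
      ultimately show ?thesis by (simp only:)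
    qed
    then show ?thesis
      using G(1) unfolding forms_over_def by (intro exI[of _ "to_frac G / to_frac f ^ k"]) blast
  qed
  then show ?thesis unfolding represents_def by (intro bchoice) blast
qed

lemma delta_cocycle:
  assumes h: "represents h H" shows "delta h \<in> cocycles1 I p d m"
proof -
  have "h g - h f \<in> local_sections I p d m 2 (f * g)" if fg: "f \<in> cover" "g \<in> cover" for f g
    unfolding local_sections_2[OF fg]
  proof (intro conjI ballI impI)
    have "h f \<in> forms_over d (s + s) (f * g)"
      using h fg coverD by (intro forms_over_restrict) (auto simp: represents_def)
    moreover have "h g \<in> forms_over d (s + s) (g * f)"
      using h fg coverD by (intro forms_over_restrict) (auto simp: represents_def)
    ultimately show "h g - h f \<in> forms_over d (s + s) (f * g)"
      using fg coverD homogeneous_mult[of s f s g]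
      by (intro forms_over_diff) (auto simp: mult.commute)
    fix i assume i: "i \<in> I" and e: "mult_exact 1 f (p i) \<and> mult_exact 1 g (p i)"
    have "val_ge (p i) (m i) ((h g - to_frac (jet i (H i))) - (h f - to_frac (jet i (H i))))"
      using h fg i e by (intro val_ge_diff representsD(2)) auto
    then show "val_ge (p i) (m i) (h g - h f)" by simp
  qed
  then show ?thesis
    unfolding cocycles1_def cochains1_def by (auto simp: delta_def)
qed

lemma to_frac_section:
  assumes "f1 \<in> cover" "f2 \<in> cover" "regular2 f1 f2"
    and "\<phi> \<in> forms_over d s f1" "\<phi> \<in> forms_over d s f2"
  obtains D where "homogeneous d D" "\<phi> = to_frac D"
proof -
  have "\<phi> \<in> forms_over d 0 1"
    by (rule forms_over_Int[OF assms(3), where s = s and e = 0 and h = 1])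
      (use assms coverD in auto)
  then obtain k D where "homogeneous (d + k * 0) D" "\<phi> = to_frac D / to_frac 1 ^ k"
    by (auto simp: forms_over_def)
  then show ?thesis using that by simp
qed

text \<open>
  Two splittings of the same cocycle differ by a section over the complement of the points, which is a
  global form.
\<close>

lemma global_jet_if_coboundary:
  assumes H: "H \<in> jets" and h: "represents h H" and B: "delta h \<in> coboundaries1 I p d m"
  shows "H \<in> global_jets"
proof -
  obtain h' where h': "h' \<in> cochains0 I p d m"
    "\<And>f g. f \<in> cover \<Longrightarrow> g \<in> cover \<Longrightarrow> delta h (f, g) = h' g - h' f"
    using B by (auto simp: coboundaries1_def)
  obtain f1 f2 where f: "f1 \<in> cover" "f2 \<in> cover" "regular2 f1 f2"
    and exact: "\<And>i. i \<in> I \<Longrightarrow> mult_exact 1 f1 (p i)"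
  proof (rule ex_regular_sections)
    fix f1 f2 f3 :: "'n mpoly"
    assume f: "f1 \<in> cover" "f2 \<in> cover" "regular2 f1 f2"
      and factor: "\<And>i. i \<in> I \<Longrightarrow> \<exists>a b w1 w2. f1 = lin a * w1 \<and> f2 = lin b * w2 \<and>
        pairing a (p i) = 0 \<and> pairing b (p i) = 0 \<and> a \<noteq> 0 \<and> b \<noteq> 0 \<and> regular2 (lin a) (lin b) \<and>
        homogeneous (card I) w1 \<and> homogeneous (card I) w2 \<and>
        eval_at w1 (p i) \<noteq> 0 \<and> eval_at w2 (p i) \<noteq> 0"
    have "mult_exact 1 f1 (p i)" if "i \<in> I" for i
      using factor[OF that] mult_exact_1_linear by blast
    with f show thesis by (rule that)
  qed
  have h'_sec: "h' f \<in> forms_over d s f"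
      "i \<in> I \<Longrightarrow> mult_exact 1 f (p i) \<Longrightarrow> val_ge (p i) (m i) (h' f)" if "f \<in> cover" for f i
    using h'(1) local_sections_1[OF that] that by (auto simp: cochains0_def)
  define \<phi> where "\<phi> = h f1 - h' f1"
  have "\<phi> = h f2 - h' f2" using h'(2)[OF f(1,2)] f by (simp add: delta_def \<phi>_def algebra_simps)
  then have "\<phi> \<in> forms_over d s f1" "\<phi> \<in> forms_over d s f2"
    using forms_over_diff[OF coverD(1,2)[OF f(1)] representsD(1)[OF h f(1)] h'_sec(1)[OF f(1)]]
      forms_over_diff[OF coverD(1,2)[OF f(2)] representsD(1)[OF h f(2)] h'_sec(1)[OF f(2)]]
    by (simp_all only: \<phi>_def)
  then obtain D where D: "homogeneous d D" "\<phi> = to_frac D"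
    using to_frac_section[OF f] by blast
  have "mult_at_least (m i) (D - jet i (H i)) (p i)" if i: "i \<in> I" for i
  proof -
    have "val_ge (p i) (m i) ((h f1 - to_frac (jet i (H i))) - h' f1)"
      using representsD(2)[OF h f(1) i exact[OF i]] h'_sec(2)[OF f(1) i exact[OF i]]
      by (rule val_ge_diff)
    also have "(h f1 - to_frac (jet i (H i))) - h' f1 = to_frac (D - jet i (H i))"
      using D(2) by (simp add: \<phi>_def algebra_simps)
    finally show ?thesis by (simp only: val_ge_poly)
  qed
  with H D(1) show ?thesis by (auto simp: global_jets_def)
qed

lemma coboundary_if_global_jet:
  assumes H: "H \<in> global_jets" and h: "represents h H"
  shows "delta h \<in> coboundaries1 I p d m"
proof -
  obtain D where D: "homogeneous d D" "\<And>i. i \<in> I \<Longrightarrow> mult_at_least (m i) (D - jet i (H i)) (p i)"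
    using H by (auto simp: global_jets_def)
  define h' where "h' f = (if f \<in> cover then h f - to_frac D else 0)" for f
  have "h' f \<in> local_sections I p d m 1 f" if f: "f \<in> cover" for f
    unfolding local_sections_1[OF f]
  proof (intro conjI ballI impI)
    show "h' f \<in> forms_over d s f"
      using h f coverD forms_over_poly[OF D(1)] by (simp add: h'_def represents_def forms_over_diff)
    fix i assume i: "i \<in> I" "mult_exact 1 f (p i)"
    have "val_ge (p i) (m i) ((h f - to_frac (jet i (H i))) - to_frac (D - jet i (H i)))"
    proof (rule val_ge_diff[OF representsD(2)[OF h f i]])
      show "val_ge (p i) (m i) (to_frac (D - jet i (H i)))"
        unfolding val_ge_poly by (rule D(2)[OF i(1)])
    qed
    then show "val_ge (p i) (m i) (h' f)" using f by (simp add: h'_def)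
  qed
  then have "h' \<in> cochains0 I p d m" by (simp add: cochains0_def h'_def)
  moreover have "delta h (f, g) = h' g - h' f" if "f \<in> cover" "g \<in> cover" for f g
    using that by (simp add: delta_def h'_def)
  ultimately show ?thesis
    using delta_cocycle[OF h] unfolding coboundaries1_def cocycles1_def by blast
qed

text \<open>
  The first cohomology of \<open>O(d)\<close> vanishes on the complement of the points. A splitting on two charts is
  given by the Koszul complex on three charts; on every other chart it is then determined in two ways,
  with denominators that are powers of coprime forms.
\<close>

lemma cocycle_splits:
  assumes g: "g \<in> cocycles1 I p d m"
  obtains h where "\<And>f. f \<in> cover \<Longrightarrow> h f \<in> forms_over d s f" "g = delta h"
proof -
  obtain f1 f2 f3 where f: "f1 \<in> cover" "f2 \<in> cover" "f3 \<in> cover"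
    and reg: "regular2 f1 f2" "regular2 f2 f1" "regular3 f1 f2 f3"
    by (rule ex_regular_sections, rule that)
  have g_sec: "g (e, e') \<in> forms_over d (s + s) (e * e')" if "e \<in> cover" "e' \<in> cover" for e e'
    using g local_sections_2[OF that] that by (auto simp: cocycles1_def cochains1_def)
  have g_cocycle: "g (e2, e3) - g (e1, e3) + g (e1, e2) = 0"
    if "e1 \<in> cover" "e2 \<in> cover" "e3 \<in> cover" for e1 e2 e3
    using g that by (auto simp: cocycles1_def)
  have large: "\<exists>k. \<forall>K\<ge>k. \<exists>G. homogeneous (d + K * (s + s)) G \<and> g (e, e') = to_frac G / to_frac (e * e') ^ K"
    if "e \<in> cover" "e' \<in> cover" for e e'
    using that coverD by (intro forms_over_large g_sec homogeneous_mult) auto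
  obtain k12 k13 k23 where
    k12: "\<forall>K\<ge>k12. \<exists>G. homogeneous (d + K * (s + s)) G \<and> g (f1, f2) = to_frac G / to_frac (f1 * f2) ^ K" and
    k13: "\<forall>K\<ge>k13. \<exists>G. homogeneous (d + K * (s + s)) G \<and> g (f1, f3) = to_frac G / to_frac (f1 * f3) ^ K" and
    k23: "\<forall>K\<ge>k23. \<exists>G. homogeneous (d + K * (s + s)) G \<and> g (f2, f3) = to_frac G / to_frac (f2 * f3) ^ K"
    using large[OF f(1,2)] large[OF f(1,3)] large[OF f(2,3)] by blast
  define K where "K = k12 + k13 + k23"
  obtain a12 where a12: "homogeneous (d + K * (s + s)) a12" "g (f1, f2) = to_frac a12 / to_frac (f1 * f2) ^ K"
    using k12[rule_format, of K] by (auto simp: K_def)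
  obtain a13 where a13: "g (f1, f3) = to_frac a13 / to_frac (f1 * f3) ^ K"
    using k13[rule_format, of K] by (auto simp: K_def)
  obtain a23 where a23: "g (f2, f3) = to_frac a23 / to_frac (f2 * f3) ^ K"
    using k23[rule_format, of K] by (auto simp: K_def)
  define x where "x = f1 ^ K"
  define y where "y = f2 ^ K"
  define z where "z = f3 ^ K"
  have nz: "x \<noteq> 0" "y \<noteq> 0" "z \<noteq> 0" using f coverD(2) by (simp_all add: x_def y_def z_def)
  have hx: "homogeneous (K * s) x" and hy: "homogeneous (K * s) y"
    using f coverD(1) unfolding x_def y_def by (blast intro: homogeneous_power)+
  have gs: "g (f1, f2) = to_frac a12 / (to_frac x * to_frac y)"
    "g (f1, f3) = to_frac a13 / (to_frac x * to_frac z)"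
    "g (f2, f3) = to_frac a23 / (to_frac y * to_frac z)"
    by (simp_all add: a12 a13 a23 x_def y_def z_def power_mult_distrib)
  have "to_frac (a23 * x - a13 * y + a12 * z) = (g (f2, f3) - g (f1, f3) + g (f1, f2)) * to_frac (x * y * z)"
    using nz by (simp add: gs field_simps)
  also have "\<dots> = 0" using g_cocycle[OF f] by simp
  finally have "a23 * x - a13 * y + a12 * z = 0" by (simp only: to_frac_eq_0_iff)
  moreover have "regular3 x y z"
    unfolding x_def y_def z_def using reg f coverD(2) by (auto intro!: regular3_power)
  ultimately obtain h1 h2 where h12: "a12 = x * h2 - y * h1"
    using koszul_exact by blast
  \<comment> \<open>The Koszul coefficients need not be forms, but their parts of the expected degree serve as well.\<close>
  let ?n = "d + K * s"
  define u where "u = to_frac (hom_part ?n h1) / to_frac x"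
  define v where "v = to_frac (hom_part ?n h2) / to_frac y"
  have "a12 = hom_part (?n + K * s) a12" using a12(1) by (simp add: hom_part_self algebra_simps)
  also have "\<dots> = x * hom_part ?n h2 - y * hom_part ?n h1"
    unfolding h12 hom_part_diff hom_part_mult_homogeneous[OF hx] hom_part_mult_homogeneous[OF hy] ..
  finally have "to_frac a12 = to_frac x * to_frac (hom_part ?n h2) - to_frac y * to_frac (hom_part ?n h1)"
    by (simp only: to_frac_diff to_frac_simps)
  then have uv: "g (f1, f2) = v - u"
    unfolding gs(1) u_def v_def using nz by (simp only: diff_divide_distrib) simp
  have u: "u \<in> forms_over d s f1" and v: "v \<in> forms_over d s f2"
    unfolding forms_over_def u_def v_def x_def y_def to_frac_power using hom_part_homogeneous by blast+
  \<comment> \<open>On the charts \<open>f1\<close> and \<open>f2\<close> this is \<open>u\<close> and \<open>v\<close>, and the cocycle condition forces the rest.\<close>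
  define h where "h e = (if e \<in> cover then g (f1, e) + u else 0)" for e
  have "h e \<in> forms_over d s e" if e: "e \<in> cover" for e
  proof (rule forms_over_Int[OF reg(1), where s = s])
    show "homogeneous s f1" "f1 \<noteq> 0" "homogeneous s f2" "f2 \<noteq> 0" "homogeneous s e" "e \<noteq> 0"
      using f e coverD by auto
    have "g (f1, e) + u \<in> forms_over d (s + s) (f1 * e)"
      using g_sec[OF f(1) e] forms_over_restrict[OF coverD(1,2)[OF e] u] f(1) e coverD
      by (intro forms_over_add homogeneous_mult) auto
    then show "h e \<in> forms_over d (s + s) (e * f1)" using e by (simp add: h_def mult.commute)
    have "g (f1, e) + u = g (f2, e) + v" using g_cocycle[OF f(1,2) e] uv by (simp add: algebra_simps)
    moreover have "g (f2, e) + v \<in> forms_over d (s + s) (f2 * e)"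
      using g_sec[OF f(2) e] forms_over_restrict[OF coverD(1,2)[OF e] v] f(2) e coverD
      by (intro forms_over_add homogeneous_mult) auto
    ultimately show "h e \<in> forms_over d (s + s) (e * f2)" using e by (simp add: h_def mult.commute)
  qed
  moreover have "g = delta h"
  proof
    fix e
    show "g e = delta h e"
    proof (cases "e \<in> cover \<times> cover")
      case True
      then obtain e1 e2 where e: "e = (e1, e2)" "e1 \<in> cover" "e2 \<in> cover" by auto
      then show ?thesis using g_cocycle[OF f(1) e(2,3)] by (simp add: delta_def h_def algebra_simps)
    next
      case False
      then have "g e = 0" using g unfolding cocycles1_def cochains1_def by blast
      with False show ?thesis by (simp only: delta_def if_False)
    qed
  qed
  ultimately show ?thesis using that by blast
qed

text \<open>
  Replacing \<open>f1\<close> and \<open>f2\<close> by their linear factors through the point, at the price of the units \<open>w1\<close>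
  and \<open>w2\<close>, reduces this to \<open>local_extension\<close>.
\<close>

lemma local_jet:
  assumes i: "i \<in> I" and f: "f1 \<in> cover" "f2 \<in> cover" "f1 = lin a * w1" "f2 = lin b * w2"
    and ab: "pairing a (p i) = 0" "pairing b (p i) = 0" "a \<noteq> 0" "b \<noteq> 0" "regular2 (lin a) (lin b)"
    and w: "homogeneous (card I) w1" "homogeneous (card I) w2"
      "eval_at w1 (p i) \<noteq> 0" "eval_at w2 (p i) \<noteq> 0"
    and \<phi>: "\<phi> \<in> forms_over d s f1" "\<psi> \<in> forms_over d s f2" "val_ge (p i) (m i) (\<phi> - \<psi>)"
  shows "\<exists>H. homogeneous (m i - 1) H \<and> val_ge (p i) (m i) (\<phi> - to_frac (jet i H))"
proof -
  have pi: "p i \<noteq> 0" using separated i by (simp add: separated_def)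
  define c where "c = (SOME c. pairing c (p i) = 1)"
  have c: "pairing c (p i) = 1" unfolding c_def using ex_pairing_1[OF pi] by (rule someI_ex)
  obtain k where k: "\<forall>K\<ge>k. \<exists>G. homogeneous (d + K * s) G \<and> \<phi> = to_frac G / to_frac f1 ^ K"
    using forms_over_large[OF coverD(1,2)[OF f(1)] \<phi>(1)] by blast
  obtain l where l: "\<forall>K\<ge>l. \<exists>G. homogeneous (d + K * s) G \<and> \<psi> = to_frac G / to_frac f2 ^ K"
    using forms_over_large[OF coverD(1,2)[OF f(2)] \<phi>(2)] by blast
  define K where "K = k + l"
  obtain G1 where G1: "homogeneous (d + K * s) G1" "\<phi> = to_frac G1 / to_frac (f1 ^ K)"
    using k[rule_format, of K] by (auto simp: K_def)
  obtain G2 where G2: "homogeneous (d + K * s) G2" "\<psi> = to_frac G2 / to_frac (f2 ^ K)"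
    using l[rule_format, of K] by (auto simp: K_def)
  have nz: "f1 ^ K \<noteq> 0" "f2 ^ K \<noteq> 0" using f(1,2) coverD(2) by auto
  have exact: "mult_exact K (f1 ^ K) (p i)" "mult_exact K (f2 ^ K) (p i)"
    using mult_exact_power[OF mult_exact_1_linear, of a "p i" w1 K]
      mult_exact_power[OF mult_exact_1_linear, of b "p i" w2 K] ab w f(3,4) by auto
  have eq: "\<phi> - \<psi> = to_frac (G1 * f2 ^ K - G2 * f1 ^ K) / to_frac (f1 ^ K * f2 ^ K)"
    unfolding G1(2) G2(2) by (rule fract_common_denominator(2)[OF nz])
  have "mult_at_least (m i + (K + K)) (G1 * f2 ^ K - G2 * f1 ^ K) (p i)"
    using \<phi>(3) by (simp only: eq val_ge_iff[OF mult_exact_mult[OF exact]])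
  then have "mult_at_least ((m i + K) + K) ((G1 * w2 ^ K) * lin b ^ K - (G2 * w1 ^ K) * lin a ^ K) (p i)"
    by (simp add: f(3,4) power_mult_distrib ac_simps)
  moreover have "homogeneous ((d + K * s) + K * card I) (G1 * w2 ^ K)"
    using G1(1) w by (intro homogeneous_mult homogeneous_power)
  ultimately obtain C where C: "homogeneous ((d + K * s) + K * card I - K) C"
    "mult_at_least (m i + K) (G1 * w2 ^ K - lin a ^ K * C) (p i)"
    using local_extension[OF _ pi ab(1,2,3,5)] by blast
  define W where "W = w1 ^ K * w2 ^ K * lin c ^ (d + 1 - m i)"
  have hW: "homogeneous (K * card I + K * card I + (d + 1 - m i) * 1) W"
    unfolding W_def using w by (intro homogeneous_mult homogeneous_power homogeneous_lin)
  have "eval_at W (p i) \<noteq> 0" using w c by (simp add: W_def)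
  moreover have "(d + K * s) + K * card I - K = (K * card I + K * card I + (d + 1 - m i) * 1) + (m i - 1)"
    using mult_bounds[OF i] by simp
  ultimately obtain H where H: "homogeneous (m i - 1) H" "mult_at_least (Suc (m i - 1)) (C - W * H) (p i)"
    using local_division[OF C(1) hW _ _ pi] by blast
  have "mult_at_least (m i) (C - W * H) (p i)" using H(2) mult_bounds[OF i] by simp
  moreover have "mult_at_least (K * 1) (lin a ^ K) (p i)"
    by (rule mult_at_least_power) (use ab in \<open>simp only: mult_at_least_1_iff eval_lin\<close>)
  ultimately have "mult_at_least (K * 1 + m i) (lin a ^ K * (C - W * H)) (p i)"
    by (intro mult_at_least_mult)
  then have "mult_at_least (m i + K) ((G1 * w2 ^ K - lin a ^ K * C) + lin a ^ K * (C - W * H)) (p i)"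
    using C(2) by (intro mult_at_least_add) (simp_all add: add.commute)
  also have "(G1 * w2 ^ K - lin a ^ K * C) + lin a ^ K * (C - W * H) = w2 ^ K * (G1 - jet i H * f1 ^ K)"
    by (simp add: W_def jet_def c_def[symmetric] f(3) power_mult_distrib algebra_simps)
  finally have "mult_at_least (0 + (m i + K)) (w2 ^ K * (G1 - jet i H * f1 ^ K)) (p i)" by simp
  moreover have "mult_exact 0 (w2 ^ K) (p i)" using w by (simp add: mult_exact_0_iff)
  ultimately have "mult_at_least (m i + K) (G1 - jet i H * f1 ^ K) (p i)"
    by (simp only: mult_cancel)
  then have "val_ge (p i) (m i) (to_frac (G1 - jet i H * f1 ^ K) / to_frac (f1 ^ K))"
    by (simp only: val_ge_iff[OF exact(1)])
  moreover have "to_frac (G1 - jet i H * f1 ^ K) / to_frac (f1 ^ K) = \<phi> - to_frac (jet i H)"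
    using nz G1(2) by (simp add: diff_divide_distrib)
  ultimately show ?thesis using H(1) by (intro exI[of _ H]) simp
qed

lemma cocycle_represented:
  assumes g: "g \<in> cocycles1 I p d m"
  obtains h H where "H \<in> jets" "represents h H" "g = delta h"
proof -
  obtain h where h: "\<And>f. f \<in> cover \<Longrightarrow> h f \<in> forms_over d s f" "g = delta h"
    using cocycle_splits[OF g] by blast
  have diff: "val_ge (p i) (m i) (h f' - h f)"
    if "f \<in> cover" "f' \<in> cover" "i \<in> I" "mult_exact 1 f (p i)" "mult_exact 1 f' (p i)" for f f' i
  proof -
    have "g (f, f') \<in> local_sections I p d m 2 (f * f')"
      using g that by (auto simp: cocycles1_def cochains1_def)
    then have "val_ge (p i) (m i) (g (f, f'))" using local_sections_2 that by blast
    then show ?thesis using that by (simp add: h(2) delta_def)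
  qed
  obtain f1 f2 f3 where f: "f1 \<in> cover" "f2 \<in> cover"
    and factor: "\<And>i. i \<in> I \<Longrightarrow> \<exists>a b w1 w2. f1 = lin a * w1 \<and> f2 = lin b * w2 \<and>
      pairing a (p i) = 0 \<and> pairing b (p i) = 0 \<and> a \<noteq> 0 \<and> b \<noteq> 0 \<and> regular2 (lin a) (lin b) \<and>
      homogeneous (card I) w1 \<and> homogeneous (card I) w2 \<and>
      eval_at w1 (p i) \<noteq> 0 \<and> eval_at w2 (p i) \<noteq> 0"
    by (rule ex_regular_sections, rule that)
  have "\<exists>H. homogeneous (m i - 1) H \<and> mult_exact 1 f1 (p i) \<and> val_ge (p i) (m i) (h f1 - to_frac (jet i H))"
    if i: "i \<in> I" for i
  proof -
    obtain a b w1 w2 where w: "f1 = lin a * w1" "f2 = lin b * w2"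
      "pairing a (p i) = 0" "pairing b (p i) = 0" "a \<noteq> 0" "b \<noteq> 0" "regular2 (lin a) (lin b)"
      "homogeneous (card I) w1" "homogeneous (card I) w2"
      "eval_at w1 (p i) \<noteq> 0" "eval_at w2 (p i) \<noteq> 0"
      using factor[OF i] by blast
    have exact: "mult_exact 1 f1 (p i)" "mult_exact 1 f2 (p i)"
      using mult_exact_1_linear w by auto
    from local_jet[OF i f w h(1)[OF f(1)] h(1)[OF f(2)] diff[OF f(2,1) i exact(2,1)]] exact
    show ?thesis by blast
  qed
  then have "\<exists>H. \<forall>i\<in>I. homogeneous (m i - 1) (H i) \<and> mult_exact 1 f1 (p i) \<and>
      val_ge (p i) (m i) (h f1 - to_frac (jet i (H i)))"
    by (intro bchoice ballI)
  then obtain H where H: "\<And>i. i \<in> I \<Longrightarrow> homogeneous (m i - 1) (H i)"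
    "\<And>i. i \<in> I \<Longrightarrow> mult_exact 1 f1 (p i)"
    "\<And>i. i \<in> I \<Longrightarrow> val_ge (p i) (m i) (h f1 - to_frac (jet i (H i)))" by blast
  define H' where "H' i = (if i \<in> I then H i else 0)" for i
  have "H' \<in> jets" using H(1) by (simp add: jets_def H'_def)
  moreover have "represents h H'"
    unfolding represents_def
  proof (intro ballI conjI impI)
    fix e assume e: "e \<in> cover"
    show "h e \<in> forms_over d s e" using h(1)[OF e] .
    fix i assume i: "i \<in> I" "mult_exact 1 e (p i)"
    have "val_ge (p i) (m i) ((h e - h f1) + (h f1 - to_frac (jet i (H i))))"
      using diff[OF f(1) e i(1) H(2)[OF i(1)] i(2)] H(3)[OF i(1)] by (rule val_ge_add)
    then show "val_ge (p i) (m i) (h e - to_frac (jet i (H' i)))" using i by (simp add: H'_def)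
  qed
  ultimately show ?thesis using that h(2) by blast
qed

end

section \<open>The dimension of the first cohomology\<close>

text \<open>
  Independent families modulo \<open>B\<close> are not larger than a generating one, by linear algebra with the
  coefficients of their members.
\<close>

lemma quotient_dim_eq:
  fixes smul :: "complex \<Rightarrow> 'a::ab_group_add \<Rightarrow> 'a" and g :: "'w \<Rightarrow> 'a"
  assumes vs: "vector_space smul" and B: "module.subspace smul B" and W: "finite W"
    and Z: "\<And>w. w \<in> W \<Longrightarrow> g w \<in> Z"
    and span: "\<And>z. z \<in> Z \<Longrightarrow> \<exists>c. z - (\<Sum>w\<in>W. smul (c w) (g w)) \<in> B"
    and indep: "\<And>c. (\<Sum>w\<in>W. smul (c w) (g w)) \<in> B \<Longrightarrow> \<forall>w\<in>W. c w = 0"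
  shows "quotient_dim smul Z B = enat (card W)"
proof -
  interpret vector_space smul by (rule vs)
  let ?F = "{U. finite U \<and> U \<subseteq> Z \<and> (\<forall>c. (\<Sum>w\<in>U. smul (c w) w) \<in> B \<longrightarrow> (\<forall>w\<in>U. c w = 0))}"
  have upper: "card U \<le> card W" if U: "U \<in> ?F" for U
  proof (rule ccontr)
    assume "\<not> card U \<le> card W"
    then have less: "card W < card U" by simp
    have fin: "finite U" and UZ: "U \<subseteq> Z"
      and U_indep: "\<And>c. (\<Sum>w\<in>U. smul (c w) w) \<in> B \<Longrightarrow> \<forall>w\<in>U. c w = 0" using U by auto
    have "\<forall>z\<in>U. \<exists>c. z - (\<Sum>w\<in>W. smul (c w) (g w)) \<in> B" using span UZ by blast
    then obtain c where c: "\<And>z. z \<in> U \<Longrightarrow> z - (\<Sum>w\<in>W. smul (c z w) (g w)) \<in> B"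
      by (auto dest!: bchoice)
    obtain x where x: "\<exists>z\<in>U. x z \<noteq> 0" "\<forall>w\<in>W. (\<Sum>z\<in>U. c z w * x z) = 0"
      using underdetermined_system[OF W fin less, of "\<lambda>w z. c z w"] by blast
    have "(\<Sum>z\<in>U. smul (x z) (z - (\<Sum>w\<in>W. smul (c z w) (g w)))) \<in> B"
      by (intro subspace_sum[OF B] subspace_scale[OF B] c)
    moreover have "(\<Sum>z\<in>U. smul (x z) (z - (\<Sum>w\<in>W. smul (c z w) (g w))))
        = (\<Sum>z\<in>U. smul (x z) z) - (\<Sum>w\<in>W. smul (\<Sum>z\<in>U. c z w * x z) (g w))"
      unfolding scale_right_diff_distrib sum_subtractf scale_sum_right scale_scale
      by (subst sum.swap) (simp add: scale_sum_left mult.commute)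
    moreover have "(\<Sum>w\<in>W. smul (\<Sum>z\<in>U. c z w * x z) (g w)) = 0" using x(2) by simp
    ultimately have "(\<Sum>z\<in>U. smul (x z) z) \<in> B" by simp
    from U_indep[OF this] x(1) show False by blast
  qed
  have inj: "inj_on g W"
  proof (rule inj_onI, rule ccontr)
    fix v w assume vw: "v \<in> W" "w \<in> W" "g v = g w" "v \<noteq> w"
    let ?c = "\<lambda>u. if u = v then 1 else if u = w then -1 else (0 :: complex)"
    have "(\<Sum>u\<in>W. smul (?c u) (g u)) = (\<Sum>u\<in>{v, w}. smul (?c u) (g u))"
      using W vw by (intro sum.mono_neutral_right) auto
    also have "\<dots> = 0" using vw by simp
    finally have "(\<Sum>u\<in>W. smul (?c u) (g u)) \<in> B" using subspace_0[OF B] by simp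
    from indep[OF this] vw(1) show False by auto
  qed
  have "g ` W \<in> ?F"
  proof (intro CollectI conjI allI impI ballI)
    show "finite (g ` W)" "g ` W \<subseteq> Z" using W Z by auto
    fix c u assume "(\<Sum>w\<in>g ` W. smul (c w) w) \<in> B" and u: "u \<in> g ` W"
    then have "(\<Sum>w\<in>W. smul (c (g w)) (g w)) \<in> B" by (simp add: sum.reindex[OF inj])
    from indep[OF this] u show "c u = 0" by auto
  qed
  then have "enat (card (g ` W)) \<le> (SUP U\<in>?F. enat (card U))" by (rule SUP_upper)
  then have "enat (card W) \<le> (SUP U\<in>?F. enat (card U))" by (simp only: card_image[OF inj])
  moreover have "(SUP U\<in>?F. enat (card U)) \<le> enat (card W)"
    using upper by (intro SUP_least) simp
  ultimately show ?thesis unfolding quotient_dim_def by (rule antisym[rotated])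
qed

lemma (in vector_space) independent_family:
  assumes C: "finite C" and indep: "\<And>x. (\<Sum>c\<in>C. scale (x c) (f c)) = 0 \<Longrightarrow> \<forall>c\<in>C. x c = 0"
  shows "inj_on f C" "independent (f ` C)"
proof -
  show inj: "inj_on f C"
  proof (rule inj_onI, rule ccontr)
    fix v w assume vw: "v \<in> C" "w \<in> C" "f v = f w" "v \<noteq> w"
    let ?c = "\<lambda>u. if u = v then 1 else if u = w then -1 else 0"
    have "(\<Sum>u\<in>C. scale (?c u) (f u)) = (\<Sum>u\<in>{v, w}. scale (?c u) (f u))"
      using C vw by (intro sum.mono_neutral_right) auto
    also have "\<dots> = 0" using vw by simp
    finally show False using indep vw(1) by fastforce
  qed
  show "independent (f ` C)"
  proof (rule independent_if_scalars_zero)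
    show "finite (f ` C)" using C by simp
    fix x u assume "(\<Sum>v\<in>f ` C. scale (x v) v) = 0" and u: "u \<in> f ` C"
    then have "(\<Sum>c\<in>C. scale (x (f c)) (f c)) = 0" by (simp add: sum.reindex[OF inj])
    from indep[OF this] u show "x u = 0" by auto
  qed
qed

interpretation fun_frac: vector_space "\<lambda>c (g :: 'e \<Rightarrow> 'n::{finite,linorder} mpoly fract) e. to_frac (Const c) * g e"
  by unfold_locales (simp_all add: fun_eq_iff Const_add Const_mult algebra_simps)

interpretation jet_space: vector_space "\<lambda>c (H :: 'i \<Rightarrow> 'n mpoly) i. Const c * H i"
  by unfold_locales (simp_all add: fun_eq_iff Const_add Const_mult algebra_simps)

lemma sum_fun_apply: "(\<Sum>a\<in>A. f a) x = (\<Sum>a\<in>A. f a x)"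
  for f :: "'a \<Rightarrow> 'b \<Rightarrow> 'c::comm_monoid_add"
  by (induction A rule: infinite_finite_induct) auto

lemma forms_basis:
  fixes d :: nat
  defines "M \<equiv> (\<lambda>t. Poly_Mapping.single t (1::complex)) ` {t :: 'n::finite \<Rightarrow>\<^sub>0 nat. mon_degree t = d}"
  shows "finite M" "mp.independent M" "{F. homogeneous d F} = mp.span M"
    "card M = card {t :: 'n \<Rightarrow>\<^sub>0 nat. mon_degree t = d}"
proof -
  let ?T = "{t :: 'n \<Rightarrow>\<^sub>0 nat. mon_degree t = d}"
  have fin: "finite ?T" by (rule finite_monomials)
  then show "finite M" by (simp add: M_def)
  have "\<forall>t\<in>?T. x t = 0" if "(\<Sum>t\<in>?T. Const (x t) * Poly_Mapping.single t 1) = 0" for x :: "('n \<Rightarrow>\<^sub>0 nat) \<Rightarrow> complex"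
  proof
    fix t assume "t \<in> ?T"
    then have "lookup (\<Sum>t\<in>?T. Const (x t) * Poly_Mapping.single t 1) t = x t"
      unfolding lookup_sum_monomials[OF fin] by (rule if_P)
    then show "x t = 0" unfolding that by simp
  qed
  note family = mp.independent_family[OF fin this]
  from family(2) show "mp.independent M" by (simp add: M_def)
  from card_image[OF family(1)] show "card M = card ?T" by (simp add: M_def)
  show "{F. homogeneous d F} = mp.span M"
  proof (rule antisym)
    show "{F. homogeneous d F} \<subseteq> mp.span M"
    proof
      fix F :: "'n mpoly" assume "F \<in> {F. homogeneous d F}"
      then have "keys F \<subseteq> ?T" by (auto simp: homogeneous_def)
      then have "F = (\<Sum>t\<in>?T. Const (lookup F t) * Poly_Mapping.single t 1)"
        by (rule form_expand[OF fin])
      also have "\<dots> \<in> mp.span M"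
        by (intro mp.span_sum mp.span_scale mp.span_base) (auto simp: M_def)
      finally show "F \<in> mp.span M" .
    qed
    show "mp.span M \<subseteq> {F. homogeneous d F}"
    proof (rule mp.span_minimal)
      show "M \<subseteq> {F. homogeneous d F}" by (auto simp: M_def homogeneous_def)
      show "mp.subspace {F :: 'n mpoly. homogeneous d F}"
        by (auto simp: mp.subspace_def intro: homogeneous_add homogeneous_Const_mult)
    qed
  qed
qed

context fat_points
begin


definition osculates :: "'n mpoly \<Rightarrow> ('i \<Rightarrow> 'n mpoly) \<Rightarrow> bool" where
  "osculates D H \<longleftrightarrow> (\<forall>i\<in>I. mult_at_least (m i) (D - jet i (H i)) (p i))"

lemma global_jets_iff: "H \<in> global_jets \<longleftrightarrow> H \<in> jets \<and> (\<exists>D. homogeneous d D \<and> osculates D H)"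
  by (simp add: global_jets_def osculates_def)

lemma osculates_add:
  assumes "osculates D H" "osculates E G"
  shows "osculates (D + E) (\<lambda>i. H i + G i)"
  unfolding osculates_def
proof
  fix i assume "i \<in> I"
  with assms have "mult_at_least (m i) ((D - jet i (H i)) + (E - jet i (G i))) (p i)"
    by (intro mult_at_least_add) (simp_all only: osculates_def)
  then show "mult_at_least (m i) (D + E - jet i (H i + G i)) (p i)"
    by (simp add: jet_simps add_diff_add)
qed

lemma osculates_scale:
  assumes "osculates D H" shows "osculates (Const c * D) (\<lambda>i. Const c * H i)"
  unfolding osculates_def
proof
  fix i assume "i \<in> I"
  with assms have "mult_at_least (m i) (Const c * (D - jet i (H i))) (p i)"
    by (intro mult_at_least_mult_left) (simp only: osculates_def)
  then show "mult_at_least (m i) (Const c * D - jet i (Const c * H i)) (p i)"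
    by (simp only: jet_simps right_diff_distrib)
qed

lemma osculates_0: "osculates 0 (\<lambda>_. 0)"
  by (simp add: osculates_def jet_simps)

lemma osculates_sum:
  assumes "\<And>a. a \<in> A \<Longrightarrow> osculates (D a) (H a)"
  shows "osculates (\<Sum>a\<in>A. Const (x a) * D a) (\<Sum>a\<in>A. (\<lambda>i. Const (x a) * H a i))"
proof -
  have "osculates (\<Sum>a\<in>A. Const (x a) * D a) (\<lambda>i. \<Sum>a\<in>A. Const (x a) * H a i)"
    using assms
  proof (induction A rule: infinite_finite_induct)
    case (insert a A)
    have "osculates (Const (x a) * D a + (\<Sum>a\<in>A. Const (x a) * D a))
        (\<lambda>i. Const (x a) * H a i + (\<Sum>a\<in>A. Const (x a) * H a i))"
    proof (rule osculates_add[OF osculates_scale])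
      show "osculates (D a) (H a)" by (rule insert.prems) simp
      show "osculates (\<Sum>a\<in>A. Const (x a) * D a) (\<lambda>i. \<Sum>a\<in>A. Const (x a) * H a i)"
        by (rule insert.IH) (rule insert.prems, simp)
    qed
    then show ?case by (simp only: sum.insert[OF insert.hyps])
  qed (simp_all only: sum.infinite sum.empty osculates_0 not_False_eq_True)
  moreover have "(\<Sum>a\<in>A. (\<lambda>i. Const (x a) * H a i)) = (\<lambda>i. \<Sum>a\<in>A. Const (x a) * H a i)"
    by (rule ext) (rule sum_fun_apply)
  ultimately show ?thesis by (simp only:)
qed

lemma pairing_jet_form: "i \<in> I \<Longrightarrow> pairing (SOME c. pairing c (p i) = 1) (p i) = 1"
proof -
  assume "i \<in> I"
  then have "p i \<noteq> 0" using separated by (simp add: separated_def)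
  from someI_ex[OF ex_pairing_1[OF this]] show ?thesis .
qed

lemma ex_osculating_jet:
  assumes "homogeneous d D" shows "\<exists>H\<in>jets. osculates D H"
proof -
  have "\<exists>H. homogeneous (m i - 1) H \<and> mult_at_least (m i) (D - jet i H) (p i)" if i: "i \<in> I" for i
  proof -
    let ?c = "SOME c. pairing c (p i) = 1"
    have "homogeneous ((d + 1 - m i) * 1) (lin ?c ^ (d + 1 - m i))"
      by (intro homogeneous_power homogeneous_lin)
    moreover have "eval_at (lin ?c ^ (d + 1 - m i)) (p i) \<noteq> 0"
      using pairing_jet_form[OF i] by simp
    moreover have "d = (d + 1 - m i) * 1 + (m i - 1)" using mult_bounds[OF i] by auto
    moreover have "p i \<noteq> 0" using separated i by (simp add: separated_def)
    ultimately obtain H where H: "homogeneous (m i - 1) H"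
      "mult_at_least (Suc (m i - 1)) (D - lin ?c ^ (d + 1 - m i) * H) (p i)"
      by (rule local_division[OF assms])
    then show ?thesis using mult_bounds[OF i] by (intro exI[of _ H]) (simp add: jet_def)
  qed
  then have "\<forall>i\<in>I. \<exists>H. homogeneous (m i - 1) H \<and> mult_at_least (m i) (D - jet i H) (p i)" by blast
  from bchoice[OF this] obtain H where
    H: "\<forall>i\<in>I. homogeneous (m i - 1) (H i) \<and> mult_at_least (m i) (D - jet i (H i)) (p i)" ..
  show ?thesis
    by (rule bexI[of _ "\<lambda>i. if i \<in> I then H i else 0"]) (use H in \<open>auto simp: osculates_def jets_def\<close>)
qed

lemma osculates_zero_jet:
  assumes "osculates 0 H" "H \<in> jets" shows "H = 0"
proof
  fix i
  show "H i = 0 i"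
  proof (cases "i \<in> I")
    case i: True
    let ?c = "SOME c. pairing c (p i) = 1"
    have "mult_at_least (m i) (0 - jet i (H i)) (p i)"
      using assms(1) i unfolding osculates_def by blast
    from mult_at_least_diff[OF mult_at_least_0 this] have "mult_at_least (0 + m i) (lin ?c ^ (d + 1 - m i) * H i) (p i)"
      by (simp add: jet_def)
    moreover have "mult_exact 0 (lin ?c ^ (d + 1 - m i)) (p i)"
      using pairing_jet_form[OF i] by (simp add: mult_exact_0_iff)
    ultimately have "mult_at_least (m i) (H i) (p i)" by (simp only: mult_cancel)
    moreover have "homogeneous (m i - 1) (H i)" using assms(2) i by (simp add: jets_def)
    moreover have "m i - 1 < m i" using mult_bounds[OF i] by simp
    ultimately show ?thesis by (simp add: mult_exceeds_degree)
  next
    case False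
    then show ?thesis using assms(2) by (simp add: jets_def)
  qed
qed

lemma osculates_0_iff:
  "homogeneous d D \<Longrightarrow> osculates D 0 \<longleftrightarrow> D \<in> linear_system I p d m"
  by (simp add: osculates_def linear_system_def jet_simps)

lemma subspace_jets: "jet_space.subspace jets"
  by (auto simp: jet_space.subspace_def jets_def intro: homogeneous_add homogeneous_Const_mult)

lemma subspace_global_jets: "jet_space.subspace global_jets"
  unfolding jet_space.subspace_def
proof (intro conjI ballI allI)
  show "0 \<in> global_jets"
    using jet_space.subspace_0[OF subspace_jets] osculates_0 homogeneous_0
    unfolding global_jets_iff zero_fun_def by blast
  fix H assume "H \<in> global_jets"
  then obtain D where D: "H \<in> jets" "homogeneous d D" "osculates D H" unfolding global_jets_iff by blast
  show "(\<lambda>i. Const c * H i) \<in> global_jets" for c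
    using jet_space.subspace_scale[OF subspace_jets D(1), of c] homogeneous_Const_mult[OF D(2), of c]
      osculates_scale[OF D(3), of c]
    unfolding global_jets_iff by blast
  fix G assume "G \<in> global_jets"
  then obtain E where E: "G \<in> jets" "homogeneous d E" "osculates E G" unfolding global_jets_iff by blast
  show "H + G \<in> global_jets"
    using jet_space.subspace_add[OF subspace_jets D(1) E(1)] homogeneous_add[OF D(2) E(2)]
      osculates_add[OF D(3) E(3)]
    unfolding global_jets_iff plus_fun_def by blast
qed

lemma dim_jets: "jet_space.dim jets = (\<Sum>i\<in>I. card {t :: 'n \<Rightarrow>\<^sub>0 nat. mon_degree t = m i - 1})"
  "\<exists>T. finite T \<and> jets \<subseteq> jet_space.span T"
proof -
  let ?S = "SIGMA i:I. {t :: 'n \<Rightarrow>\<^sub>0 nat. mon_degree t = m i - 1}"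
  define e where "e s = (\<lambda>k. if k = fst s then Poly_Mapping.single (snd s) (1::complex) else 0)"
    for s :: "'i \<times> ('n \<Rightarrow>\<^sub>0 nat)"
  have fin: "finite ?S" by (intro finite_SigmaI finite_I finite_monomials)
  have coeff: "lookup ((\<Sum>s\<in>?S. (\<lambda>k. Const (x s) * e s k)) i) t = (if (i, t) \<in> ?S then x (i, t) else 0)"
    for x i t
  proof -
    have "lookup ((\<Sum>s\<in>?S. (\<lambda>k. Const (x s) * e s k)) i) t = (\<Sum>s\<in>?S. if s = (i, t) then x s else 0)"
      unfolding sum_fun_apply lookup_sum
      by (rule sum.cong) (auto simp: e_def lookup_single when_def)
    then show ?thesis using fin by simp
  qed
  have "\<forall>s\<in>?S. x s = 0" if "(\<Sum>s\<in>?S. (\<lambda>k. Const (x s) * e s k)) = 0" for x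
  proof
    fix s assume s: "s \<in> ?S"
    then have "lookup ((\<Sum>s\<in>?S. (\<lambda>k. Const (x s) * e s k)) (fst s)) (snd s) = x s"
      unfolding coeff by (simp only: prod.collapse if_True)
    then show "x s = 0" unfolding that by simp
  qed
  note family = jet_space.independent_family[where f = e, OF fin this]
  have sub: "e ` ?S \<subseteq> jets"
    by (auto simp: e_def jets_def homogeneous_def split: if_splits)
  have span: "jets \<subseteq> jet_space.span (e ` ?S)"
  proof
    fix H assume H: "H \<in> jets"
    have "H = (\<Sum>s\<in>?S. (\<lambda>k. Const (lookup (H (fst s)) (snd s)) * e s k))"
    proof (intro ext poly_mapping_eqI)
      fix i t
      have "lookup (H i) t = 0" if "(i, t) \<notin> ?S"
      proof (cases "i \<in> I")
        case True
        then have "homogeneous (m i - 1) (H i)" "mon_degree t \<noteq> m i - 1"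
          using H that by (auto simp: jets_def)
        then show ?thesis by (blast dest: homogeneousD)
      qed (use H in \<open>simp add: jets_def\<close>)
      then show "lookup (H i) t = lookup ((\<Sum>s\<in>?S. (\<lambda>k. Const (lookup (H (fst s)) (snd s)) * e s k)) i) t"
        unfolding coeff by auto
    qed
    also have "\<dots> \<in> jet_space.span (e ` ?S)"
      by (intro jet_space.span_sum jet_space.span_scale jet_space.span_base imageI)
    finally show "H \<in> jet_space.span (e ` ?S)" .
  qed
  show "\<exists>T. finite T \<and> jets \<subseteq> jet_space.span T" using fin span by blast
  have "card (e ` ?S) = jet_space.dim jets"
    by (rule jet_space.basis_card_eq_dim[OF sub span family(2)])
  moreover have "card (e ` ?S) = card ?S" by (rule card_image[OF family(1)])
  moreover have "card ?S = (\<Sum>i\<in>I. card {t :: 'n \<Rightarrow>\<^sub>0 nat. mon_degree t = m i - 1})"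
    by (rule card_SigmaI[OF finite_I]) (intro ballI finite_monomials)
  ultimately show "jet_space.dim jets = (\<Sum>i\<in>I. card {t :: 'n \<Rightarrow>\<^sub>0 nat. mon_degree t = m i - 1})"
    by (metis (no_types))
qed

lemma represents_sum:
  assumes "\<And>a. a \<in> A \<Longrightarrow> represents (h a) (H a)"
  shows "represents (\<Sum>a\<in>A. (\<lambda>f. to_frac (Const (x a)) * h a f)) (\<Sum>a\<in>A. (\<lambda>i. Const (x a) * H a i))"
proof -
  have "represents (\<lambda>f. \<Sum>a\<in>A. to_frac (Const (x a)) * h a f) (\<lambda>i. \<Sum>a\<in>A. Const (x a) * H a i)"
    using assms
  proof (induction A rule: infinite_finite_induct)
    case (insert a A)
    have "represents (\<lambda>f. to_frac (Const (x a)) * h a f + (\<Sum>a\<in>A. to_frac (Const (x a)) * h a f))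
        (\<lambda>i. Const (x a) * H a i + (\<Sum>a\<in>A. Const (x a) * H a i))"
    proof (rule represents_add[OF represents_scale])
      show "represents (h a) (H a)" by (rule insert.prems) simp
      show "represents (\<lambda>f. \<Sum>a\<in>A. to_frac (Const (x a)) * h a f) (\<lambda>i. \<Sum>a\<in>A. Const (x a) * H a i)"
        by (rule insert.IH) (rule insert.prems, simp)
    qed
    then show ?case by (simp only: sum.insert[OF insert.hyps])
  qed (simp_all only: sum.infinite sum.empty represents_0 not_False_eq_True)
  moreover have "(\<Sum>a\<in>A. (\<lambda>i. Const (x a) * H a i)) = (\<lambda>i. \<Sum>a\<in>A. Const (x a) * H a i)"
    by (rule ext) (rule sum_fun_apply)
  moreover have "(\<Sum>a\<in>A. (\<lambda>f. to_frac (Const (x a)) * h a f))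
      = (\<lambda>f. \<Sum>a\<in>A. to_frac (Const (x a)) * h a f)"
    by (rule ext) (rule sum_fun_apply)
  ultimately show ?thesis by (simp only:)
qed

lemma delta_sum:
  "delta (\<Sum>a\<in>A. (\<lambda>f. to_frac (Const (x a)) * h a f))
    = (\<Sum>a\<in>A. (\<lambda>e. to_frac (Const (x a)) * delta (h a) e))"
  by (rule ext) (simp add: delta_def sum_fun_apply sum_subtractf right_diff_distrib)

lemma delta_diff: "delta (\<lambda>f. h f - h' f) = delta h - delta h'"
  by (rule ext) (simp add: delta_def)

lemma represents_diff:
  assumes "represents h H" "represents g G"
  shows "represents (\<lambda>f. h f - g f) (\<lambda>i. H i - G i)"
  using represents_add[OF assms(1) represents_scale[OF assms(2), of "-1"]]
  by (simp add: Const_uminus)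

lemma subspace_coboundaries: "fun_frac.subspace (coboundaries1 I p d m)"
proof -
  have eq: "coboundaries1 I p d m = {delta h | h H. represents h H \<and> H \<in> global_jets}"
  proof (intro antisym subsetI)
    fix g assume g: "g \<in> coboundaries1 I p d m"
    then have "g \<in> cocycles1 I p d m" unfolding coboundaries1_def cocycles1_def by auto
    then obtain h H where h: "H \<in> jets" "represents h H" "g = delta h"
      by (rule cocycle_represented)
    then have "H \<in> global_jets" using global_jet_if_coboundary g by blast
    with h show "g \<in> {delta h | h H. represents h H \<and> H \<in> global_jets}" by blast
  next
    fix g assume "g \<in> {delta h | h H. represents h H \<and> H \<in> global_jets}"
    then show "g \<in> coboundaries1 I p d m" using coboundary_if_global_jet by blast
  qed
  show ?thesis
    unfolding fun_frac.subspace_def eq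
  proof (intro conjI ballI allI)
    have "delta (\<lambda>_. 0) = 0" by (rule ext) (simp add: delta_def)
    moreover have "(\<lambda>_. 0) \<in> global_jets"
      using jet_space.subspace_0[OF subspace_global_jets] by (simp add: zero_fun_def)
    ultimately show "0 \<in> {delta h | h H. represents h H \<and> H \<in> global_jets}"
      using represents_0 by force
  next
    fix x y assume "x \<in> {delta h | h H. represents h H \<and> H \<in> global_jets}"
      "y \<in> {delta h | h H. represents h H \<and> H \<in> global_jets}"
    then obtain h H h' H' where h: "x = delta h" "represents h H" "H \<in> global_jets"
      "y = delta h'" "represents h' H'" "H' \<in> global_jets" by blast
    have "x + y = delta (\<lambda>f. h f + h' f)" unfolding h by (rule ext) (simp add: delta_def)
    moreover have "(\<lambda>i. H i + H' i) \<in> global_jets"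
      using jet_space.subspace_add[OF subspace_global_jets h(3,6)] by (simp add: plus_fun_def)
    ultimately show "x + y \<in> {delta h | h H. represents h H \<and> H \<in> global_jets}"
      using represents_add[OF h(2,5)] by blast
  next
    fix c x assume "x \<in> {delta h | h H. represents h H \<and> H \<in> global_jets}"
    then obtain h H where h: "x = delta h" "represents h H" "H \<in> global_jets" by blast
    have "(\<lambda>e. to_frac (Const c) * x e) = delta (\<lambda>f. to_frac (Const c) * h f)"
      unfolding h by (rule ext) (simp add: delta_def right_diff_distrib)
    then show "(\<lambda>e. to_frac (Const c) * x e) \<in> {delta h | h H. represents h H \<and> H \<in> global_jets}"
      using represents_scale[OF h(2)] jet_space.subspace_scale[OF subspace_global_jets h(3)] by blast
  qed
qed

text \<open>
  The sequence \<open>0 \<rightarrow> L \<rightarrow> S\<^sub>d \<rightarrow> jets \<rightarrow> H\<^sup>1 \<rightarrow> 0\<close>, where \<open>L\<close> is the linear system and \<open>S\<^sub>d\<close> the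
  space of forms of degree \<open>d\<close>, is exact. The proof chooses a basis \<open>BS\<close> of \<open>S\<^sub>d\<close> that extends one
  of \<open>L\<close>, and completes the jets of its remaining elements \<open>C\<close> to a basis of all jets by \<open>W\<close>,
  which represents a basis of \<open>H\<^sup>1\<close>.
\<close>

theorem h1_eq_dim_minus_vdim:
  obtains n where "h1 I p d m = enat n" "int n = int (dim_ls I p d m) - vdim (CARD('n) - 1) I d m"
proof -
  let ?L = "linear_system I p d m"
  let ?S = "{F :: 'n mpoly. homogeneous d F}"
  define M where "M = (\<lambda>t. Poly_Mapping.single t (1::complex)) ` {t :: 'n \<Rightarrow>\<^sub>0 nat. mon_degree t = d}"
  note M = forms_basis[where d = d and 'n = 'n, folded M_def]
  obtain BL where BL: "BL \<subseteq> ?L" "mp.independent BL" "?L \<subseteq> mp.span BL"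
    using mp.maximal_independent_subset[of ?L] by blast
  have LS: "?L \<subseteq> ?S" by (auto simp: linear_system_def)
  then have "BL \<subseteq> ?S" using BL(1) by blast
  from mp.maximal_independent_subset_extend[OF this BL(2)] obtain BS
    where BS: "BL \<subseteq> BS" "BS \<subseteq> ?S" "mp.independent BS" "?S \<subseteq> mp.span BS" by blast
  have finBS: "finite BS"
    using mp.independent_span_bound[OF M(1) BS(3)] BS(2) M(3) by blast
  define C where "C = BS - BL"
  have finC: "finite C" using finBS by (simp add: C_def)
  have "card BL = mp.dim ?L" by (rule mp.basis_card_eq_dim[OF BL(1,3,2)])
  moreover have "card BS = mp.dim ?S" by (rule mp.basis_card_eq_dim[OF BS(2,4,3)])
  moreover have "card M = mp.dim ?S"
    using M(3) mp.span_superset[of M] by (intro mp.basis_card_eq_dim[OF _ _ M(2)]) simp_all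
  moreover have "card BS = card C + card BL"
    using BS(1) finBS unfolding C_def by (simp add: card_Diff_subset finite_subset card_mono)
  ultimately have cardC: "card C + mp.dim ?L = card {t :: 'n \<Rightarrow>\<^sub>0 nat. mon_degree t = d}"
    using M(4) by simp
  have "\<forall>D\<in>?S. \<exists>H. H \<in> jets \<and> osculates D H" using ex_osculating_jet by blast
  from bchoice[OF this] obtain ev where ev: "\<forall>D\<in>?S. ev D \<in> jets \<and> osculates D (ev D)" ..
  have CS: "C \<subseteq> ?S" using BS(2) by (auto simp: C_def)
  have "\<forall>c\<in>C. x c = 0" if x: "(\<Sum>c\<in>C. (\<lambda>i. Const (x c) * ev c i)) = 0" for x
  proof -
    let ?D = "\<Sum>c\<in>C. Const (x c) * c"
    have "osculates ?D (\<Sum>c\<in>C. (\<lambda>i. Const (x c) * ev c i))"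
      using ev CS by (intro osculates_sum) blast
    then have "osculates ?D 0" by (simp only: x)
    moreover have "homogeneous d ?D"
      using CS by (intro homogeneous_sum homogeneous_Const_mult) blast
    ultimately have "?D \<in> ?L" by (simp only: osculates_0_iff)
    then have "?D \<in> mp.span BL" using BL(3) by blast
    moreover have finBL: "finite BL" using BS(1) finBS by (rule finite_subset)
    ultimately obtain y where y: "?D = (\<Sum>b\<in>BL. Const (y b) * b)"
      unfolding mp.span_finite[OF finBL] by blast
    let ?z = "\<lambda>b. if b \<in> C then x b else - y b"
    have "(\<Sum>b\<in>BS. Const (?z b) * b) = (\<Sum>b\<in>C. Const (?z b) * b) + (\<Sum>b\<in>BL. Const (?z b) * b)"
      using BS(1) finBS finBL unfolding C_def by (subst sum.union_disjoint[symmetric]) (auto intro!: sum.cong)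
    also have "(\<Sum>b\<in>C. Const (?z b) * b) = ?D" by (rule sum.cong) simp_all
    also have "(\<Sum>b\<in>BL. Const (?z b) * b) = (\<Sum>b\<in>BL. - (Const (y b) * b))"
      by (rule sum.cong) (auto simp: C_def Const_uminus)
    also have "?D + (\<Sum>b\<in>BL. - (Const (y b) * b)) = 0"
      unfolding sum_negf y by (rule right_minus)
    finally have zero: "(\<Sum>b\<in>BS. Const (?z b) * b) = 0" .
    have "?z b = 0" if "b \<in> BS" for b
      using BS(3) finBS subset_refl zero that by (rule mp.independentD[where u = ?z])
    then have "x b = 0" if "b \<in> C" for b using that by (fastforce simp: C_def)
    then show ?thesis by blast
  qed
  note family = jet_space.independent_family[where f = ev, OF finC this]
  have evC: "ev ` C \<subseteq> jets" using ev CS by blast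
  from jet_space.maximal_independent_subset_extend[OF evC family(2)] obtain W'
    where W': "ev ` C \<subseteq> W'" "W' \<subseteq> jets" "jet_space.independent W'" "jets \<subseteq> jet_space.span W'" by blast
  obtain T where T: "finite T" "jets \<subseteq> jet_space.span T" using dim_jets(2) by blast
  have finW': "finite W'"
    using jet_space.independent_span_bound[OF T(1) W'(3)] W'(2) T(2) by blast
  define W where "W = W' - ev ` C"
  have finW: "finite W" using finW' by (simp add: W_def)
  have "card W' = jet_space.dim jets" by (rule jet_space.basis_card_eq_dim[OF W'(2,4,3)])
  moreover have "card W' = card W + card (ev ` C)"
    using W'(1) finW' unfolding W_def by (simp add: card_Diff_subset finite_subset card_mono)
  ultimately have cardW: "card W + card C = (\<Sum>i\<in>I. card {t :: 'n \<Rightarrow>\<^sub>0 nat. mon_degree t = m i - 1})"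
    using card_image[OF family(1)] dim_jets(1) by simp
  have split: "(\<Sum>w\<in>W'. f w) = (\<Sum>w\<in>W. f w) + (\<Sum>w\<in>ev ` C. f w)" for f :: "_ \<Rightarrow> 'i \<Rightarrow> 'n mpoly"
    using W'(1) finW' unfolding W_def by (simp add: sum.subset_diff add.commute)
  have global: "(\<Sum>w\<in>ev ` C. (\<lambda>i. Const (x w) * w i)) \<in> global_jets" for x
  proof (intro jet_space.subspace_sum[OF subspace_global_jets] jet_space.subspace_scale[OF subspace_global_jets])
    fix w assume "w \<in> ev ` C"
    then show "w \<in> global_jets" using ev CS unfolding global_jets_iff by blast
  qed
  have global_span: "H \<in> jet_space.span (ev ` C)" if H: "H \<in> global_jets" for H
  proof -
    obtain D where D: "H \<in> jets" "D \<in> ?S" "osculates D H" using H unfolding global_jets_iff by blast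
    have "D \<in> mp.span BS" using D(2) BS(4) by blast
    then obtain x where x: "D = (\<Sum>b\<in>BS. Const (x b) * b)"
      unfolding mp.span_finite[OF finBS] by blast
    let ?E = "\<Sum>b\<in>BL. Const (x b) * b"
    let ?G = "\<Sum>c\<in>C. (\<lambda>i. Const (x c) * ev c i)"
    have "D = (\<Sum>b\<in>C. Const (x b) * b) + ?E"
      unfolding x C_def using BS(1) finBS by (simp add: sum.subset_diff)
    moreover have "osculates (\<Sum>c\<in>C. Const (x c) * c) ?G"
      using ev CS by (intro osculates_sum) blast
    moreover have "osculates ?E 0"
    proof -
      have "?E \<in> ?L" using BL(1) by (intro mp.subspace_sum[OF subspace_linear_system]
        mp.subspace_scale[OF subspace_linear_system]) blast
      then show ?thesis using linear_systemD(1) osculates_0_iff by blast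
    qed
    ultimately have "osculates D ?G"
      using osculates_add[of "\<Sum>c\<in>C. Const (x c) * c" ?G ?E 0] by simp
    then have "osculates (D + Const (- 1) * D) (\<lambda>i. H i + Const (- 1) * ?G i)"
      using D(3) by (intro osculates_add osculates_scale)
    then have "osculates 0 (H - ?G)" by (simp add: Const_uminus fun_diff_def)
    moreover have "?G \<in> jets"
      using ev CS by (intro jet_space.subspace_sum[OF subspace_jets] jet_space.subspace_scale[OF subspace_jets]) blast
    then have "H - ?G \<in> jets" using D(1) jet_space.subspace_diff[OF subspace_jets] by blast
    ultimately have "H - ?G = 0" by (rule osculates_zero_jet)
    then have "H = ?G" by simp
    also have "?G \<in> jet_space.span (ev ` C)"
      by (intro jet_space.span_sum jet_space.span_scale jet_space.span_base imageI)
    finally show ?thesis .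
  qed
  have "\<forall>w\<in>W. \<exists>h. represents h w" using W'(2) ex_represents unfolding W_def by blast
  from bchoice[OF this] obtain h where h: "\<forall>w\<in>W. represents (h w) w" ..
  have rep: "represents (\<Sum>w\<in>W. (\<lambda>f. to_frac (Const (x w)) * h w f)) (\<Sum>w\<in>W. (\<lambda>i. Const (x w) * w i))" for x
    by (rule represents_sum) (use h in blast)
  have W_jets: "(\<Sum>w\<in>W. (\<lambda>i. Const (x w) * w i)) \<in> jets" for x
    using W'(2) by (intro jet_space.subspace_sum[OF subspace_jets] jet_space.subspace_scale[OF subspace_jets])
      (auto simp: W_def)
  have "h1 I p d m = enat (card W)"
    unfolding h1_def
  proof (rule quotient_dim_eq[OF fun_frac.vector_space_axioms subspace_coboundaries finW, where g = "\<lambda>w. delta (h w)"])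
    show "delta (h w) \<in> cocycles1 I p d m" if "w \<in> W" for w
      using h that by (intro delta_cocycle) blast
  next
    fix z assume "z \<in> cocycles1 I p d m"
    then obtain g H where g: "H \<in> jets" "represents g H" "z = delta g" by (rule cocycle_represented)
    then have "H \<in> jet_space.span W'" using W'(4) by blast
    then obtain x where x: "H = (\<Sum>w\<in>W'. (\<lambda>i. Const (x w) * w i))"
      unfolding jet_space.span_finite[OF finW'] by blast
    let ?HW = "\<Sum>w\<in>W. (\<lambda>i. Const (x w) * w i)"
    let ?hW = "\<Sum>w\<in>W. (\<lambda>f. to_frac (Const (x w)) * h w f)"
    have "H - ?HW = (\<Sum>w\<in>ev ` C. (\<lambda>i. Const (x w) * w i))"
      unfolding x split by (rule add_diff_cancel_left')
    then have "H - ?HW \<in> global_jets" using global[of x] by (simp only:)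
    moreover have "represents (\<lambda>f. g f - ?hW f) (H - ?HW)"
      using represents_diff[OF g(2) rep[of x]] by (simp add: fun_diff_def)
    ultimately have "delta (\<lambda>f. g f - ?hW f) \<in> coboundaries1 I p d m" by (rule coboundary_if_global_jet)
    then have "z - (\<Sum>w\<in>W. (\<lambda>e. to_frac (Const (x w)) * delta (h w) e)) \<in> coboundaries1 I p d m"
      by (simp only: delta_diff delta_sum g(3))
    then show "\<exists>c. z - (\<Sum>w\<in>W. (\<lambda>e. to_frac (Const (c w)) * delta (h w) e)) \<in> coboundaries1 I p d m" by blast
  next
    fix x assume "(\<Sum>w\<in>W. (\<lambda>e. to_frac (Const (x w)) * delta (h w) e)) \<in> coboundaries1 I p d m"
    then have "(\<Sum>w\<in>W. (\<lambda>i. Const (x w) * w i)) \<in> global_jets"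
      using global_jet_if_coboundary[OF W_jets rep] by (simp only: delta_sum)
    from global_span[OF this] obtain y
      where y: "(\<Sum>w\<in>W. (\<lambda>i. Const (x w) * w i)) = (\<Sum>w\<in>ev ` C. (\<lambda>i. Const (y w) * w i))"
      unfolding jet_space.span_finite[OF finite_imageI[OF finC]] by blast
    let ?z = "\<lambda>w. if w \<in> W then x w else - y w"
    have "(\<Sum>w\<in>W'. (\<lambda>i. Const (?z w) * w i))
        = (\<Sum>w\<in>W. (\<lambda>i. Const (?z w) * w i)) + (\<Sum>w\<in>ev ` C. (\<lambda>i. Const (?z w) * w i))"
      by (rule split)
    also have "(\<Sum>w\<in>W. (\<lambda>i. Const (?z w) * w i)) = (\<Sum>w\<in>W. (\<lambda>i. Const (x w) * w i))"
      by (rule sum.cong) simp_all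
    also have "(\<Sum>w\<in>ev ` C. (\<lambda>i. Const (?z w) * w i)) = (\<Sum>w\<in>ev ` C. - (\<lambda>i. Const (y w) * w i))"
      by (rule sum.cong) (auto simp: W_def Const_uminus fun_eq_iff)
    also have "(\<Sum>w\<in>W. (\<lambda>i. Const (x w) * w i)) + (\<Sum>w\<in>ev ` C. - (\<lambda>i. Const (y w) * w i)) = 0"
      unfolding sum_negf y by (rule right_minus)
    finally have zero: "(\<Sum>w\<in>W'. (\<lambda>i. Const (?z w) * w i)) = 0" .
    have "?z w = 0" if "w \<in> W'" for w
      using W'(3) finW' subset_refl zero that by (rule jet_space.independentD[where u = ?z])
    then have "x w = 0" if "w \<in> W" for w using that by (fastforce simp: W_def)
    then show "\<forall>w\<in>W. x w = 0" by blast
  qed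
  moreover have "int (card W) = int (dim_ls I p d m) - vdim (CARD('n) - 1) I d m"
  proof -
    have "card {t :: 'n \<Rightarrow>\<^sub>0 nat. mon_degree t = k} = (CARD('n) - 1 + k) choose (CARD('n) - 1)" for k
      unfolding card_monomials using binomial_symmetric[of k "k + CARD('n) - 1"] dimension
      by (simp add: add.commute)
    moreover have "CARD('n) - 1 + (m i - 1) = CARD('n) - 1 + m i - 1" if "i \<in> I" for i
      using mult_bounds[OF that] by simp
    ultimately show ?thesis
      using cardW cardC unfolding vdim_def dim_ls_def by (simp flip: of_nat_sum)
  qed
  ultimately show ?thesis by (rule that)
qed

end

section \<open>Multiplicities under substitution\<close>

lemma mult_substitute:
  fixes x :: "'n::finite \<Rightarrow> 'k::finite mpoly"
  assumes F: "mult_at_least k F v" and x: "\<And>j. eval_at (x j) u = v $ j"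
  shows "mult_at_least k (substitute Const x F) u"
proof -
  define y where "y j = shift u (x j) - Const (v $ j)" for j
  have low: "low 1 (y j)" for j
  proof -
    have "mult_at_least 1 (x j - Const (v $ j)) u"
      unfolding mult_at_least_1_iff by (simp add: x)
    then show ?thesis by (simp add: mult_at_least_shift y_def)
  qed
  have "shift u (substitute Const x F) = substitute Const (\<lambda>j. shift u (x j)) F"
    unfolding shift_def by (rule Csub.substitute_substitute)
  also have "(\<lambda>j. shift u (x j)) = (\<lambda>j. Const (v $ j) + y j)" by (simp add: y_def)
  also have "substitute Const \<dots> F = substitute Const y (shift v F)"
    unfolding shift_def by (simp add: Csub.substitute_substitute)
  finally show ?thesis
    using F low_substitute[of k "shift v F" y] low by (simp add: mult_at_least_shift)
qed

interpretation polysub: scalar_hom "\<lambda>c. [:c:]"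
  by unfold_locales (simp_all add: one_pCons)

text \<open>
  Along a parametrized curve through \<open>v\<close>, multiplicity becomes the order of a root.
\<close>

lemma mult_restrict_to_curve:
  fixes x :: "'n::finite \<Rightarrow> complex poly"
  assumes F: "mult_at_least k F v" and x: "\<And>j. poly (x j) u = v $ j"
  shows "[:- u, 1:] ^ k dvd substitute (\<lambda>c. [:c:]) x F"
proof -
  define y where "y j = x j - [:v $ j:]" for j
  have y: "[:- u, 1:] dvd y j" for j
    using x[of j] by (simp add: y_def poly_eq_0_iff_dvd[symmetric])
  have mon: "[:- u, 1:] ^ mon_degree t dvd eval_mon y t" for t
  proof -
    have "[:- u, 1:] ^ (\<Sum>j\<in>A. lookup t j) dvd (\<Prod>j\<in>A. y j ^ lookup t j)" for A
    proof (induction A rule: infinite_finite_induct)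
      case (insert j A)
      have "[:- u, 1:] ^ lookup t j * [:- u, 1:] ^ (\<Sum>j\<in>A. lookup t j)
          dvd y j ^ lookup t j * (\<Prod>j\<in>A. y j ^ lookup t j)"
        by (intro mult_dvd_mono dvd_power_same y insert.IH)
      then show ?case
        by (simp only: sum.insert[OF insert.hyps] prod.insert[OF insert.hyps] power_add)
    qed simp_all
    then show ?thesis by (simp add: mon_degree_def eval_mon_def)
  qed
  have "x = (\<lambda>j. [:v $ j:] + y j)" by (simp add: y_def)
  then have "substitute (\<lambda>c. [:c:]) x F = substitute (\<lambda>c. [:c:]) y (shift v F)"
    by (simp add: shift_def polysub.substitute_substitute)
  moreover have "[:- u, 1:] ^ k dvd [:lookup (shift v F) t:] * eval_mon y t" if "t \<in> keys (shift v F)" for t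
  proof -
    have "k \<le> mon_degree t" using F that by (simp add: mult_at_least_def shift_def)
    then have "[:- u, 1:] ^ k dvd eval_mon y t" using mon[of t] by (rule power_le_dvd[rotated])
    then show ?thesis by (rule dvd_mult)
  qed
  ultimately show ?thesis unfolding substitute_alt by (simp only: dvd_sum)
qed

section \<open>Division by a monic quadratic binomial\<close>

definition weight_le :: "(('v \<Rightarrow>\<^sub>0 nat) \<Rightarrow> nat) \<Rightarrow> nat \<Rightarrow> 'v mpoly \<Rightarrow> bool" where
  "weight_le wt n F \<longleftrightarrow> (\<forall>t\<in>keys F. wt t \<le> n)"

lemma divide_monomial_by_binomial:
  fixes wt :: "('v \<Rightarrow>\<^sub>0 nat) \<Rightarrow> nat"
  assumes \<mu>: "lookup \<mu> j = 0" and wt: "\<And>s t. wt (s + t) = wt s + wt t"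
    and le: "wt \<mu> \<le> wt (Poly_Mapping.single j 2)" and n: "wt t \<le> n"
  shows "\<exists>G R. Poly_Mapping.single t 1 = (Var j ^ 2 - Poly_Mapping.single \<mu> 1) * G + R \<and>
    (\<forall>s\<in>keys G. wt s + wt (Poly_Mapping.single j 2) \<le> n) \<and> weight_le wt n R \<and>
    (\<forall>s\<in>keys R. lookup s j \<le> 1)"
  using n
proof (induction "lookup t j" arbitrary: t rule: less_induct)
  case less
  show ?case
  proof (cases "lookup t j \<le> 1")
    case True
    then show ?thesis using less.prems
      by (intro exI[of _ 0] exI[of _ "Poly_Mapping.single t 1"]) (auto simp: weight_le_def)
  next
    case False
    define t' where "t' = t - Poly_Mapping.single j 2"
    have t: "t = Poly_Mapping.single j 2 + t'"
      using False by (auto simp: t'_def poly_mapping_eq_iff lookup_add lookup_minus lookup_single when_def fun_eq_iff)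
    have "lookup (\<mu> + t') j < lookup t j" using \<mu> by (simp add: t lookup_add)
    moreover have "wt (\<mu> + t') \<le> n" using less.prems le by (simp add: t wt)
    ultimately obtain G R where GR: "Poly_Mapping.single (\<mu> + t') 1 = (Var j ^ 2 - Poly_Mapping.single \<mu> 1) * G + R"
      "\<forall>s\<in>keys G. wt s + wt (Poly_Mapping.single j 2) \<le> n" "weight_le wt n R" "\<forall>s\<in>keys R. lookup s j \<le> 1"
      using less.hyps by blast
    have "Var j ^ 2 = Poly_Mapping.single (Poly_Mapping.single j 2) (1::complex)"
      by (simp add: Var_def power2_eq_square mult_single single_add[symmetric] numeral_2_eq_2)
    then have "Poly_Mapping.single t 1 = Var j ^ 2 * Poly_Mapping.single t' (1::complex)"
      by (simp add: t mult_single)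
    also have "\<dots> = (Var j ^ 2 - Poly_Mapping.single \<mu> 1) * Poly_Mapping.single t' 1
        + Poly_Mapping.single (\<mu> + t') 1"
      by (simp add: left_diff_distrib mult_single)
    also have "\<dots> = (Var j ^ 2 - Poly_Mapping.single \<mu> 1) * (Poly_Mapping.single t' 1 + G) + R"
      by (simp only: GR(1) distrib_left add.assoc)
    finally have "Poly_Mapping.single t 1 = (Var j ^ 2 - Poly_Mapping.single \<mu> 1) * (Poly_Mapping.single t' 1 + G) + R" .
    moreover have "\<forall>s\<in>keys (Poly_Mapping.single t' 1 + G). wt s + wt (Poly_Mapping.single j 2) \<le> n"
      using Poly_Mapping.keys_add[of "Poly_Mapping.single t' (1::complex)" G] GR(2) less.prems
      by (auto simp: t wt add.commute dest!: subsetD)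
    ultimately show ?thesis using GR(3,4) by blast
  qed
qed

text \<open>
  Division with remainder by \<open>X\<^sub>j\<^sup>2 - \<mu>\<close>, where the monomial \<open>\<mu>\<close> does not contain \<open>X\<^sub>j\<close>, does not
  increase any weight for which \<open>\<mu>\<close> is not heavier than \<open>X\<^sub>j\<^sup>2\<close>.
\<close>

lemma divide_by_binomial:
  fixes F :: "'v mpoly"
  assumes \<mu>: "lookup \<mu> j = 0" and wt: "\<And>s t. wt (s + t) = wt s + wt t"
    and le: "wt \<mu> \<le> wt (Poly_Mapping.single j 2)" and F: "weight_le wt n F"
  obtains G R where "F = (Var j ^ 2 - Poly_Mapping.single \<mu> 1) * G + R"
    "\<And>s. s \<in> keys G \<Longrightarrow> wt s + wt (Poly_Mapping.single j 2) \<le> n" "weight_le wt n R"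
    "\<And>s. s \<in> keys R \<Longrightarrow> lookup s j \<le> 1"
proof -
  have "\<forall>t\<in>keys F. \<exists>GR. Poly_Mapping.single t 1 = (Var j ^ 2 - Poly_Mapping.single \<mu> 1) * fst GR + snd GR \<and>
    (\<forall>s\<in>keys (fst GR). wt s + wt (Poly_Mapping.single j 2) \<le> n) \<and> weight_le wt n (snd GR) \<and>
    (\<forall>s\<in>keys (snd GR). lookup s j \<le> 1)"
  proof
    fix t assume "t \<in> keys F"
    then have "wt t \<le> n" using F by (simp add: weight_le_def)
    from divide_monomial_by_binomial[where wt = wt, OF \<mu> wt le this]
    show "\<exists>GR. Poly_Mapping.single t 1 = (Var j ^ 2 - Poly_Mapping.single \<mu> 1) * fst GR + snd GR \<and>
      (\<forall>s\<in>keys (fst GR). wt s + wt (Poly_Mapping.single j 2) \<le> n) \<and> weight_le wt n (snd GR) \<and>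
      (\<forall>s\<in>keys (snd GR). lookup s j \<le> 1)" by fastforce
  qed
  from bchoice[OF this] obtain D where D:
    "\<And>t. t \<in> keys F \<Longrightarrow> Poly_Mapping.single t 1 = (Var j ^ 2 - Poly_Mapping.single \<mu> 1) * fst (D t) + snd (D t)"
    "\<And>t s. t \<in> keys F \<Longrightarrow> s \<in> keys (fst (D t)) \<Longrightarrow> wt s + wt (Poly_Mapping.single j 2) \<le> n"
    "\<And>t s. t \<in> keys F \<Longrightarrow> s \<in> keys (snd (D t)) \<Longrightarrow> wt s \<le> n"
    "\<And>t s. t \<in> keys F \<Longrightarrow> s \<in> keys (snd (D t)) \<Longrightarrow> lookup s j \<le> 1"
    unfolding weight_le_def by blast
  let ?G = "\<Sum>t\<in>keys F. Const (lookup F t) * fst (D t)"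
  let ?R = "\<Sum>t\<in>keys F. Const (lookup F t) * snd (D t)"
  have keys: "\<exists>t\<in>keys F. s \<in> keys (H t)" if "s \<in> keys (\<Sum>t\<in>keys F. Const (lookup F t) * H t)" for s H
  proof (rule ccontr)
    assume "\<not> ?thesis"
    then have "\<forall>t\<in>keys F. lookup (H t) s = 0" by (simp add: in_keys_iff)
    then have "lookup (\<Sum>t\<in>keys F. Const (lookup F t) * H t) s = 0"
      unfolding lookup_sum lookup_Const_mult by (intro sum.neutral) simp
    with that show False by (simp add: in_keys_iff)
  qed
  have "F = (\<Sum>t\<in>keys F. Const (lookup F t) * Poly_Mapping.single t 1)"
    by (subst (1) mpoly_expand) (simp add: Const_def mult_single)
  also have "\<dots> = (\<Sum>t\<in>keys F. Const (lookup F t) * ((Var j ^ 2 - Poly_Mapping.single \<mu> 1) * fst (D t) + snd (D t)))"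
    by (rule sum.cong) (simp_all only: D(1))
  also have "\<dots> = (Var j ^ 2 - Poly_Mapping.single \<mu> 1) * ?G + ?R"
    by (simp only: distrib_left sum.distrib sum_distrib_left mult.left_commute)
  finally have "F = (Var j ^ 2 - Poly_Mapping.single \<mu> 1) * ?G + ?R" .
  moreover have "wt s + wt (Poly_Mapping.single j 2) \<le> n" if "s \<in> keys ?G" for s
    using keys[OF that] D(2) by blast
  moreover have "weight_le wt n ?R" unfolding weight_le_def using keys[of _ "\<lambda>t. snd (D t)"] D(3) by blast
  moreover have "lookup s j \<le> 1" if "s \<in> keys ?R" for s using keys[OF that] D(4) by blast
  ultimately show ?thesis by (rule that)
qed

section \<open>Polynomials with roots at positive points\<close>

lemma prod_linear_powers_dvd:
  fixes p :: "complex poly"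
  assumes "finite S" "\<And>a. a \<in> S \<Longrightarrow> [:- a, 1:] ^ b dvd p"
  shows "(\<Prod>a\<in>S. [:- a, 1:] ^ b) dvd p"
  using assms
proof (induction S rule: finite_induct)
  case (insert a S)
  then obtain q where q: "p = (\<Prod>a\<in>S. [:- a, 1:] ^ b) * q" by (metis dvdE insertCI)
  have "poly (\<Prod>a\<in>S. [:- a, 1:] ^ b) a \<noteq> 0"
    using insert.hyps by (auto simp: poly_prod)
  then have ord: "order a (\<Prod>a\<in>S. [:- a, 1:] ^ b) = 0" by (rule order_0I)
  have "[:- a, 1:] ^ b dvd q"
  proof (cases "p = 0")
    case True
    then have "q = 0" using q insert.hyps by auto
    then show ?thesis by simp
  next
    case False
    have "b \<le> order a p" using insert.prems[of a] False by (simp add: order_divides)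
    also have "\<dots> = order a q" using False ord unfolding q by (subst order_mult) auto
    finally show ?thesis by (meson order_1 power_le_dvd)
  qed
  then have "[:- a, 1:] ^ b * (\<Prod>a\<in>S. [:- a, 1:] ^ b) dvd q * (\<Prod>a\<in>S. [:- a, 1:] ^ b)"
    by (rule mult_dvd_mono) simp
  then show ?case using insert.hyps q by (simp add: mult.commute)
qed simp

lemma coeffs_prod_linear:
  fixes a :: "'i \<Rightarrow> complex"
  assumes "finite S" "\<And>i. i \<in> S \<Longrightarrow> a i \<noteq> 0"
  shows "coeff (\<Prod>i\<in>S. [:- a i, 1:]) 0 \<noteq> 0 \<and>
    coeff (\<Prod>i\<in>S. [:- a i, 1:]) 1 = - coeff (\<Prod>i\<in>S. [:- a i, 1:]) 0 * (\<Sum>i\<in>S. 1 / a i)"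
  using assms
proof (induction S rule: finite_induct)
  case (insert i S)
  let ?P = "\<Prod>i\<in>S. [:- a i, 1:]"
  have IH: "coeff ?P 0 \<noteq> 0" "coeff ?P 1 = - coeff ?P 0 * (\<Sum>i\<in>S. 1 / a i)" using insert by auto
  have c: "coeff ([:- a i, 1:] * ?P) 0 = - a i * coeff ?P 0"
    "coeff ([:- a i, 1:] * ?P) 1 = coeff ?P 0 - a i * coeff ?P 1"
    by (simp_all add: coeff_pCons)
  have "a i \<noteq> 0" using insert.prems by simp
  then show ?case
    unfolding prod.insert[OF insert.hyps] sum.insert[OF insert.hyps] c
    using IH by (simp add: field_simps)
qed simp

text \<open>
  The degree forces such a polynomial to be a multiple of the product of its prescribed linear
  factors, whose linear coefficient does not vanish because all roots are positive.
\<close>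

lemma positive_roots_no_linear_term:
  fixes p :: "complex poly" and S :: "nat set"
  assumes S: "finite S" "S \<noteq> {}" "0 \<notin> S" and b: "b > 0"
    and roots: "\<And>i. i \<in> S \<Longrightarrow> [:- of_nat i, 1:] ^ b dvd p"
    and deg: "degree p \<le> card S * b" and coeff: "coeff p 1 = 0"
  shows "p = 0"
proof (rule ccontr)
  assume "p \<noteq> 0"
  let ?A = "S \<times> {..<b}"
  let ?P = "\<Prod>x\<in>?A. [:- of_nat (fst x), 1:] :: complex poly"
  have inj: "inj_on (of_nat :: nat \<Rightarrow> complex) S" by (simp add: inj_on_def)
  have P: "?P = (\<Prod>a\<in>of_nat ` S. [:- a, 1:] ^ b)"
    by (simp add: prod.reindex[OF inj] prod.cartesian_product[symmetric] case_prod_unfold[symmetric])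
      (simp add: prod.cartesian_product[of "\<lambda>i _. [:- of_nat i, 1:]", symmetric, unfolded case_prod_unfold])
  have "?P dvd p"
    unfolding P using S roots by (intro prod_linear_powers_dvd) auto
  then obtain q where q: "p = ?P * q" by (rule dvdE)
  have fin: "finite ?A" using S by simp
  have "?P \<noteq> 0" using fin by (subst prod_zero_iff) auto
  have "degree ?P = card S * b" by (simp add: degree_prod_sum_eq card_cartesian_product)
  moreover have "degree p = degree ?P + degree q"
    using \<open>p \<noteq> 0\<close> q by (metis degree_mult_eq mult_zero_left mult_zero_right)
  ultimately have "degree q = 0" using deg by simp
  then obtain c where "q = [:c:]" by (rule degree_eq_zeroE)
  then have c: "p = smult c ?P" "c \<noteq> 0" using q \<open>p \<noteq> 0\<close> by auto
  have pos: "fst x \<noteq> 0" if "x \<in> ?A" for x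
  proof -
    have "fst x \<in> S" using that by auto
    then show ?thesis using S(3) by metis
  qed
  then have "of_nat (fst x) \<noteq> (0::complex)" if "x \<in> ?A" for x using that by simp
  from coeffs_prod_linear[OF fin this]
  have P01: "coeff ?P 0 \<noteq> 0" "coeff ?P 1 = - coeff ?P 0 * (\<Sum>x\<in>?A. 1 / of_nat (fst x))" by auto
  have "(\<Sum>x\<in>?A. 1 / of_nat (fst x) :: complex) = of_real (\<Sum>x\<in>?A. 1 / real (fst x))" by simp
  moreover have "(\<Sum>x\<in>?A. 1 / real (fst x)) > 0"
  proof (rule sum_pos[OF fin])
    show "?A \<noteq> {}" using S(2) b by auto
    show "1 / real (fst x) > 0" if "x \<in> ?A" for x using pos[OF that] by simp
  qed
  ultimately have "(\<Sum>x\<in>?A. 1 / of_nat (fst x) :: complex) \<noteq> 0" by (metis less_irrefl of_real_eq_0_iff)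
  then have "coeff ?P 1 \<noteq> 0" using P01 by simp
  then show False using coeff c by simp
qed

section \<open>Eight points on a cuspidal quartic\<close>

definition quadric0 :: "4 mpoly" where
  "quadric0 = Var 2 ^ 2 - Poly_Mapping.single (Poly_Mapping.single 1 1 + Poly_Mapping.single 4 1) 1"

definition quadric1 :: "4 mpoly" where
  "quadric1 = Var 3 ^ 2 - Poly_Mapping.single (Poly_Mapping.single 2 1 + Poly_Mapping.single 4 1) 1"

definition curve :: "nat \<Rightarrow> complex ^ 4" where
  "curve i = (\<chi> j. if j = 1 then 1 else if j = 2 then of_nat i ^ 2 else if j = 3 then of_nat i ^ 3
     else of_nat i ^ 4)"

text \<open>
  Eight points of a quartic curve with a cusp at \<open>(1, 0, 0, 0)\<close>, the complete intersection of the two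
  quadrics, and one point where only \<open>quadric1\<close> vanishes.
\<close>

definition special_points :: "nat \<Rightarrow> complex ^ 4" where
  "special_points i = (if i = 9 then axis 2 1 else curve i)"

lemma distinct_4 [simp]: "(1::4) \<noteq> 2" "(1::4) \<noteq> 3" "(1::4) \<noteq> 4" "(2::4) \<noteq> 1" "(2::4) \<noteq> 3" "(2::4) \<noteq> 4"
  "(3::4) \<noteq> 1" "(3::4) \<noteq> 2" "(3::4) \<noteq> 4" "(4::4) \<noteq> 1" "(4::4) \<noteq> 2" "(4::4) \<noteq> 3"
  by auto

lemma quadrics_Var: "quadric0 = Var 2 ^ 2 - Var 1 * Var 4" "quadric1 = Var 3 ^ 2 - Var 2 * Var 4"
  by (simp_all add: quadric0_def quadric1_def Var_def mult_single)

lemma homogeneous_quadrics: "homogeneous 2 quadric0" "homogeneous 2 quadric1"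
proof -
  have "homogeneous (1 + 1) (Var i * Var j :: 4 mpoly)" for i j
    by (intro homogeneous_mult homogeneous_Var)
  then show "homogeneous 2 quadric0" "homogeneous 2 quadric1"
    unfolding quadrics_Var power2_eq_square one_add_one by (intro homogeneous_diff; blast)+
qed

lemma prod_4: "prod f (UNIV :: 4 set) = f 1 * f 2 * f 3 * f 4"
  unfolding UNIV_4 by (simp add: ac_simps)

lemma eval_mon_4: "eval_mon x t = x 1 ^ lookup t 1 * x 2 ^ lookup t 2 * x 3 ^ lookup t 3 * x 4 ^ lookup t 4"
  for t :: "4 \<Rightarrow>\<^sub>0 nat"
  using eval_mon_superset[of UNIV t x] by (simp add: prod_4)

lemma mon_degree_4: "mon_degree t = lookup t 1 + lookup t 2 + lookup t 3 + lookup t 4" for t :: "4 \<Rightarrow>\<^sub>0 nat"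
  by (simp add: mon_degree_UNIV sum_4)

lemma eval_mon_bool: "eval_mon x t = x False ^ lookup t False * x True ^ lookup t True"
  for t :: "bool \<Rightarrow>\<^sub>0 nat"
  using eval_mon_superset[of UNIV t x, OF _ subset_UNIV] by (simp add: UNIV_bool)

text \<open>
  The cone \<open>quadric0 = 0\<close> is the image of the plane with coordinates \<open>u, z\<close> under
  \<open>(1, u, z, u\<^sup>2)\<close>; the curve becomes the cuspidal cubic \<open>z\<^sup>2 = u\<^sup>3\<close>.
\<close>

definition to_cone :: "4 \<Rightarrow> bool mpoly" where
  "to_cone j = (if j = 1 then 1 else if j = 2 then Var False else if j = 3 then Var True else Var False ^ 2)"

definition cuspidal_cubic :: "bool mpoly" where
  "cuspidal_cubic = Var True ^ 2 - Poly_Mapping.single (Poly_Mapping.single False 3) 1"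

definition cubic_point :: "nat \<Rightarrow> complex ^ bool" where
  "cubic_point i = (\<chi> b. if b then of_nat i ^ 3 else of_nat i ^ 2)"

text \<open>
  The parametrization of the cuspidal cubic by \<open>(t\<^sup>2, t\<^sup>3)\<close>, under which no monomial becomes \<open>t\<close>.
\<close>

definition to_normalization :: "bool \<Rightarrow> complex poly" where
  "to_normalization b = (if b then [:0, 0, 0, 1:] else [:0, 0, 1:])"

text \<open>
  Restricted to the cone, a form of degree \<open>d\<close> has weight at most \<open>2 d\<close>.
\<close>

definition cone_weight :: "(bool \<Rightarrow>\<^sub>0 nat) \<Rightarrow> nat" where
  "cone_weight t = lookup t False + 2 * lookup t True"

lemma cone_weight_add: "cone_weight (s + t) = cone_weight s + cone_weight t"
  by (simp add: cone_weight_def lookup_add)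

lemma bool_mon: "Var False ^ k * Var True ^ l
    = (Poly_Mapping.single (Poly_Mapping.single False k + Poly_Mapping.single True l) 1 :: bool mpoly)"
proof -
  have "Poly_Mapping.single t (1::complex) = eval_mon Var t" for t :: "bool \<Rightarrow>\<^sub>0 nat"
    by (simp add: eval_mon_Var)
  then show ?thesis by (simp add: eval_mon_bool lookup_add lookup_single when_def)
qed

lemma cuspidal_cubic_Var: "cuspidal_cubic = Var True ^ 2 - Var False ^ 3"
  using bool_mon[of 3 0] by (simp add: cuspidal_cubic_def)

lemma to_normalization_monom: "to_normalization False = monom 1 2" "to_normalization True = monom 1 3"
  by (simp_all add: to_normalization_def monom_altdef power2_eq_square power3_eq_cube)

lemma normalization_mon:
  "eval_mon to_normalization t = monom 1 (2 * lookup t False + 3 * lookup t True)"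
  unfolding eval_mon_bool to_normalization_monom monom_power mult_monom by simp

lemma coeff_normalization:
  "coeff (substitute (\<lambda>c. [:c:]) to_normalization F) n
    = (\<Sum>t\<in>keys F. if 2 * lookup t False + 3 * lookup t True = n then lookup F t else 0)"
  unfolding substitute_alt normalization_mon
  by (simp add: coeff_sum) (rule sum.cong; simp)

lemma cubic_exact:
  assumes "i > 0" shows "mult_exact 1 cuspidal_cubic (cubic_point i)"
  unfolding mult_exact_def
proof
  show "mult_at_least 1 cuspidal_cubic (cubic_point i)"
    unfolding mult_at_least_1_iff by (simp add: cuspidal_cubic_Var cubic_point_def power_mult[symmetric])
  show "\<not> mult_at_least (Suc 1) cuspidal_cubic (cubic_point i)"
  proof
    let ?x = "\<lambda>b. if b then [:of_nat i ^ 3, 1:] else [:of_nat i ^ 2 :: complex:]"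
    assume "mult_at_least (Suc 1) cuspidal_cubic (cubic_point i)"
    then have "[:- 0, 1:] ^ Suc 1 dvd substitute (\<lambda>c. [:c:]) ?x cuspidal_cubic"
      by (rule mult_restrict_to_curve) (simp add: cubic_point_def)
    then obtain q where "substitute (\<lambda>c. [:c:]) ?x cuspidal_cubic = [:- 0, 1:] ^ Suc 1 * q" by (rule dvdE)
    then have "coeff (substitute (\<lambda>c. [:c:]) ?x cuspidal_cubic) 1 = 0" by simp
    moreover have "coeff (substitute (\<lambda>c. [:c:]) ?x cuspidal_cubic) 1 = 2 * of_nat i ^ 3"
      by (simp add: cuspidal_cubic_Var power2_eq_square power3_eq_cube)
    ultimately show False using assms by simp
  qed
qed

text \<open>
  Modulo the cubic, \<open>f\<close> is a polynomial in \<open>t\<close> of degree at most \<open>8 b\<close> without linear term, with eight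
  positive roots of order \<open>b\<close>. So it is zero, and \<open>f\<close> is divisible by the cubic, which passes simply
  through the points.
\<close>

lemma cuspidal_cubic_system:
  assumes f: "weight_le cone_weight (4 * b) f"
    and mult: "\<And>i. i \<in> {1..8} \<Longrightarrow> mult_at_least b f (cubic_point i)"
  shows "\<exists>a. f = Const a * cuspidal_cubic ^ b"
  using assms
proof (induction b arbitrary: f)
  case 0
  have "t = 0" if "t \<in> keys f" for t
    using 0(1) that by (auto simp: weight_le_def cone_weight_def poly_mapping_eq_iff fun_eq_iff all_bool_eq)
  then have "f = Const (lookup f 0)"
    by (intro poly_mapping_eqI) (auto simp: lookup_Const in_keys_iff)
  then show ?case by (metis mult.right_neutral power_0)
next
  case (Suc b)
  have "cone_weight (Poly_Mapping.single False 3) \<le> cone_weight (Poly_Mapping.single True 2)"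
    by (simp add: cone_weight_def lookup_single when_def)
  from divide_by_binomial[OF _ cone_weight_add this Suc.prems(1), folded cuspidal_cubic_def]
  obtain g r where gr: "f = cuspidal_cubic * g + r"
    "\<And>s. s \<in> keys g \<Longrightarrow> cone_weight s + cone_weight (Poly_Mapping.single True 2) \<le> 4 * Suc b"
    "weight_le cone_weight (4 * Suc b) r" "\<And>s. s \<in> keys r \<Longrightarrow> lookup s True \<le> 1"
    by (auto simp: lookup_single when_def)
  let ?\<psi> = "substitute (\<lambda>c. [:c:]) to_normalization"
  have "?\<psi> cuspidal_cubic = 0"
    unfolding cuspidal_cubic_Var by (simp add: to_normalization_def power2_eq_square power3_eq_cube)
  then have \<psi>: "?\<psi> f = ?\<psi> r" by (simp add: gr(1))
  have "?\<psi> f = 0"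
  proof (rule positive_roots_no_linear_term[of "{1..8}" "Suc b"])
    fix i :: nat assume "i \<in> {1..8}"
    from Suc.prems(2)[OF this] show "[:- of_nat i, 1:] ^ Suc b dvd ?\<psi> f"
      by (rule mult_restrict_to_curve) (simp add: cubic_point_def to_normalization_def algebra_simps power2_eq_square power3_eq_cube)
  next
    show "degree (?\<psi> f) \<le> card {1..8 :: nat} * Suc b"
    proof (rule degree_le, intro allI impI)
      fix n assume n: "card {1..8 :: nat} * Suc b < n"
      have "2 * lookup t False + 3 * lookup t True \<noteq> n" if "t \<in> keys r" for t
        using gr(3) that n by (force simp: weight_le_def cone_weight_def)
      then show "coeff (?\<psi> f) n = 0" unfolding \<psi> coeff_normalization by (intro sum.neutral) auto
    qed
    show "coeff (?\<psi> f) 1 = 0"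
    proof -
      have "2 * k + 3 * l \<noteq> 1" for k l :: nat by presburger
      then show ?thesis unfolding coeff_normalization by (intro sum.neutral) simp
    qed
  qed auto
  have "r = 0"
  proof (rule poly_mapping_eqI)
    fix t
    show "lookup r t = lookup 0 t"
    proof (cases "t \<in> keys r")
      case True
      let ?N = "\<lambda>t. 2 * lookup t False + 3 * lookup t True"
      have eq: "s = t" if "s \<in> keys r" "?N s = ?N t" for s
      proof -
        have "lookup s True \<le> 1" "lookup t True \<le> 1" using gr(4) that True by auto
        then have "lookup s True = lookup t True" "lookup s False = lookup t False"
          using that(2) by presburger+
        then show ?thesis by (intro poly_mapping_eqI) (metis (full_types))
      qed
      have "0 = coeff (?\<psi> r) (?N t)" using \<open>?\<psi> f = 0\<close> \<psi> by simp
      also have "\<dots> = (\<Sum>s\<in>keys r. if s = t then lookup r s else 0)"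
        unfolding coeff_normalization by (rule sum.cong) (use eq in auto)
      also have "\<dots> = lookup r t" using True by simp
      finally show ?thesis by simp
    qed (simp add: in_keys_iff)
  qed
  then have fg: "f = cuspidal_cubic * g" using gr(1) by simp
  have "\<exists>a. g = Const a * cuspidal_cubic ^ b"
  proof (rule Suc.IH)
    show "weight_le cone_weight (4 * b) g"
      using gr(2) by (force simp: weight_le_def cone_weight_def lookup_single when_def)
    fix i :: nat assume i: "i \<in> {1..8}"
    then have "mult_at_least (1 + b) (cuspidal_cubic * g) (cubic_point i)"
      using Suc.prems(2) fg by simp
    then show "mult_at_least b g (cubic_point i)"
      using mult_cancel[OF cubic_exact] i by auto
  qed
  then show ?case by (auto simp: fg mult.left_commute)
qed

definition cone_exponent :: "(4 \<Rightarrow>\<^sub>0 nat) \<Rightarrow> bool \<Rightarrow>\<^sub>0 nat" where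
  "cone_exponent t = Poly_Mapping.single False (lookup t 2 + 2 * lookup t 4) + Poly_Mapping.single True (lookup t 3)"

lemma cone_mon: "eval_mon to_cone t = Poly_Mapping.single (cone_exponent t) 1"
  unfolding cone_exponent_def bool_mon[symmetric]
  by (simp add: eval_mon_4 to_cone_def power_add power_mult mult_ac)

lemma lookup_cone:
  "lookup (substitute Const to_cone F) s = (\<Sum>t\<in>keys F. if cone_exponent t = s then lookup F t else 0)"
  unfolding substitute_alt cone_mon lookup_sum lookup_Const_mult
  by (rule sum.cong) (simp_all add: lookup_single when_def)

lemma weight_cone:
  assumes "homogeneous d F" shows "weight_le cone_weight (2 * d) (substitute Const to_cone F)"
  unfolding weight_le_def
proof
  fix s assume "s \<in> keys (substitute Const to_cone F)"
  then have nz: "(\<Sum>t\<in>keys F. if cone_exponent t = s then lookup F t else 0) \<noteq> 0"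
    by (simp add: in_keys_iff lookup_cone)
  obtain t where t: "t \<in> keys F" "cone_exponent t = s"
  proof (rule ccontr)
    assume "\<not> thesis"
    then have "\<forall>t\<in>keys F. cone_exponent t \<noteq> s" using that by blast
    then have "(\<Sum>t\<in>keys F. if cone_exponent t = s then lookup F t else 0) = 0"
      by (intro sum.neutral) simp
    with nz show False by simp
  qed
  then have "mon_degree t = d" using assms by (simp add: homogeneous_def)
  then show "cone_weight s \<le> 2 * d"
    unfolding t(2)[symmetric] cone_exponent_def cone_weight_def mon_degree_4
    by (simp add: lookup_add lookup_single when_def)
qed

text \<open>
  A remainder of degree at most one in the second variable is determined by its restriction to the
  cone.
\<close>

lemma vanishing_on_cone:
  assumes F: "homogeneous (d + 2) F" and zero: "substitute Const to_cone F = 0"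
  obtains H where "homogeneous d H" "F = quadric0 * H"
proof -
  have \<mu>: "lookup (Poly_Mapping.single (1::4) (1::nat) + Poly_Mapping.single 4 1) 2 = 0"
    by (simp add: lookup_single lookup_add when_def)
  obtain G R where GR: "F = quadric0 * G + R" "\<And>s. s \<in> keys R \<Longrightarrow> lookup s 2 \<le> 1"
  proof (rule divide_by_binomial[OF \<mu>, where wt = "\<lambda>_. 0" and n = 0 and F = F, folded quadric0_def])
    show "weight_le (\<lambda>_. 0) 0 F" by (simp add: weight_le_def)
  qed (use that in auto)
  let ?H = "hom_part d G" and ?R = "hom_part (d + 2) R"
  have split: "F = quadric0 * ?H + ?R"
  proof -
    have "F = hom_part (d + 2) F" using F by (simp add: hom_part_self)
    also have "\<dots> = quadric0 * ?H + ?R"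
      unfolding GR(1) hom_part_add hom_part_mult_homogeneous[OF homogeneous_quadrics(1)] ..
    finally show ?thesis .
  qed
  have "substitute Const to_cone quadric0 = 0"
    by (simp add: quadrics_Var to_cone_def)
  then have R0: "substitute Const to_cone ?R = 0" using zero split by simp
  have "?R = 0"
  proof (rule poly_mapping_eqI)
    fix t
    show "lookup ?R t = lookup 0 t"
    proof (cases "t \<in> keys ?R")
      case True
      have small: "lookup s 2 \<le> 1" "mon_degree s = d + 2" if "s \<in> keys ?R" for s
        using that GR(2)[of s] by (auto simp: in_keys_iff lookup_hom_part split: if_splits)
      have eq: "s = t" if "s \<in> keys ?R" "cone_exponent s = cone_exponent t" for s
      proof -
        have "lookup (cone_exponent s) False = lookup (cone_exponent t) False"
          "lookup (cone_exponent s) True = lookup (cone_exponent t) True" using that(2) by simp_all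
        then have "lookup s 2 + 2 * lookup s 4 = lookup t 2 + 2 * lookup t 4" "lookup s 3 = lookup t 3"
          by (simp_all add: cone_exponent_def lookup_add lookup_single when_def)
        moreover have "lookup s 2 \<le> 1" "lookup t 2 \<le> 1" using small that(1) True by blast+
        ultimately have eqs: "lookup s 2 = lookup t 2" "lookup s 3 = lookup t 3" "lookup s 4 = lookup t 4"
          by presburger+
        then have "lookup s 1 = lookup t 1"
          using small(2)[OF that(1)] small(2)[OF True] by (simp add: mon_degree_4)
        with eqs have "\<forall>j. lookup s j = lookup t j" unfolding forall_4 by blast
        then show ?thesis by (intro poly_mapping_eqI) blast
      qed
      have "0 = lookup (substitute Const to_cone ?R) (cone_exponent t)" by (simp only: R0 lookup_zero)
      also have "\<dots> = (\<Sum>s\<in>keys ?R. if s = t then lookup ?R s else 0)"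
        unfolding lookup_cone by (rule sum.cong) (use eq in auto)
      also have "\<dots> = lookup ?R t" using True by simp
      finally show ?thesis by simp
    qed (simp add: in_keys_iff)
  qed
  then have "F = quadric0 * ?H" using split by simp
  with hom_part_homogeneous show ?thesis by (rule that)
qed

lemma curve_simps: "curve i $ 1 = 1" "curve i $ 2 = of_nat i ^ 2" "curve i $ 3 = of_nat i ^ 3" "curve i $ 4 = of_nat i ^ 4"
  by (simp_all add: curve_def)

lemma quadrics_at_curve: "mult_at_least 1 quadric0 (curve i)" "mult_at_least 1 quadric1 (curve i)"
  unfolding mult_at_least_1_iff by (simp_all add: quadrics_Var curve_simps power_mult[symmetric] power_add[symmetric])

lemma quadric0_exact: "mult_exact 1 quadric0 (curve i)"
  unfolding mult_exact_def
proof
  show "mult_at_least 1 quadric0 (curve i)" by (rule quadrics_at_curve)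
  show "\<not> mult_at_least (Suc 1) quadric0 (curve i)"
  proof
    let ?x = "\<lambda>j. if j = 4 then [:of_nat i ^ 4, 1:] else [:curve i $ j:]"
    assume "mult_at_least (Suc 1) quadric0 (curve i)"
    then have "[:- 0, 1:] ^ Suc 1 dvd substitute (\<lambda>c. [:c:]) ?x quadric0"
      by (rule mult_restrict_to_curve) (simp add: curve_simps)
    then obtain q where "substitute (\<lambda>c. [:c:]) ?x quadric0 = [:- 0, 1:] ^ Suc 1 * q" by (rule dvdE)
    then have "coeff (substitute (\<lambda>c. [:c:]) ?x quadric0) 1 = 0" by simp
    then show False by (simp add: quadrics_Var curve_simps power2_eq_square)
  qed
qed

text \<open>
  Subtracting the right multiple of the power of \<open>quadric1\<close>, which restricts to the power of the cubic,
  leaves a form vanishing on the cone. It is divisible by \<open>quadric0\<close>, and the quotient belongs to the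
  system with \<open>b - 1\<close> in place of \<open>b\<close>.
\<close>

lemma special_system:
  assumes "F \<in> linear_system {1..8} special_points (2 * b) (\<lambda>_. b)"
  shows "\<exists>a. F = (\<Sum>i\<le>b. Const (a i) * (quadric0 ^ i * quadric1 ^ (b - i)))"
  using assms
proof (induction b arbitrary: F)
  case 0
  then have "homogeneous 0 F" using linear_systemD(1) by fastforce
  then have "F = Const (lookup F 0)"
    by (intro poly_mapping_eqI) (auto simp: lookup_Const mon_degree_eq_0_iff dest: homogeneousD)
  then show ?case by (intro exI[of _ "\<lambda>_. lookup F 0"]) simp
next
  case (Suc b)
  have F: "homogeneous (2 * Suc b) F" "\<And>i. i \<in> {1..8} \<Longrightarrow> mult_at_least (Suc b) F (curve i)"
  proof -
    show "homogeneous (2 * Suc b) F" using Suc.prems by (rule linear_systemD(1))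
    show "mult_at_least (Suc b) F (curve i)" if "i \<in> {1..8}" for i
      using linear_systemD(2)[OF Suc.prems that] that by (simp add: special_points_def)
  qed
  let ?\<phi> = "substitute Const to_cone"
  have "\<exists>a. ?\<phi> F = Const a * cuspidal_cubic ^ Suc b"
  proof (rule cuspidal_cubic_system)
    have "2 * (2 * Suc b) = 4 * Suc b" by simp
    then show "weight_le cone_weight (4 * Suc b) (?\<phi> F)" using weight_cone[OF F(1)] by (simp only:)
    show "mult_at_least (Suc b) (?\<phi> F) (cubic_point i)" if "i \<in> {1..8}" for i
    proof (rule mult_substitute[OF F(2)[OF that]])
      have "\<forall>j. eval_at (to_cone j) (cubic_point i) = curve i $ j"
        unfolding forall_4 by (simp add: to_cone_def cubic_point_def curve_simps power_mult[symmetric])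
      then show "eval_at (to_cone j) (cubic_point i) = curve i $ j" for j by blast
    qed
  qed
  then obtain a where a: "?\<phi> F = Const a * cuspidal_cubic ^ Suc b" by blast
  let ?G = "F - Const a * quadric1 ^ Suc b"
  have "?\<phi> quadric1 = cuspidal_cubic"
    unfolding quadrics_Var cuspidal_cubic_Var by (simp add: to_cone_def power3_eq_cube power2_eq_square mult.assoc)
  then have "?\<phi> ?G = 0" using a by simp
  moreover have "homogeneous (2 * b + 2) ?G"
    using F(1) homogeneous_Const_mult[OF homogeneous_power[OF homogeneous_quadrics(2), of "Suc b"], of a]
    by (intro homogeneous_diff) (simp_all add: mult.commute)
  ultimately obtain H where H: "homogeneous (2 * b) H" "?G = quadric0 * H"
    using vanishing_on_cone by blast
  have "H \<in> linear_system {1..8} special_points (2 * b) (\<lambda>_. b)"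
  proof (rule linear_systemI[OF H(1)])
    fix i :: nat assume i: "i \<in> {1..8}"
    have "mult_at_least (Suc b * 1) (quadric1 ^ Suc b) (curve i)"
      using quadrics_at_curve(2) by (rule mult_at_least_power)
    then have "mult_at_least (Suc b) (Const a * quadric1 ^ Suc b) (curve i)"
      unfolding mult_1_right by (rule mult_at_least_mult_left)
    with F(2)[OF i] have "mult_at_least (Suc b) ?G (curve i)" by (rule mult_at_least_diff)
    then have "mult_at_least (1 + b) (quadric0 * H) (curve i)" unfolding H(2) by simp
    then have "mult_at_least b H (curve i)" using mult_cancel[OF quadric0_exact] by blast
    then show "mult_at_least b H (special_points i)" using i by (simp add: special_points_def)
  qed
  from Suc.IH[OF this] obtain c where c: "H = (\<Sum>i\<le>b. Const (c i) * (quadric0 ^ i * quadric1 ^ (b - i)))" by blast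
  let ?d = "\<lambda>i. if i = 0 then a else c (i - 1)"
  have "F = Const a * quadric1 ^ Suc b + quadric0 * H" using H(2) by (simp add: algebra_simps)
  also have "\<dots> = (\<Sum>i\<le>Suc b. Const (?d i) * (quadric0 ^ i * quadric1 ^ (Suc b - i)))"
    unfolding c sum.atMost_Suc_shift by (simp add: sum_distrib_left mult_ac)
  finally show ?case by (rule exI[where x = ?d])
qed

text \<open>
  The monomials in the second and third variable alone of the products of the two quadrics, which become
  \<open>X\<^sub>2\<^sup>2\<close> and \<open>X\<^sub>3\<^sup>2\<close> when the other variables are zero.
\<close>

definition leading_monomials :: "nat \<Rightarrow> (4 \<Rightarrow>\<^sub>0 nat) set" where
  "leading_monomials b = (\<lambda>i. Poly_Mapping.single 2 (2 * i) + Poly_Mapping.single 3 (2 * (b - i))) ` {..b}"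

lemma finite_leading_monomials [simp]: "finite (leading_monomials b)"
  by (simp add: leading_monomials_def)

lemma card_leading_monomials: "card (leading_monomials b) = b + 1"
proof -
  have "inj_on (\<lambda>i. Poly_Mapping.single (2::4) (2 * i) + Poly_Mapping.single 3 (2 * (b - i))) {..b}"
  proof (rule inj_onI)
    fix i j assume "Poly_Mapping.single (2::4) (2 * i) + Poly_Mapping.single 3 (2 * (b - i))
      = Poly_Mapping.single 2 (2 * j) + Poly_Mapping.single 3 (2 * (b - j))"
    then have "lookup (Poly_Mapping.single (2::4) (2 * i) + Poly_Mapping.single 3 (2 * (b - i))) 2
      = lookup (Poly_Mapping.single 2 (2 * j) + Poly_Mapping.single 3 (2 * (b - j))) (2::4)" by simp
    then show "i = j" by (simp add: lookup_add lookup_single when_def)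
  qed
  then show ?thesis by (simp add: leading_monomials_def card_image)
qed

lemma leading_coefficients:
  assumes F: "F = (\<Sum>i\<le>b. Const (a i) * (quadric0 ^ i * quadric1 ^ (b - i)))" and k: "k \<le> b"
  shows "lookup F (Poly_Mapping.single 2 (2 * k) + Poly_Mapping.single 3 (2 * (b - k))) = a k"
proof -
  let ?x = "\<lambda>j :: 4. if j = 2 then Var False else if j = 3 then Var True else (0 :: bool mpoly)"
  let ?t = "Poly_Mapping.single (2::4) (2 * k) + Poly_Mapping.single 3 (2 * (b - k))"
  let ?s = "\<lambda>i. Poly_Mapping.single False (2 * i) + Poly_Mapping.single True (2 * (b - i))"
  have s_eq: "?s i = ?s j \<longleftrightarrow> i = j" for i j
  proof
    assume "?s i = ?s j"
    then have "lookup (?s i) False = lookup (?s j) False" by simp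
    then show "i = j" by (simp add: lookup_add lookup_single when_def)
  qed simp
  have mon: "lookup (eval_mon ?x t) (?s k) = (if t = ?t then 1 else 0)" for t
  proof (cases "lookup t 1 = 0 \<and> lookup t 4 = 0")
    case True
    have "eval_mon ?x t = Poly_Mapping.single (Poly_Mapping.single False (lookup t 2) + Poly_Mapping.single True (lookup t 3)) 1"
      unfolding bool_mon[symmetric] using True by (simp add: eval_mon_4)
    moreover have "Poly_Mapping.single False (lookup t 2) + Poly_Mapping.single True (lookup t 3) = ?s k \<longleftrightarrow> t = ?t"
      using True by (auto simp: poly_mapping_eq_iff fun_eq_iff lookup_add lookup_single when_def forall_4 all_bool_eq)
    ultimately show ?thesis by (simp add: lookup_single when_def)
  next
    case False
    then have "eval_mon ?x t = 0" by (auto simp: eval_mon_4)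
    moreover have "t \<noteq> ?t" using False by (auto simp: lookup_add lookup_single when_def)
    ultimately show ?thesis by simp
  qed
  have "lookup F ?t = (\<Sum>t\<in>keys F. if t = ?t then lookup F t else 0)"
    unfolding sum.delta[OF finite_keys] by (simp add: in_keys_iff)
  also have "\<dots> = (\<Sum>t\<in>keys F. lookup F t * (if t = ?t then 1 else 0))"
    by (rule sum.cong) simp_all
  also have "\<dots> = lookup (substitute Const ?x F) (?s k)"
    unfolding substitute_alt lookup_sum lookup_Const_mult mon ..
  also have "substitute Const ?x F = (\<Sum>i\<le>b. Const (a i) * (Var False ^ (2 * i) * Var True ^ (2 * (b - i))))"
    unfolding F by (simp add: quadrics_Var power_mult)
  also have "lookup \<dots> (?s k) = (\<Sum>i\<le>b. if i = k then a i else 0)"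
    unfolding bool_mon lookup_sum lookup_Const_mult
    by (rule sum.cong) (auto simp: lookup_single when_def s_eq simp del: Poly_Mapping.single_zero)
  also have "\<dots> = a k" using k by simp
  finally show ?thesis .
qed

lemma special_pencil_powers:
  assumes "F \<in> linear_system {1..8} special_points (2 * b) (\<lambda>_. b)"
    and "\<And>t. t \<in> leading_monomials b \<Longrightarrow> lookup F t = 0"
  shows "F = 0"
proof -
  obtain a where a: "F = (\<Sum>i\<le>b. Const (a i) * (quadric0 ^ i * quadric1 ^ (b - i)))"
    using special_system[OF assms(1)] by blast
  have "a i = 0" if "i \<le> b" for i
    using leading_coefficients[OF a that] assms(2) that by (force simp: leading_monomials_def)
  then show ?thesis unfolding a by simp
qed

lemma special_quadric:
  assumes "F \<in> linear_system {1..9} special_points 2 (\<lambda>_. 1)"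
  shows "\<exists>a. F = Const a * quadric1"
proof -
  have "F \<in> linear_system {1..8} special_points (2 * 1) (\<lambda>_. 1)"
    using assms linear_system_antimono[of "{1..8}" "{1..9 :: nat}"] by auto
  from special_system[OF this] obtain a
    where "F = (\<Sum>i\<le>1. Const (a i) * (quadric0 ^ i * quadric1 ^ (1 - i)))" by blast
  then have a: "F = Const (a 0) * quadric1 + Const (a 1) * quadric0" by simp
  have "mult_at_least 1 F (axis 2 1)"
    using linear_systemD(2)[OF assms, of 9] by (simp add: special_points_def)
  then have "eval_at F (axis 2 1) = 0" by (simp only: mult_at_least_1_iff)
  then have "a 1 = 0" by (simp add: a quadrics_Var axis_def)
  then show ?thesis using a by auto
qed

lemma special_quadric_unique:
  assumes "F \<in> linear_system {1..9} special_points 2 (\<lambda>_. 1)" "lookup F (Poly_Mapping.single 3 2) = 0"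
  shows "F = 0"
proof -
  obtain a where a: "F = Const a * quadric1" using special_quadric[OF assms(1)] by blast
  have "F = (\<Sum>i\<le>1. Const (if i = 0 then a else 0) * (quadric0 ^ i * quadric1 ^ (1 - i)))"
    by (simp add: a)
  from leading_coefficients[OF this, of 0] assms(2) have "a = 0" by simp
  then show ?thesis by (simp add: a)
qed

lemma special_quadric_smooth:
  assumes F: "F \<in> linear_system {1..9} special_points 2 (\<lambda>i. if i = 9 then 2 else 1)"
  shows "F = 0"
proof -
  have "F \<in> linear_system {1..9} special_points 2 (\<lambda>_. 1)"
  proof (rule linear_systemI)
    show "homogeneous 2 F" using F by (rule linear_systemD)
    show "mult_at_least 1 F (special_points i)" if "i \<in> {1..9}" for i
      using linear_systemD(2)[OF F that] by (rule mult_at_least_mono) simp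
  qed
  then obtain a where a: "F = Const a * quadric1" using special_quadric by blast
  have "mult_at_least 2 F (axis 2 1)"
    using linear_systemD(2)[OF F, of 9] by (simp add: special_points_def)
  let ?x = "\<lambda>j. if j = 4 then [:0, 1:] else [:axis 2 1 $ j:] :: complex poly"
  from \<open>mult_at_least 2 F (axis 2 1)\<close> have "[:- 0, 1:] ^ 2 dvd substitute (\<lambda>c. [:c:]) ?x F"
    by (rule mult_restrict_to_curve) (simp add: axis_def)
  then obtain q where "substitute (\<lambda>c. [:c:]) ?x F = [:- 0, 1:] ^ 2 * q" by (rule dvdE)
  then have "coeff (substitute (\<lambda>c. [:c:]) ?x F) 1 = 0" by (simp add: power2_eq_square)
  then have "a = 0" by (simp add: a quadrics_Var axis_def power2_eq_square)
  then show ?thesis by (simp add: a)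
qed

lemma linear_form_is_lin:
  fixes F :: "'n::finite mpoly"
  assumes "homogeneous 1 F" shows "\<exists>c. F = lin c"
proof
  show "F = lin (\<chi> j. lookup F (Poly_Mapping.single j 1))"
  proof (rule poly_mapping_eqI)
    fix t
    show "lookup F t = lookup (lin (\<chi> j. lookup F (Poly_Mapping.single j 1))) t"
    proof (cases "mon_degree t = 1")
      case True
      then have "t \<noteq> 0" by auto
      then obtain j where j: "lookup t j \<noteq> 0" by (auto simp: poly_mapping_eq_iff fun_eq_iff)
      define t' where "t' = t - Poly_Mapping.single j 1"
      have t: "t = Poly_Mapping.single j 1 + t'"
        using j by (auto simp: t'_def poly_mapping_eq_iff lookup_add lookup_minus lookup_single when_def fun_eq_iff)
      then have "mon_degree t' = 0" using True by (simp add: mon_degree_add)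
      then have "t = Poly_Mapping.single j 1" using t by (simp add: mon_degree_eq_0_iff)
      then show ?thesis by (simp only: lookup_lin vec_lambda_beta)
    next
      case False
      then show ?thesis using homogeneousD[OF assms] homogeneousD[OF homogeneous_lin(1)] by metis
    qed
  qed
qed

text \<open>
  On the curve a linear form is a polynomial of degree four without linear term.
\<close>

lemma special_points_not_coplanar:
  assumes F: "F \<in> linear_system J special_points 1 (\<lambda>_. 1)" and J: "J \<subseteq> {1..8}" "card J = 4"
  shows "F = 0"
proof -
  obtain c where c: "F = lin c" using linear_form_is_lin linear_systemD(1)[OF F] by blast
  let ?x = "\<lambda>j. if j = 1 then 1 else if j = 2 then monom 1 2 else if j = 3 then monom 1 3 else monom 1 4 :: complex poly"
  let ?p = "substitute (\<lambda>c. [:c:]) ?x F"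
  have p: "?p = [:c $ 1, 0, c $ 2, c $ 3, c $ 4:]"
    unfolding c polysub.substitute_lin sum_4 by (simp add: monom_altdef eval_nat_numeral)
  have "?p = 0"
  proof (rule positive_roots_no_linear_term[of J 1])
    show "finite J" "J \<noteq> {}" "0 \<notin> J" using J finite_subset by auto
    show "[:- of_nat i, 1:] ^ 1 dvd ?p" if "i \<in> J" for i
    proof (rule mult_restrict_to_curve)
      show "mult_at_least 1 F (curve i)"
        using linear_systemD(2)[OF F that] that J(1) by (auto simp: special_points_def)
      have "\<forall>j. poly (?x j) (of_nat i) = curve i $ j"
        unfolding forall_4 by (simp add: curve_simps poly_monom)
      then show "poly (?x j) (of_nat i) = curve i $ j" for j by blast
    qed
    show "degree ?p \<le> card J * 1" unfolding p J(2) by (simp add: degree_pCons_eq_if)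
    show "coeff ?p 1 = 0" unfolding p by simp
  qed simp
  then have "c $ 1 = 0 \<and> c $ 2 = 0 \<and> c $ 3 = 0 \<and> c $ 4 = 0" unfolding p by simp
  then have "c = 0" by (simp add: vec_eq_iff forall_4)
  then show ?thesis by (simp add: c)
qed

section \<open>Factors of forms\<close>

lemma hom_part_top_mult:
  assumes "degree_le k F" "degree_le l G"
  shows "hom_part (k + l) (F * G) = hom_part k F * hom_part l G"
proof -
  have zero: "hom_part (k + l) (A * B) = 0"
    if A: "\<And>t. t \<in> keys A \<Longrightarrow> mon_degree t \<le> k" and B: "\<And>t. t \<in> keys B \<Longrightarrow> mon_degree t \<le> l"
      and less: "(\<forall>t\<in>keys A. mon_degree t < k) \<or> (\<forall>t\<in>keys B. mon_degree t < l)" for A B :: "'a mpoly"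
  proof (rule poly_mapping_eqI)
    fix t
    have "mon_degree t < k + l" if t: "t \<in> keys (A * B)"
    proof -
      obtain r s where "r \<in> keys A" "s \<in> keys B" "t = r + s"
        using t Poly_Mapping.keys_mult[of A B] by blast
      then show ?thesis using A[of r] B[of s] less by (fastforce simp: mon_degree_add)
    qed
    then show "lookup (hom_part (k + l) (A * B)) t = lookup 0 t"
      by (force simp: lookup_hom_part in_keys_iff)
  qed
  have strict: "\<forall>t\<in>keys (A - hom_part n A). mon_degree t < n" if "degree_le n A" for A :: "'a mpoly" and n
    using that by (force simp: degree_le_def in_keys_iff lookup_minus lookup_hom_part split: if_splits)
  have deg: "\<And>t. t \<in> keys (hom_part n A) \<Longrightarrow> mon_degree t \<le> n" for A :: "'a mpoly" and n
    by (auto simp: in_keys_iff lookup_hom_part split: if_splits)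
  have "F * G = hom_part k F * hom_part l G + (hom_part k F * (G - hom_part l G) + (F - hom_part k F) * G)"
    by (simp add: algebra_simps)
  then have "hom_part (k + l) (F * G) = hom_part (k + l) (hom_part k F * hom_part l G) +
      (hom_part (k + l) (hom_part k F * (G - hom_part l G)) + hom_part (k + l) ((F - hom_part k F) * G))"
    by (simp only: hom_part_add)
  also have "hom_part (k + l) (hom_part k F * hom_part l G) = hom_part k F * hom_part l G"
    by (intro hom_part_self homogeneous_mult hom_part_homogeneous)
  also have "hom_part (k + l) (hom_part k F * (G - hom_part l G)) = 0"
  proof (rule zero)
    show "mon_degree t \<le> l" if "t \<in> keys (G - hom_part l G)" for t
      using strict[OF assms(2)] that by (simp add: less_imp_le)
  qed (use deg strict[OF assms(2)] in auto)
  also have "hom_part (k + l) ((F - hom_part k F) * G) = 0"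
  proof (rule zero)
    show "mon_degree t \<le> k" if "t \<in> keys (F - hom_part k F)" for t
      using strict[OF assms(1)] that by (simp add: less_imp_le)
  qed (use assms(2) strict[OF assms(1)] in \<open>auto simp: degree_le_def\<close>)
  finally show ?thesis by simp
qed

lemma ex_top_degree:
  assumes "F \<noteq> 0" shows "\<exists>k. degree_le k F \<and> hom_part k F \<noteq> 0"
proof -
  let ?k = "Max (mon_degree ` keys F)"
  have ne: "keys F \<noteq> {}" using assms by simp
  then have "?k \<in> mon_degree ` keys F" by (intro Max_in) auto
  then obtain t where t: "t \<in> keys F" "?k = mon_degree t" by blast
  have "lookup (hom_part ?k F) t \<noteq> 0" using t by (simp add: lookup_hom_part in_keys_iff)
  then have "hom_part ?k F \<noteq> 0" by auto
  moreover have "degree_le ?k F" by (auto simp: degree_le_def)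
  ultimately show ?thesis by blast
qed

text \<open>
  The lowest parts and the highest parts of the factors both multiply to parts of the product, so the
  lowest and highest degrees of each factor coincide.
\<close>

lemma homogeneous_factors:
  fixes F G :: "'n::linorder mpoly"
  assumes "homogeneous d (F * G)" "F * G \<noteq> 0"
  obtains k l where "homogeneous k F" "homogeneous l G" "k + l = d"
proof -
  have nz: "F \<noteq> 0" "G \<noteq> 0" using assms(2) by auto
  obtain k where k: "degree_le k F" "hom_part k F \<noteq> 0" using ex_top_degree nz by blast
  obtain l where l: "degree_le l G" "hom_part l G \<noteq> 0" using ex_top_degree nz by blast
  obtain k' where k': "low k' F" "\<not> low (Suc k') F" using ex_low_exact nz by blast
  obtain l' where l': "low l' G" "\<not> low (Suc l') G" using ex_low_exact nz by blast
  have "hom_part (k + l) (F * G) \<noteq> 0" unfolding hom_part_top_mult[OF k(1) l(1)] using k l by simp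
  then have d: "k + l = d" using hom_part_other[OF assms(1)] by blast
  have "hom_part k' F \<noteq> 0" "hom_part l' G \<noteq> 0" using k' l' by (auto simp: low_Suc)
  then have "hom_part (k' + l') (F * G) \<noteq> 0" unfolding hom_part_low_mult[OF k'(1) l'(1)] by simp
  then have d': "k' + l' = d" using hom_part_other[OF assms(1)] by blast
  have "k' \<le> k"
  proof (rule ccontr)
    assume "\<not> k' \<le> k"
    then have "hom_part k F = 0" using k'(1) by (simp add: low_iff_hom_part)
    with k(2) show False by simp
  qed
  moreover have "l' \<le> l"
  proof (rule ccontr)
    assume "\<not> l' \<le> l"
    then have "hom_part l G = 0" using l'(1) by (simp add: low_iff_hom_part)
    with l(2) show False by simp
  qed
  ultimately have "k' = k" "l' = l" using d d' by auto
  then have "homogeneous k F" "homogeneous l G"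
    using k(1) l(1) k'(1) l'(1) by (auto simp: homogeneous_def degree_le_def low_def intro: antisym)
  then show ?thesis using d by (rule that)
qed

section \<open>Pencils of forms\<close>

text \<open>
  At \<open>v\<close> the multiplicity of such a sum is the least \<open>i\<close> with \<open>a i \<noteq> 0\<close>.
\<close>

lemma pencil_coefficients:
  fixes q r :: "'n::{finite,linorder} mpoly"
  assumes q: "mult_exact 1 q v" and r: "eval_at r v \<noteq> 0"
    and F: "mult_at_least k (\<Sum>i\<le>b. Const (a i) * (q ^ i * r ^ (b - i))) v"
    and i: "i < k" "i \<le> b"
  shows "a i = 0"
  using i
proof (induction i rule: less_induct)
  case (less i)
  let ?T = "\<lambda>j. Const (a j) * (q ^ j * r ^ (b - j))"
  let ?G = "\<Sum>j\<in>{i..b}. Const (a j) * (q ^ (j - i) * r ^ (b - j))"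
  have "(\<Sum>j\<le>b. ?T j) = (\<Sum>j\<in>{i..b}. ?T j)"
    by (rule sum.mono_neutral_right) (use less in auto)
  also have "\<dots> = q ^ i * ?G"
    unfolding sum_distrib_left
  proof (rule sum.cong[OF refl])
    fix j assume "j \<in> {i..b}"
    then have "q ^ j = q ^ i * q ^ (j - i)" by (simp flip: power_add)
    then show "?T j = q ^ i * (Const (a j) * (q ^ (j - i) * r ^ (b - j)))" by (simp add: mult_ac)
  qed
  finally have "mult_at_least k (q ^ i * ?G) v" using F by simp
  then have "mult_at_least (i * 1 + 1) (q ^ i * ?G) v"
    by (rule mult_at_least_mono) (use less.prems in simp)
  then have "mult_at_least 1 ?G v" using mult_cancel[OF mult_exact_power[OF q]] by blast
  then have G: "eval_at ?G v = 0" by (simp only: mult_at_least_1_iff)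
  have q0: "eval_at q v = 0" using q by (simp add: mult_exact_def flip: mult_at_least_1_iff)
  have "eval_at ?G v = (\<Sum>j\<in>{i..b}. a j * (eval_at q v ^ (j - i) * eval_at r v ^ (b - j)))" by simp
  also have "\<dots> = (\<Sum>j\<in>{i}. a j * (eval_at q v ^ (j - i) * eval_at r v ^ (b - j)))"
    by (rule sum.mono_neutral_right) (use less.prems in \<open>auto simp: q0\<close>)
  also have "\<dots> = a i * eval_at r v ^ (b - i)" by simp
  finally show ?case using G r by simp
qed

text \<open>
  The products \<open>q\<^sup>i r\<^bsup>b - i\<^esup>\<close> have different multiplicities at \<open>v\<close>, hence they are independent, and \<open>T\<close>
  leaves no room for more.
\<close>

lemma pencil_system:
  fixes q r :: "'n::{finite,linorder} mpoly"
  assumes q: "mult_exact 1 q v" and r: "eval_at r v \<noteq> 0"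
    and qr: "q \<in> linear_system I p e (\<lambda>_. 1)" "r \<in> linear_system I p e (\<lambda>_. 1)"
    and T: "finite T" "card T = b + 1"
      "\<And>F. F \<in> linear_system I p (b * e) (\<lambda>_. b) \<Longrightarrow> (\<And>t. t \<in> T \<Longrightarrow> lookup F t = 0) \<Longrightarrow> F = 0"
  shows "linear_system I p (b * e) (\<lambda>_. b) = {(\<Sum>i\<le>b. Const (a i) * (q ^ i * r ^ (b - i))) | a. True}"
    and "dim_ls I p (b * e) (\<lambda>_. b) = b + 1"
proof -
  let ?L = "linear_system I p (b * e) (\<lambda>_. b)"
  let ?f = "\<lambda>i. q ^ i * r ^ (b - i)"
  have f: "?f i \<in> ?L" if "i \<le> b" for i
  proof -
    have "?f i \<in> linear_system I p (i * e + (b - i) * e) (\<lambda>_. i * 1 + (b - i) * 1)"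
      using qr by (intro linear_system_mult linear_system_power)
    moreover have "i * e + (b - i) * e = b * e" "i * 1 + (b - i) * 1 = b"
      using that by (simp_all flip: add_mult_distrib)
    ultimately show ?thesis by simp
  qed
  have "\<forall>i\<in>{..b}. x i = 0" if "(\<Sum>i\<in>{..b}. Const (x i) * ?f i) = 0" for x
  proof
    fix i assume "i \<in> {..b}"
    moreover have "mult_at_least (Suc b) (\<Sum>i\<le>b. Const (x i) * ?f i) v" using that by simp
    ultimately show "x i = 0" using pencil_coefficients[OF q r, where k = "Suc b" and b = b and a = x and i = i] by simp
  qed
  note family = mp.independent_family[where f = ?f, OF finite_atMost this]
  have B: "?f ` {..b} \<subseteq> ?L" using f by auto
  have "card (?f ` {..b}) = card T" using card_image[OF family(1)] T(2) by simp
  note basis = basis_of_coeffs[OF subspace_linear_system T(1) T(3) B family(2) this]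
  show "dim_ls I p (b * e) (\<lambda>_. b) = b + 1" unfolding dim_ls_def using basis(2) T(2) by simp
  show "?L = {(\<Sum>i\<le>b. Const (a i) * ?f i) | a. True}"
  proof (intro antisym subsetI)
    fix F assume "F \<in> ?L"
    then have "F \<in> mp.span (?f ` {..b})" using basis(1) by simp
    then obtain c where "F = (\<Sum>G\<in>?f ` {..b}. Const (c G) * G)"
      unfolding mp.span_finite[OF finite_imageI[OF finite_atMost]] by blast
    then have "F = (\<Sum>i\<le>b. Const (c (?f i)) * ?f i)" by (simp add: sum.reindex[OF family(1)])
    then show "F \<in> {(\<Sum>i\<le>b. Const (a i) * ?f i) | a. True}"
      by (intro CollectI exI[of _ "\<lambda>i. c (?f i)"]) simp
  next
    fix F assume "F \<in> {(\<Sum>i\<le>b. Const (a i) * ?f i) | a. True}"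
    then obtain a where "F = (\<Sum>i\<le>b. Const (a i) * ?f i)" by blast
    then show "F \<in> ?L"
      using f by (auto intro!: mp.subspace_sum[OF subspace_linear_system] mp.subspace_scale[OF subspace_linear_system])
  qed
qed

section \<open>Existence of quadrics\<close>

lemma ex_form_with_conditions:
  fixes p :: "'i \<Rightarrow> complex ^ 'n::finite"
  assumes "finite J" "finite T"
    and card: "card J + card T < card {t :: 'n \<Rightarrow>\<^sub>0 nat. mon_degree t = d}"
  obtains F where "F \<noteq> 0" "F \<in> linear_system J p d (\<lambda>_. 1)" "\<And>t. t \<in> T \<Longrightarrow> lookup F t = 0"
proof -
  let ?M = "{t :: 'n \<Rightarrow>\<^sub>0 nat. mon_degree t = d}"
  let ?A = "\<lambda>k t. case k of Inl i \<Rightarrow> eval_mon (\<lambda>j. p i $ j) t | Inr s \<Rightarrow> (if t = s then 1 else 0)"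
  have fin: "finite ?M" by (rule finite_monomials)
  have "card (Inl ` J \<union> Inr ` T :: ('i + ('n \<Rightarrow>\<^sub>0 nat)) set) = card J + card T"
    using assms by (subst card_Un_disjoint) (auto simp: card_image)
  then obtain x where x: "\<exists>t\<in>?M. x t \<noteq> 0" "\<forall>k\<in>Inl ` J \<union> Inr ` T. (\<Sum>t\<in>?M. ?A k t * x t) = 0"
    using underdetermined_system[OF _ fin, of "Inl ` J \<union> Inr ` T" ?A] assms by auto
  let ?F = "\<Sum>t\<in>?M. Const (x t) * Poly_Mapping.single t 1"
  have look: "lookup ?F s = (if s \<in> ?M then x s else 0)" for s by (rule lookup_sum_monomials[OF fin])
  have hom: "homogeneous d ?F" by (rule homogeneousI) (use look in \<open>auto split: if_splits\<close>)
  show ?thesis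
  proof
    obtain t where "t \<in> ?M" "x t \<noteq> 0" using x(1) by blast
    then have "lookup ?F t \<noteq> 0" unfolding look by simp
    then show "?F \<noteq> 0" by (metis lookup_zero)
    show "?F \<in> linear_system J p d (\<lambda>_. 1)"
    proof (rule linear_systemI[OF hom])
      fix i assume "i \<in> J"
      then have "(\<Sum>t\<in>?M. ?A (Inl i) t * x t) = 0" using x(2) by blast
      moreover have "eval_at ?F (p i) = (\<Sum>t\<in>?M. ?A (Inl i) t * x t)"
        by (simp add: mult.commute)
      ultimately show "mult_at_least 1 ?F (p i)" unfolding mult_at_least_1_iff by simp
    qed
    fix s assume "s \<in> T"
    then have "(\<Sum>t\<in>?M. ?A (Inr s) t * x t) = 0" using x(2) by blast
    moreover have "(\<Sum>t\<in>?M. ?A (Inr s) t * x t) = (\<Sum>t\<in>?M. if t = s then x t else 0)"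
      by (rule sum.cong) simp_all
    ultimately show "lookup ?F s = 0" unfolding look using fin by simp
  qed
qed

lemma eval_form_scale:
  assumes "homogeneous d F" shows "eval_at F (s *s v) = s ^ d * eval_at F v"
  using eval.substitute_scale[OF assms, of s "\<lambda>j. v $ j"] by simp

lemma not_separated_imp_scaled:
  fixes u v :: "complex ^ 'n::finite"
  assumes "v \<noteq> 0" "\<And>c. pairing c v = 0 \<Longrightarrow> pairing c u = 0"
  shows "\<exists>s. u = s *s v"
proof -
  obtain j where j: "v $ j \<noteq> 0" using assms(1) by (auto simp: vec_eq_iff)
  have scaled: "u $ k = u $ j / v $ j * v $ k" for k
  proof -
    let ?c = "v $ j *s axis k 1 + (- v $ k) *s axis j 1"
    have "pairing ?c v = 0" unfolding pairing_combination pairing_axis by simp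
    then have "pairing ?c u = 0" by (rule assms(2))
    then show ?thesis unfolding pairing_combination pairing_axis using j by (simp add: field_simps)
  qed
  have "u = (u $ j / v $ j) *s v"
    unfolding vec_eq_iff vector_smult_component by (intro allI scaled)
  then show ?thesis ..
qed

section \<open>The system through nine general points\<close>

text \<open>
  The first condition bounds the dimension of the systems \<open>L(b)\<close>. The next two say that there is at most
  one quadric through the nine points and that it is smooth at the last one. The last condition
  excludes that one of two planes contains half of the first eight points.
\<close>

definition general_conditions :: "nat set \<Rightarrow> (nat \<Rightarrow> complex ^ 4) \<Rightarrow> bool" where
  "general_conditions N p \<longleftrightarrow>
    (\<forall>b\<in>N. \<forall>F\<in>linear_system {1..8} p (2 * b) (\<lambda>_. b).
       (\<forall>t\<in>leading_monomials b. lookup F t = 0) \<longrightarrow> F = 0) \<and>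
    (\<forall>F\<in>linear_system {1..9} p 2 (\<lambda>_. 1). lookup F (Poly_Mapping.single 3 2) = 0 \<longrightarrow> F = 0) \<and>
    (\<forall>F\<in>linear_system {1..9} p 2 (\<lambda>i. if i = 9 then 2 else 1). F = 0) \<and>
    (\<forall>J\<in>{J. J \<subseteq> {1..8} \<and> card J = 4}. \<forall>F\<in>linear_system J p 1 (\<lambda>_. 1). F = 0)"

lemma generically_general_conditions:
  assumes "finite N" shows "generically {1..9} special_points (general_conditions N)"
  unfolding general_conditions_def
proof (intro generically_conj generically_ball)
  show "finite N" by fact
  show "generically {1..9} special_points (\<lambda>p. \<forall>F\<in>linear_system {1..8} p (2 * b) (\<lambda>_. b).
       (\<forall>t\<in>leading_monomials b. lookup F t = 0) \<longrightarrow> F = 0)" for b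
    by (rule generically_linear_system) (auto intro: special_pencil_powers)
  show "generically {1..9} special_points (\<lambda>p. \<forall>F\<in>linear_system {1..9} p 2 (\<lambda>_. 1).
      lookup F (Poly_Mapping.single 3 2) = 0 \<longrightarrow> F = 0)"
    using generically_linear_system[of "{1..9}" "{1..9}" special_points 2 "\<lambda>_. 1" "{Poly_Mapping.single 3 2}"]
      special_quadric_unique by simp
  show "generically {1..9} special_points
      (\<lambda>p. \<forall>F\<in>linear_system {1..9} p 2 (\<lambda>i. if i = 9 then 2 else 1). F = 0)"
    using generically_linear_system[of "{1..9}" "{1..9}" special_points 2 "\<lambda>i. if i = 9 then 2 else 1" "{}"]
      special_quadric_smooth by simp
  show "finite {J :: nat set. J \<subseteq> {1..8} \<and> card J = 4}"
    by (rule finite_subset[of _ "Pow {1..8}"]) auto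
  show "generically {1..9} special_points (\<lambda>p. \<forall>F\<in>linear_system J p 1 (\<lambda>_. 1). F = 0)"
    if "J \<in> {J. J \<subseteq> {1..8} \<and> card J = 4}" for J
  proof -
    have "J \<subseteq> {1..9}" using that by auto
    then show ?thesis
      using generically_linear_system[of J "{1..9}" special_points 1 "\<lambda>_. 1" "{}"]
        special_points_not_coplanar that by simp
  qed
qed

locale nine_points =
  fixes p :: "nat \<Rightarrow> complex ^ 4" and N :: "nat set"
  assumes conditions: "general_conditions N p" and nonzero: "\<And>i. i \<in> {1..9} \<Longrightarrow> p i \<noteq> 0"
begin

lemma power_system_bound:
  "b \<in> N \<Longrightarrow> F \<in> linear_system {1..8} p (2 * b) (\<lambda>_. b) \<Longrightarrow>
    (\<And>t. t \<in> leading_monomials b \<Longrightarrow> lookup F t = 0) \<Longrightarrow> F = 0"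
  using conditions unfolding general_conditions_def by blast

lemma quadric_bound:
  "F \<in> linear_system {1..9} p 2 (\<lambda>_. 1) \<Longrightarrow> lookup F (Poly_Mapping.single 3 2) = 0 \<Longrightarrow> F = 0"
  using conditions unfolding general_conditions_def by blast

lemma quadric_smooth:
  "F \<in> linear_system {1..9} p 2 (\<lambda>i. if i = 9 then 2 else 1) \<Longrightarrow> F = 0"
  using conditions unfolding general_conditions_def by blast

lemma not_coplanar:
  "J \<subseteq> {1..8} \<Longrightarrow> card J = 4 \<Longrightarrow> F \<in> linear_system J p 1 (\<lambda>_. 1) \<Longrightarrow> F = 0"
  using conditions unfolding general_conditions_def by blast

lemma card_quadric_monomials: "card {t :: 4 \<Rightarrow>\<^sub>0 nat. mon_degree t = 2} = 10"
  unfolding card_monomials by (simp add: choose_two)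

text \<open>
  If two of the points coincided, there would be only eight conditions on quadrics through all nine, and
  more than one such quadric.
\<close>

lemma separated_points: "separated {1..9} p"
proof -
  have "\<exists>c. pairing c (p j) = 0 \<and> pairing c (p i) \<noteq> 0" if ij: "i \<in> {1..9}" "j \<in> {1..9}" "i \<noteq> j" for i j
  proof (rule ccontr)
    assume "\<not> ?thesis"
    then obtain s where s: "p i = s *s p j"
      using not_separated_imp_scaled[OF nonzero[OF ij(2)], of "p i"] by blast
    obtain F where F: "F \<noteq> 0" "F \<in> linear_system ({1..9} - {i}) p 2 (\<lambda>_. 1)"
      "lookup F (Poly_Mapping.single 3 2) = 0"
      using ex_form_with_conditions[of "{1..9} - {i}" "{Poly_Mapping.single 3 2}" 2 p] ij card_quadric_monomials
      by auto
    have hom: "homogeneous 2 F" using F(2) by (rule linear_systemD(1))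
    have "mult_at_least 1 F (p j)" using linear_systemD(2)[OF F(2), of j] ij by auto
    then have "eval_at F (p j) = 0" by (simp only: mult_at_least_1_iff)
    then have "eval_at F (p i) = 0" unfolding s eval_form_scale[OF hom] by simp
    then have "mult_at_least 1 F (p k)" if "k \<in> {1..9}" for k
      using linear_systemD(2)[OF F(2), of k] that mult_at_least_1_iff by (cases "k = i") auto
    then have "F \<in> linear_system {1..9} p 2 (\<lambda>_. 1)" using hom by (intro linear_systemI)
    then have "F = 0" using F(3) by (rule quadric_bound)
    with F(1) show False by simp
  qed
  then show ?thesis using nonzero by (auto simp: separated_def)
qed

text \<open>
  Quadrics have ten coefficients. Nine conditions leave \<open>q\<close>; eight of them together with the
  vanishing of a coefficient that is nonzero in \<open>q\<close> leave \<open>r\<close>, which cannot pass through the ninth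
  point since it is not a multiple of \<open>q\<close>.
\<close>

lemma ex_quadrics:
  obtains q r where "q \<in> linear_system {1..9} p 2 (\<lambda>_. 1)" "q \<noteq> 0" "mult_exact 1 q (p 9)"
    "linear_system {1..9} p 2 (\<lambda>_. 1) = {Const c * q | c. True}"
    "r \<in> linear_system {1..8} p 2 (\<lambda>_. 1)" "eval_at r (p 9) \<noteq> 0"
proof -
  let ?z = "Poly_Mapping.single 3 2 :: 4 \<Rightarrow>\<^sub>0 nat"
  let ?L = "linear_system {1..9} p 2 (\<lambda>_. 1)"
  obtain q where q: "q \<noteq> 0" "q \<in> ?L"
    using ex_form_with_conditions[of "{1..9 :: nat}" "{}" 2 p] card_quadric_monomials by auto
  obtain r where r: "r \<noteq> 0" "r \<in> linear_system {1..8} p 2 (\<lambda>_. 1)" "lookup r ?z = 0"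
    using ex_form_with_conditions[of "{1..8 :: nat}" "{?z}" 2 p] card_quadric_monomials by auto
  have qz: "lookup q ?z \<noteq> 0" using quadric_bound q by blast
  have span: "?L = {Const c * q | c. True}"
  proof (intro antisym subsetI)
    fix F assume F: "F \<in> ?L"
    let ?c = "lookup F ?z / lookup q ?z"
    have "F - Const ?c * q \<in> ?L"
      using F q(2) by (intro mp.subspace_diff[OF subspace_linear_system] mp.subspace_scale[OF subspace_linear_system])
    moreover have "lookup (F - Const ?c * q) ?z = 0" using qz by (simp add: lookup_minus)
    ultimately have "F - Const ?c * q = 0" by (rule quadric_bound)
    then have "F = Const ?c * q" by simp
    then show "F \<in> {Const c * q | c. True}" by blast
  qed (use q(2) mp.subspace_scale[OF subspace_linear_system] in blast)
  have "mult_exact 1 q (p 9)"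
    unfolding mult_exact_def
  proof
    show "mult_at_least 1 q (p 9)" using linear_systemD(2)[OF q(2), of 9] by simp
    show "\<not> mult_at_least (Suc 1) q (p 9)"
    proof
      assume 2: "mult_at_least (Suc 1) q (p 9)"
      have "q \<in> linear_system {1..9} p 2 (\<lambda>i. if i = 9 then 2 else 1)"
      proof (rule linear_systemI)
        show "homogeneous 2 q" using q(2) by (rule linear_systemD(1))
        show "mult_at_least (if i = 9 then 2 else 1) q (p i)" if "i \<in> {1..9}" for i
          using linear_systemD(2)[OF q(2) that] 2 by (simp add: numeral_2_eq_2)
      qed
      with q(1) show False using quadric_smooth by blast
    qed
  qed
  moreover have "eval_at r (p 9) \<noteq> 0"
  proof
    assume r9: "eval_at r (p 9) = 0"
    have "r \<in> ?L"
    proof (rule linear_systemI)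
      show "homogeneous 2 r" using r(2) by (rule linear_systemD(1))
      show "mult_at_least 1 r (p i)" if "i \<in> {1..9}" for i
      proof (cases "i = 9")
        case True
        then show ?thesis unfolding mult_at_least_1_iff using r9 by simp
      next
        case False
        then show ?thesis using that by (intro linear_systemD(2)[OF r(2)]) auto
      qed
    qed
    then show False using quadric_bound r(1,3) by blast
  qed
  ultimately show ?thesis using that q span r(2) by blast
qed

text \<open>
  A reducible quadric consists of two planes, one of which would contain four of the first eight
  points.
\<close>

lemma quadric_irreducible:
  assumes q: "q \<in> linear_system {1..9} p 2 (\<lambda>_. 1)" "q \<noteq> 0"
  shows "irreducible q"
proof (rule irreducibleI)
  have vanish: "eval_at q (p i) = 0" if "i \<in> {1..9}" for i
    using linear_systemD(2)[OF q(1) that] mult_at_least_1_iff by blast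
  show "q \<noteq> 0" by fact
  show "\<not> q dvd 1"
  proof
    assume "q dvd 1"
    then obtain u where u: "1 = q * u" by (rule dvdE)
    have "1 = eval_at (q * u) (p 9)" unfolding u[symmetric] by simp
    then show False using vanish[of 9] by simp
  qed
  have no_planes: False
    if AB: "q = A * B" "homogeneous 1 A" "homogeneous 1 B" for A B
  proof -
    let ?J = "\<lambda>F. {i \<in> {1..8}. eval_at F (p i) = 0}"
    have few: "card (?J F) < 4" if F: "homogeneous 1 F" "F \<noteq> 0" for F
    proof (rule ccontr)
      assume "\<not> card (?J F) < 4"
      then obtain J where J: "J \<subseteq> ?J F" "card J = 4"
        using obtain_subset_with_card_n[of 4 "?J F"] by auto
      then have "F \<in> linear_system J p 1 (\<lambda>_. 1)"
        using F(1) by (intro linear_systemI) (auto simp: mult_at_least_1_iff simp del: One_nat_def)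
      then have "F = 0" using J by (intro not_coplanar) auto
      with F(2) show False by simp
    qed
    have "{1..8} \<subseteq> ?J A \<union> ?J B"
    proof
      fix i :: nat assume i: "i \<in> {1..8}"
      then have "eval_at q (p i) = 0" by (intro vanish) auto
      then show "i \<in> ?J A \<union> ?J B" using i by (auto simp: AB(1))
    qed
    then have "card {1..8 :: nat} \<le> card (?J A \<union> ?J B)" by (rule card_mono[rotated]) simp
    also have "\<dots> \<le> card (?J A) + card (?J B)" by (rule card_Un_le)
    also have "\<dots> < 4 + 4" using few AB q(2) by (intro add_strict_mono) auto
    finally show False by simp
  qed
  fix A B assume AB: "q = A * B"
  have "homogeneous 2 q" using q(1) by (rule linear_systemD(1))
  then obtain k l where kl: "homogeneous k A" "homogeneous l B" "k + l = 2"
    using homogeneous_factors[of 2 A B] AB q(2) by blast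
  have unit: "F dvd 1" if F: "homogeneous 0 F" "F \<noteq> 0" for F :: "4 mpoly"
  proof -
    have eq: "F = Const (lookup F 0)"
      by (rule poly_mapping_eqI) (use F(1) in \<open>auto simp: lookup_Const mon_degree_eq_0_iff dest: homogeneousD\<close>)
    then have "lookup F 0 \<noteq> 0" using F(2) by (metis Const_0)
    then have "1 = Const (lookup F 0) * Const (1 / lookup F 0)" unfolding Const_mult[symmetric] by simp
    then show ?thesis using eq by (metis dvd_triv_left)
  qed
  have nz: "A \<noteq> 0" "B \<noteq> 0" using AB q(2) by auto
  consider "k = 0" | "l = 0" | "k = 1" "l = 1" using kl(3) by linarith
  then show "A dvd 1 \<or> B dvd 1"
  proof cases
    case 1 then show ?thesis using unit kl(1) nz by blast
  next
    case 2 then show ?thesis using unit kl(2) nz by blast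
  next
    case 3 then show ?thesis using no_planes AB kl by blast
  qed
qed

end

lemma choose_3: "6 * (n choose 3) = n * (n - 1) * (n - 2)"
proof -
  have "real (n choose 3) = real n * real (n - 1) * real (n - 2) / 6" if "n \<ge> 2"
    using that by (simp add: binomial_gbinomial gbinomial_prod_rev eval_nat_numeral fact_numeral of_nat_diff)
  then have "real (6 * (n choose 3)) = real (n * (n - 1) * (n - 2))" if "n \<ge> 2" using that by simp
  then have "6 * (n choose 3) = n * (n - 1) * (n - 2)" if "n \<ge> 2" using that by (simp only: of_nat_eq_iff)
  moreover have "6 * (n choose 3) = n * (n - 1) * (n - 2)" if "n < 2" using that by (simp add: binomial_eq_0)
  ultimately show ?thesis by (meson not_less)
qed

context nine_points
begin

text \<open>
  In the expansion of a form of degree \<open>2 m\<close> in \<open>q\<close> and \<open>r\<close>, multiplicity \<open>a\<close> at the last point means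
  that the first \<open>a\<close> coefficients vanish. The form \<open>q\<^sup>a r\<^bsup>m - a\<^esup>\<close> is not divisible by a higher power of
  \<open>q\<close>, as \<open>r\<close> does not vanish at the last point.
\<close>

lemma nine_point_system:
  assumes q: "q \<in> linear_system {1..9} p 2 (\<lambda>_. 1)" "q \<noteq> 0" "mult_exact 1 q (p 9)"
    and r: "r \<in> linear_system {1..8} p 2 (\<lambda>_. 1)" "eval_at r (p 9) \<noteq> 0"
    and N: "m \<in> N" "m - a \<in> N" and a: "a \<le> m"
  shows "linear_system {1..9} p (2 * m) (mults m a) =
      {q ^ a * G | G. G \<in> linear_system {1..8} p (2 * (m - a)) (\<lambda>_. m - a)}"
    and "dim_ls {1..9} p (2 * m) (mults m a) = m - a + 1"
    and "dim_ls {1..8} p (2 * (m - a)) (\<lambda>_. m - a) = m - a + 1"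
    and "base_multiplicity q (linear_system {1..9} p (2 * m) (mults m a)) a"
proof -
  let ?L = "linear_system {1..9} p (2 * m) (mults m a)"
  let ?b = "m - a"
  have q8: "q \<in> linear_system {1..8} p 2 (\<lambda>_. 1)"
    using q(1) linear_system_antimono[of "{1..8 :: nat}" "{1..9}"] by auto
  have pencil: "linear_system {1..8} p (2 * b) (\<lambda>_. b) = {(\<Sum>i\<le>b. Const (c i) * (q ^ i * r ^ (b - i))) | c. True}"
      "dim_ls {1..8} p (2 * b) (\<lambda>_. b) = b + 1" if "b \<in> N" for b
    using pencil_system[OF q(3) r(2) q8 r(1) finite_leading_monomials card_leading_monomials, of b]
      power_system_bound[OF that] by (simp_all only: mult.commute[of b])
  show "dim_ls {1..8} p (2 * ?b) (\<lambda>_. ?b) = ?b + 1" using pencil(2) N(2) .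
  have mults_8: "mults m a i = m" if "i \<in> {1..8}" for i using that by (simp add: mults_def)
  have mults_9: "mults m a 9 = a" by (simp add: mults_def)
  have into: "q ^ a * G \<in> ?L" if G: "G \<in> linear_system {1..8} p (2 * ?b) (\<lambda>_. ?b)" for G
  proof (rule linear_systemI)
    have "homogeneous (a * 2 + 2 * ?b) (q ^ a * G)"
      using linear_systemD(1)[OF q(1)] linear_systemD(1)[OF G] by (intro homogeneous_mult homogeneous_power)
    moreover have "a * 2 + 2 * ?b = 2 * m" using a by simp
    ultimately show "homogeneous (2 * m) (q ^ a * G)" by (simp only:)
    fix i :: nat assume i: "i \<in> {1..9}"
    have qa: "mult_at_least (a * 1) (q ^ a) (p i)"
      using linear_systemD(2)[OF q(1) i] by (rule mult_at_least_power)
    show "mult_at_least (mults m a i) (q ^ a * G) (p i)"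
    proof (cases "i = 9")
      case True
      then show ?thesis using qa by (simp add: mults_9 mult_at_least_mult_right)
    next
      case False
      then have i8: "i \<in> {1..8}" using i by auto
      have "mult_at_least (a * 1 + ?b) (q ^ a * G) (p i)"
        using qa linear_systemD(2)[OF G i8] by (rule mult_at_least_mult)
      moreover have "a * 1 + ?b = m" using a by simp
      ultimately show ?thesis using mults_8[OF i8] by simp
    qed
  qed
  have onto: "\<exists>G\<in>linear_system {1..8} p (2 * ?b) (\<lambda>_. ?b). F = q ^ a * G" if F: "F \<in> ?L" for F
  proof -
    have "F \<in> linear_system {1..8} p (2 * m) (\<lambda>_. m)"
    proof (rule linear_systemI)
      show "homogeneous (2 * m) F" using F by (rule linear_systemD(1))
      fix i :: nat assume i: "i \<in> {1..8}"
      then have "i \<in> {1..9}" by auto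
      from linear_systemD(2)[OF F this] show "mult_at_least m F (p i)" by (simp only: mults_8[OF i])
    qed
    then obtain c where c: "F = (\<Sum>i\<le>m. Const (c i) * (q ^ i * r ^ (m - i)))"
      using pencil(1)[OF N(1)] by blast
    have "mult_at_least a F (p 9)" using linear_systemD(2)[OF F, of 9] by (simp add: mults_9)
    then have zero: "c i = 0" if "i < a" for i
      using pencil_coefficients[OF q(3) r(2), where k = a and b = m and a = c and i = i] that a c by simp
    let ?G = "\<Sum>j\<le>?b. Const (c (j + a)) * (q ^ j * r ^ (?b - j))"
    have "F = (\<Sum>i\<in>{a..m}. Const (c i) * (q ^ i * r ^ (m - i)))"
      unfolding c by (rule sum.mono_neutral_right) (use zero in auto)
    also have "{a..m} = (\<lambda>j. j + a) ` {..?b}"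
    proof (intro set_eqI iffI)
      fix i assume "i \<in> {a..m}"
      then have "i = (i - a) + a" "i - a \<in> {..?b}" by auto
      then show "i \<in> (\<lambda>j. j + a) ` {..?b}" by (rule image_eqI)
    qed (use a in auto)
    also have "(\<Sum>i\<in>(\<lambda>j. j + a) ` {..?b}. Const (c i) * (q ^ i * r ^ (m - i)))
        = (\<Sum>j\<le>?b. Const (c (j + a)) * (q ^ (j + a) * r ^ (m - (j + a))))"
      by (subst sum.reindex) (simp_all add: inj_on_def)
    also have "\<dots> = q ^ a * ?G"
      unfolding sum_distrib_left
    proof (rule sum.cong[OF refl])
      fix j
      have "m - (j + a) = ?b - j" by simp
      then show "Const (c (j + a)) * (q ^ (j + a) * r ^ (m - (j + a)))
          = q ^ a * (Const (c (j + a)) * (q ^ j * r ^ (?b - j)))"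
        by (simp only: power_add ac_simps)
    qed
    finally have "F = q ^ a * ?G" .
    moreover have "?G \<in> linear_system {1..8} p (2 * ?b) (\<lambda>_. ?b)"
      unfolding pencil(1)[OF N(2)] by (intro CollectI exI[of _ "\<lambda>j. c (j + a)"]) simp
    ultimately show ?thesis by blast
  qed
  show shape: "?L = {q ^ a * G | G. G \<in> linear_system {1..8} p (2 * ?b) (\<lambda>_. ?b)}"
    using into onto by blast
  let ?f = "\<lambda>j. q ^ a * (q ^ j * r ^ (?b - j))"
  have f: "?f j \<in> ?L" if "j \<le> ?b" for j
  proof (rule into)
    have "q ^ j * r ^ (?b - j) \<in> linear_system {1..8} p (j * 2 + (?b - j) * 2) (\<lambda>_. j * 1 + (?b - j) * 1)"
      using q8 r(1) by (intro linear_system_mult linear_system_power)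
    moreover have "j * 2 + (?b - j) * 2 = 2 * ?b" "j * 1 + (?b - j) * 1 = ?b" using that by simp_all
    ultimately show "q ^ j * r ^ (?b - j) \<in> linear_system {1..8} p (2 * ?b) (\<lambda>_. ?b)" by (simp only:)
  qed
  have factor: "(\<Sum>j\<le>?b. Const (x j) * ?f j) = q ^ a * (\<Sum>j\<le>?b. Const (x j) * (q ^ j * r ^ (?b - j)))" for x
    by (simp only: sum_distrib_left mult.left_commute)
  have "\<forall>j\<in>{..?b}. x j = 0" if x: "(\<Sum>j\<in>{..?b}. Const (x j) * ?f j) = 0" for x
  proof
    fix j assume j: "j \<in> {..?b}"
    have "q ^ a * (\<Sum>j\<le>?b. Const (x j) * (q ^ j * r ^ (?b - j))) = 0" using x unfolding factor .
    then have "(\<Sum>j\<le>?b. Const (x j) * (q ^ j * r ^ (?b - j))) = 0" using q(2) by simp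
    then have "mult_at_least (Suc ?b) (\<Sum>j\<le>?b. Const (x j) * (q ^ j * r ^ (?b - j))) (p 9)" by simp
    then show "x j = 0"
      using pencil_coefficients[OF q(3) r(2), where k = "Suc ?b" and b = ?b and a = x and i = j] j by simp
  qed
  note family = mp.independent_family[where f = ?f, OF finite_atMost this]
  have sub: "?f ` {..?b} \<subseteq> ?L" using f by auto
  have "?L \<subseteq> mp.span (?f ` {..?b})"
  proof
    fix F assume "F \<in> ?L"
    then obtain G where G: "G \<in> linear_system {1..8} p (2 * ?b) (\<lambda>_. ?b)" "F = q ^ a * G" using onto by blast
    obtain c where "G = (\<Sum>j\<le>?b. Const (c j) * (q ^ j * r ^ (?b - j)))" using G(1) pencil(1)[OF N(2)] by blast
    then have "F = (\<Sum>j\<le>?b. Const (c j) * ?f j)" unfolding G(2) factor by (simp only:)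
    also have "\<dots> \<in> mp.span (?f ` {..?b})"
      by (intro mp.span_sum mp.span_scale mp.span_base imageI)
    finally show "F \<in> mp.span (?f ` {..?b})" .
  qed
  from mp.basis_card_eq_dim[OF sub this family(2)]
  show "dim_ls {1..9} p (2 * m) (mults m a) = ?b + 1"
    unfolding dim_ls_def using card_image[OF family(1)] by simp
  show "base_multiplicity q ?L a"
    unfolding base_multiplicity_def
  proof (intro conjI ballI bexI)
    show "q ^ a dvd F" if "F \<in> ?L" for F using onto[OF that] by auto
    show "?f 0 \<in> ?L" by (rule f) simp
    show "\<not> q ^ Suc a dvd ?f 0"
    proof
      assume "q ^ Suc a dvd ?f 0"
      then have "q ^ a * q dvd q ^ a * r ^ ?b" by (simp add: mult.commute)
      then have "q dvd r ^ ?b" using q(2) by simp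
      then obtain u where u: "r ^ ?b = q * u" by (rule dvdE)
      have "eval_at q (p 9) = 0" using q(3) unfolding mult_exact_def mult_at_least_1_iff by blast
      then have "eval_at (r ^ ?b) (p 9) = 0" unfolding u by simp
      then show False using r(2) by simp
    qed
  qed
qed

end

lemma vdim_eight_points: "vdim 3 {1..8 :: nat} (2 * b) (\<lambda>_. b) = int b + 1"
proof -
  have "6 * ((3 + 2 * b) choose 3) = (2 * b + 3) * (2 * b + 2) * (2 * b + 1)"
    unfolding choose_3 by (simp add: ac_simps)
  then have 1: "6 * int ((3 + 2 * b) choose 3) = (2 * int b + 3) * (2 * int b + 2) * (2 * int b + 1)"
    by (metis (mono_tags) of_nat_mult of_nat_add of_nat_numeral of_nat_1)
  have "6 * ((3 + b - 1) choose 3) = (b + 2) * (b + 1) * b"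
    unfolding choose_3 by (simp add: ac_simps)
  then have 2: "6 * int ((3 + b - 1) choose 3) = (int b + 2) * (int b + 1) * int b"
    by (metis (mono_tags) of_nat_mult of_nat_add of_nat_numeral of_nat_1)
  have "6 * vdim 3 {1..8 :: nat} (2 * b) (\<lambda>_. b) = 6 * (int b + 1)"
    unfolding vdim_def right_diff_distrib 1 using 2 by (simp add: algebra_simps)
  then show ?thesis by simp
qed

lemma vdim_nine_points:
  "vdim 3 {1..9} (2 * m) (mults m a) = int m + 1 - (int a + int ((a + 1) choose 3) + int (a choose 2))"
proof -
  have "{1..9 :: nat} = insert 9 {1..8}" by auto
  then have "(\<Sum>i\<in>{1..9 :: nat}. int ((3 + mults m a i - 1) choose 3))
      = int ((3 + a - 1) choose 3) + (\<Sum>i\<in>{1..8 :: nat}. int ((3 + m - 1) choose 3))"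
    by (simp add: mults_def)
  then have "vdim 3 {1..9} (2 * m) (mults m a) = vdim 3 {1..8 :: nat} (2 * m) (\<lambda>_. m) - int ((3 + a - 1) choose 3)"
    unfolding vdim_def by simp
  moreover have "(3 + a - 1) choose 3 = a + ((a + 1) choose 3) + (a choose 2)"
    by (simp add: eval_nat_numeral)
  ultimately show ?thesis unfolding vdim_eight_points by simp
qed

theorem theorem3p1:
  fixes a m :: nat
  assumes "1 \<le> a" and "a \<le> m"
  shows "for_general_points {1..9} (\<lambda>p :: nat \<Rightarrow> complex ^ 4.
    dim_ls {1..9} p (2 * m) (mults m a) = m - a + 1 \<and>
    h1 {1..9} p (2 * m) (mults m a) = enat (((a + 1) choose 3) + (a choose 2)) \<and>
    (special {1..9} p (2 * m) (mults m a) \<longleftrightarrow> 2 \<le> a \<and> a \<le> m) \<and>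
    (\<exists>q. irreducible q \<and>
         linear_system {1..9} p 2 (\<lambda>_. 1) = {Const c * q | c. True} \<and>
         linear_system {1..9} p (2 * m) (mults m a) =
           {q ^ a * G | G. G \<in> linear_system {1..8} p (2 * (m - a)) (\<lambda>_. m - a)} \<and>
         \<not> special {1..8} p (2 * (m - a)) (\<lambda>_. m - a) \<and>
         base_multiplicity q (linear_system {1..9} p (2 * m) (mults m a)) a))"
proof (rule for_general_points_if_generically[OF generically_general_conditions[of "{m, m - a}"]])
  show "finite {m, m - a}" by simp
next
  fix p :: "nat \<Rightarrow> complex ^ 4"
  assume "general_conditions {m, m - a} p" "\<And>i. i \<in> {1..9} \<Longrightarrow> p i \<noteq> 0"
  then interpret nine_points p "{m, m - a}" by unfold_locales
  obtain q r where q: "q \<in> linear_system {1..9} p 2 (\<lambda>_. 1)" "q \<noteq> 0" "mult_exact 1 q (p 9)"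
    and span: "linear_system {1..9} p 2 (\<lambda>_. 1) = {Const c * q | c. True}"
    and r: "r \<in> linear_system {1..8} p 2 (\<lambda>_. 1)" "eval_at r (p 9) \<noteq> 0"
    by (rule ex_quadrics)
  note system = nine_point_system[OF q r insertI1 insertI2[OF singletonI] assms(2)]
  have four: "CARD(4) - 1 = 3" by simp
  have defect: "0 < ((a + 1) choose 3) + (a choose 2) \<longleftrightarrow> 2 \<le> a"
    using assms(1) by (cases "a = 1") (auto simp: zero_less_binomial_iff)
  have h1: "h1 {1..9} p (2 * m) (mults m a) = enat (((a + 1) choose 3) + (a choose 2))"
  proof -
    interpret fat_points "{1..9}" p "2 * m" "mults m a"
    proof
      show "separated {1..9} p" by (rule separated_points)
      show "1 \<le> mults m a i \<and> mults m a i \<le> 2 * m + 1" if "i \<in> {1..9}" for i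
        using assms by (simp add: mults_def)
    qed simp_all
    obtain n where n: "h1 {1..9} p (2 * m) (mults m a) = enat n"
      "int n = int (dim_ls {1..9} p (2 * m) (mults m a)) - vdim (CARD(4) - 1) {1..9} (2 * m) (mults m a)"
      by (rule h1_eq_dim_minus_vdim)
    have "int n = int (((a + 1) choose 3) + (a choose 2))"
      using n(2) assms unfolding four vdim_nine_points system(2) by (simp add: of_nat_diff)
    then show ?thesis using n(1) by (simp only: of_nat_eq_iff)
  qed
  have special9: "special {1..9} p (2 * m) (mults m a) \<longleftrightarrow> 2 \<le> a \<and> a \<le> m"
  proof -
    define x where "x = int ((a + 1) choose 3)"
    define y where "y = int (a choose 2)"
    have "0 < x + y \<longleftrightarrow> 2 \<le> a" using defect unfolding x_def y_def by linarith
    then show ?thesis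
      unfolding special_def edim_def four vdim_nine_points system(2) x_def[symmetric] y_def[symmetric]
      using assms by linarith
  qed
  have special8: "\<not> special {1..8} p (2 * (m - a)) (\<lambda>_. m - a)"
    unfolding special_def edim_def four vdim_eight_points system(3) by simp
  show "dim_ls {1..9} p (2 * m) (mults m a) = m - a + 1 \<and>
    h1 {1..9} p (2 * m) (mults m a) = enat (((a + 1) choose 3) + (a choose 2)) \<and>
    (special {1..9} p (2 * m) (mults m a) \<longleftrightarrow> 2 \<le> a \<and> a \<le> m) \<and>
    (\<exists>q. irreducible q \<and>
         linear_system {1..9} p 2 (\<lambda>_. 1) = {Const c * q | c. True} \<and>
         linear_system {1..9} p (2 * m) (mults m a) =
           {q ^ a * G | G. G \<in> linear_system {1..8} p (2 * (m - a)) (\<lambda>_. m - a)} \<and>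
         \<not> special {1..8} p (2 * (m - a)) (\<lambda>_. m - a) \<and>
         base_multiplicity q (linear_system {1..9} p (2 * m) (mults m a)) a)"
    using system(2) h1 special9 quadric_irreducible[OF q(1,2)] span system(1) special8 system(4) by blast
qed

end
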